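(* Let $k\ge1$, let $p_1,\ldots,p_k,q\ge1$ be integers and $\sigma_1,\ldots,\sigma_k,\sigma\in\{\pm1\}$ with $(q,\sigma)\ne(1,1)$. If the sum $p_1+\cdots+p_k+q+k$ and the integer $\frac{1-\sigma_1\cdots\sigma_k\sigma}{2}$ are of the same parity, then the Euler $T$-sum $T_{p_1,\ldots,p_k,q}^{\sigma_1,\ldots,\sigma_k,\sigma}$ of degree $k$ is reducible to (i.e. is a polynomial with rational coefficients in) (alternating) Euler sums and (alternating) Euler $T$-sums of degrees lower than $k$.
   Context: For $\sigma\in\{\pm1\}$, $n\ge0$, $r\ge1$: $h_n^{(r)}(\sigma)=\sum_{j=1}^n\frac{\sigma^{j-1}}{(j-1/2)^r}$ and $H_n^{(r)}(\sigma)=\sum_{j=1}^n\frac{\sigma^{j-1}}{j^r}$. For $(q,\sigma)\ne(1,1)$ and $k\ge0$, the (alternating) Euler $T$-sums and Euler sums of degree $k$ are $T_{p_1,\ldots,p_k,q}^{\sigma_1,\ldots,\sigma_k,\sigma}=\sum_{n\ge1}\sigma^{n-1}\frac{h_{n-1}^{(p_1)}(\sigma_1)\cdots h_{n-1}^{(p_k)}(\sigma_k)}{(n-1/2)^q}$ and $S_{p_1,\ldots,p_k,q}^{\sigma_1,\ldots,\sigma_k,\sigma}=\sum_{n\ge1}\sigma^{n-1}\frac{H_{n}^{(p_1)}(\sigma_1)\cdots H_{n}^{(p_k)}(\sigma_k)}{n^q}$. Degree $0$ sums are $\sum_{n\ge1}\frac{\sigma^{n-1}}{(n-1/2)^q}$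 and $\sum_{n\ge1}\frac{\sigma^{n-1}}{n^q}$ (e.g. $\ln 2=\sum_{n\ge1}(-1)^{n-1}/n$). *)

theory Defs
  imports Complex_Main "HOL-Library.Multiset"
begin

definition h_harm :: "nat \<Rightarrow> int \<Rightarrow> nat \<Rightarrow> real" where
  "h_harm r \<sigma> n = (\<Sum>j=1..n. of_int \<sigma> ^ (j - 1) / (real j - 1/2) ^ r)"

definition H_harm :: "nat \<Rightarrow> int \<Rightarrow> nat \<Rightarrow> real" where
  "H_harm r \<sigma> n = (\<Sum>j=1..n. of_int \<sigma> ^ (j - 1) / real j ^ r)"

text \<open>The parameters \<open>(p\<^sub>1, \<dots>, p\<^sub>k)\<close> and \<open>(\<sigma>\<^sub>1, \<dots>, \<sigma>\<^sub>k)\<close> are functions on \<open>nat\<close>, of which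
  only the values on \<open>{1..k}\<close> are used; \<open>k\<close> is the degree. The infinite sums run over \<open>n \<ge> 1\<close>,
  so the summand is taken at \<open>Suc n\<close>. They converge in the usual sense of partial sums for all
  admissible parameters, but only conditionally when \<open>q = 1\<close>.\<close>

definition Euler_T_term ::
  "nat \<Rightarrow> (nat \<Rightarrow> nat) \<Rightarrow> (nat \<Rightarrow> int) \<Rightarrow> nat \<Rightarrow> int \<Rightarrow> nat \<Rightarrow> real" where
  "Euler_T_term k p s q \<sigma> n =
     of_int \<sigma> ^ (n - 1) * (\<Prod>i=1..k. h_harm (p i) (s i) (n - 1)) / (real n - 1/2) ^ q"

definition Euler_T_sum ::
  "nat \<Rightarrow> (nat \<Rightarrow> nat) \<Rightarrow> (nat \<Rightarrow> int) \<Rightarrow> nat \<Rightarrow> int \<Rightarrow> real" where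
  "Euler_T_sum k p s q \<sigma> = (\<Sum>n. Euler_T_term k p s q \<sigma> (Suc n))"

definition Euler_S_term ::
  "nat \<Rightarrow> (nat \<Rightarrow> nat) \<Rightarrow> (nat \<Rightarrow> int) \<Rightarrow> nat \<Rightarrow> int \<Rightarrow> nat \<Rightarrow> real" where
  "Euler_S_term k p s q \<sigma> n =
     of_int \<sigma> ^ (n - 1) * (\<Prod>i=1..k. H_harm (p i) (s i) n) / real n ^ q"

definition Euler_S_sum ::
  "nat \<Rightarrow> (nat \<Rightarrow> nat) \<Rightarrow> (nat \<Rightarrow> int) \<Rightarrow> nat \<Rightarrow> int \<Rightarrow> real" where
  "Euler_S_sum k p s q \<sigma> = (\<Sum>n. Euler_S_term k p s q \<sigma> (Suc n))"

definition Euler_admissible ::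
  "nat \<Rightarrow> (nat \<Rightarrow> nat) \<Rightarrow> (nat \<Rightarrow> int) \<Rightarrow> nat \<Rightarrow> int \<Rightarrow> bool" where
  "Euler_admissible k p s q \<sigma> \<longleftrightarrow>
     (\<forall>i\<in>{1..k}. 1 \<le> p i \<and> s i \<in> {1, -1}) \<and> 1 \<le> q \<and> \<sigma> \<in> {1, -1} \<and> (q, \<sigma>) \<noteq> (1, 1)"

definition Euler_sums_below :: "nat \<Rightarrow> real set" where
  "Euler_sums_below k =
     {Euler_S_sum j p s q \<sigma> | j p s q \<sigma>. j < k \<and> Euler_admissible j p s q \<sigma>} \<union>
     {Euler_T_sum j p s q \<sigma> | j p s q \<sigma>. j < k \<and> Euler_admissible j p s q \<sigma>}"

text \<open>\<open>x\<close> is the value of a polynomial with rational coefficients at finitely many elements of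
  \<open>A\<close>: a monomial is a finite multiset of elements of \<open>A\<close>, and \<open>c m\<close> is the coefficient of the
  monomial \<open>m\<close>. The empty multiset gives the constant term.\<close>

definition rat_polynomial_in :: "real set \<Rightarrow> real \<Rightarrow> bool" where
  "rat_polynomial_in A x \<longleftrightarrow>
     (\<exists>(M :: real multiset set) (c :: real multiset \<Rightarrow> rat).
        finite M \<and> (\<forall>m\<in>M. set_mset m \<subseteq> A) \<and> x = (\<Sum>m\<in>M. of_rat (c m) * prod_mset m))"

end

theory Submission
  imports Defs "HOL-Complex_Analysis.Complex_Analysis"
begin

text \<open>
  With \<open>\<psi>\<^sub>i(z) = \<Sum>j\<ge>0. \<sigma>\<^sub>i\<^sup>j / (j - z)\<^bsup>p\<^sub>i\<^esup>\<close> (regularised if divergent) put \<open>F(z) = \<psi>\<^sub>1(z) \<cdots> \<psi>\<^sub>k(z) / z\<^sup>q\<close>. At the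
  half-integers \<open>\<plusminus>(m + 1/2)\<close> the values of \<open>\<psi>\<^sub>i\<close> are constants plus multiples of \<open>h\<^sub>m\<close>, so \<open>F(m + 1/2)\<close> and
  \<open>F(-(m + 1/2))\<close>, weighted with the powers of \<open>t = \<sigma>\<^sub>1 \<cdots> \<sigma>\<^sub>k \<sigma>\<close>, both contribute the term of the \<open>T\<close>-sum
  up to sign and lower degree; the parity condition says exactly that these two contributions do not cancel.
  On the other hand \<open>F\<close> is the sum of its principal parts at the integers \<open>n \<ge> 0\<close>. Their coefficients are
  polynomials in \<open>1/n\<close> and in the numbers \<open>H\<^sub>n\<close>, of degree less than \<open>k\<close> because at least one \<open>\<psi>\<^sub>i\<close> contributes its
  pole, and summing \<open>t\<^bsup>x + 1/2\<^esup> / (x - n)\<^sup>d\<close> over all half-integers \<open>x\<close> gives \<open>t\<^sup>n\<close> times a sum of degree \<open>0\<close>.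

  The expansion of \<open>F\<close> follows from the residue theorem for the truncations of the \<open>\<psi>\<^sub>i\<close>, which are rational
  functions. For \<open>q = 1\<close> the sums converge only conditionally; the interchange of summations then
  rests on summation by parts.
\<close>

section \<open>Residues of rational functions\<close>

text \<open>Truncating first means that residues are taken only of rational functions vanishing at
  infinity, so no growth of digamma-like functions on contours has to be estimated; the truncation
  is removed afterwards, over the reals, by dominated convergence. The sign count: let
  \<open>P\<close> be the sum of the \<open>p i\<close> and \<open>e\<close> the product of the
  \<open>s i\<close>. The term with the product of all \<open>h_harm\<close> has coefficient
  \<open>e ^ m * (-1) ^ P\<close> at \<open>m + 1/2\<close> and
  \<open>e ^ m * (-1) ^ (k + q)\<close> at \<open>-(m + 1/2)\<close>. The weights
  \<open>t ^ (m + 1)\<close> and \<open>t ^ m\<close> with \<open>t = e * \<sigma>\<close> turn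
  these into \<open>\<sigma> ^ m\<close> times \<open>\<sigma> * e * (-1) ^ P\<close> and
  \<open>\<sigma> ^ m\<close> times \<open>(-1) ^ (k + q)\<close>. The obstacle is
  \<open>q = 1\<close>: the series over the poles \<open>n\<close> carries only
  \<open>1 / n\<close>, while the kernel over \<open>\<bar>x\<bar> < N\<close> can grow
  logarithmically in \<open>n\<close>. Summation by parts puts differences on the kernel, and these
  are large near \<open>n = N\<close>, a place that moves with \<open>N\<close>. Two facts make this
  harmless: the kernel, suitably signed, has a limit independent of \<open>n\<close>, and the
  weights are already small near \<open>n = N\<close>.\<close>

lemma has_fps_expansion_inverse_power:
  fixes l :: complex
  assumes "l \<noteq> 0" "p > 0"
  shows "(\<lambda>z. 1 / (l - z) ^ p) has_fps_expansion
           Abs_fps (\<lambda>f. of_nat ((p + f - 1) choose f) / l ^ (p + f))"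
proof -
  have *: "(\<lambda>z. (1 / l ^ p) * inverse ((1 - (1 / l) * z) ^ p)) has_fps_expansion
          fps_const (1 / l ^ p) * inverse ((1 - fps_const (1 / l) * fps_X) ^ p)"
    by (intro fps_expansion_intros has_fps_expansion_mult has_fps_expansion_inverse) auto
  have "fps_const (1 / l ^ p) * inverse ((1 - fps_const (1 / l) * fps_X) ^ p) =
         Abs_fps (\<lambda>f. of_nat ((p + f - 1) choose f) / l ^ (p + f))"
    using assms
    by (subst one_minus_const_fps_X_neg_power') (auto simp: fps_eq_iff power_add field_simps)
  moreover have "(1 / l ^ p) * inverse ((1 - (1 / l) * z) ^ p) = 1 / (l - z) ^ p" for z
  proof -
    have "l - z = l * (1 - (1 / l) * z)"
      using assms by (simp add: field_simps)
    hence "(l - z) ^ p = l ^ p * (1 - (1 / l) * z) ^ p"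
      by (metis power_mult_distrib)
    thus ?thesis by (simp add: field_simps)
  qed
  ultimately show ?thesis using * by simp
qed

text \<open>On a circle of large radius \<open>R\<close> the integrand is at most
  \<open>e / R\<close>, so the integral, which is 2 pi i times the sum of all residues, is at most 2
  pi e for every \<open>e > 0\<close>.\<close>

lemma sum_residues_eq_0:
  fixes g :: "complex \<Rightarrow> complex"
  assumes "finite A" "g holomorphic_on -A" "((\<lambda>s. s * g s) \<longlongrightarrow> 0) at_infinity"
  shows "(\<Sum>a\<in>A. residue g a) = 0"
proof -
  define S where "S = (\<Sum>a\<in>A. residue g a)"
  obtain B where B: "\<And>a. a \<in> A \<Longrightarrow> norm a \<le> B"
    using finite_imp_bounded[OF assms(1)] by (auto simp: bounded_iff)
  have "norm S \<le> e" if "e > 0" for e :: real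
  proof -
    have "eventually (\<lambda>s. norm (s * g s) < e) at_infinity"
      using assms(3) that by (auto simp: tendsto_iff dist_norm)
    then obtain R0 where R0: "\<And>s. norm s \<ge> R0 \<Longrightarrow> norm (s * g s) < e"
      by (auto simp: eventually_at_infinity)
    define R where "R = max (max R0 B) 0 + 1"
    have R: "R > 0" "R \<ge> R0" "R > B" by (auto simp: R_def)
    have wind: "winding_number (circlepath 0 R) a = 1" if "a \<in> A" for a
      using B[OF that] R by (intro winding_number_circlepath) auto
    have "contour_integral (circlepath 0 R) g =
            2 * pi * \<i> * (\<Sum>p\<in>A. winding_number (circlepath 0 R) p * residue g p)"
      by (rule Residue_theorem[where S = UNIV])
         (use assms R in \<open>auto simp: Compl_eq_Diff_UNIV dest!: B\<close>)
    also have "(\<Sum>p\<in>A. winding_number (circlepath 0 R) p * residue g p) = S"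
      unfolding S_def by (intro sum.cong) (auto simp: wind)
    finally have eq: "contour_integral (circlepath 0 R) g = 2 * pi * \<i> * S" .
    have sub: "sphere 0 R \<subseteq> -A"
      using R by (auto dest!: B)
    have "continuous_on (path_image (circlepath 0 R)) g"
      using sub R
      by (intro continuous_on_subset[OF holomorphic_on_imp_continuous_on[OF assms(2)]]) auto
    hence "g contour_integrable_on circlepath 0 R"
      by (rule contour_integrable_continuous_circlepath)
    hence "(g has_contour_integral 2 * pi * \<i> * S) (circlepath 0 R)"
      using eq has_contour_integral_integral by metis
    hence "norm (2 * pi * \<i> * S) \<le> (e / R) * (2 * pi * R)"
    proof (rule has_contour_integral_bound_circlepath)
      fix s :: complex assume "norm (s - 0) = R"
      hence "norm (s * g s) < e" using R0[of s] R by simp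
      thus "norm (g s) \<le> e / R" using \<open>norm (s - 0) = R\<close> R by (simp add: norm_mult field_simps)
    qed (use that R in auto)
    thus "norm S \<le> e" using R by (simp add: norm_mult)
  qed
  hence "norm S \<le> 0" by (rule field_le_epsilon[of _ 0, simplified])
  thus ?thesis by (simp add: S_def)
qed

text \<open>The residues of \<open>f s / (s - x)\<close> add up to 0, the extra denominator turning
  \<open>f \<longlonglongrightarrow> 0\<close> into the decay required. The residue at
  \<open>x\<close> is \<open>f x\<close>; the one at a pole \<open>a\<close> is minus the principal
  part of \<open>f\<close> at \<open>a\<close>, evaluated at \<open>x\<close>.\<close>

lemma partial_fraction_expansion:
  fixes f :: "complex \<Rightarrow> complex"
  assumes fin: "finite A" and x: "x \<notin> A" and holo: "f holomorphic_on -A"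
    and lim: "(f \<longlongrightarrow> 0) at_infinity"
    and V: "\<And>a. a \<in> A \<Longrightarrow> V a has_fps_expansion U a"
    and f: "\<And>a. a \<in> A \<Longrightarrow> eventually (\<lambda>z. f (a + z) = V a z / z ^ D a) (at 0)"
    and D: "\<And>a. a \<in> A \<Longrightarrow> D a > 0"
  shows "f x = (\<Sum>a\<in>A. \<Sum>d<D a. fps_nth (U a) (D a - 1 - d) / (x - a) ^ (d + 1))"
proof -
  define g where "g = (\<lambda>s. f s / (s - x))"
  have "(\<Sum>a\<in>insert x A. residue g a) = 0"
  proof (rule sum_residues_eq_0)
    show "g holomorphic_on -(insert x A)"
      unfolding g_def by (intro holomorphic_intros holomorphic_on_subset[OF holo]) auto
    have "((\<lambda>s. f s * (1 + x * inverse (s - x))) \<longlongrightarrow> 0 * (1 + x * 0)) at_infinity"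
    proof (intro tendsto_intros lim)
      have "filterlim (\<lambda>s. s + (- x)) at_infinity at_infinity"
        by (rule tendsto_add_filterlim_at_infinity'[OF filterlim_ident tendsto_const])
      thus "((\<lambda>s. inverse (s - x)) \<longlongrightarrow> 0) at_infinity"
        by (intro filterlim_compose[OF tendsto_inverse_0]) simp
    qed
    moreover have "eventually (\<lambda>s. f s * (1 + x * inverse (s - x)) = s * g s) at_infinity"
      using eventually_not_equal_at_infinity[of x]
      by eventually_elim (auto simp: g_def field_simps)
    ultimately show "((\<lambda>s. s * g s) \<longlongrightarrow> 0) at_infinity"
      using tendsto_cong by force
  qed (use fin in auto)
  moreover have "residue g x = f x"
    unfolding g_def using fin x holo
    by (intro residue_simple[of "-A"]) (auto intro: finite_imp_closed open_Compl)
  ultimately have "f x = (\<Sum>a\<in>A. - residue g a)"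
    using fin x by (simp add: sum_negf eq_neg_iff_add_eq_0)
  also have "\<dots> = (\<Sum>a\<in>A. \<Sum>d<D a. fps_nth (U a) (D a - 1 - d) / (x - a) ^ (d + 1))"
  proof (intro sum.cong refl)
    fix a assume a: "a \<in> A"
    define E where "E = Abs_fps (\<lambda>j. 1 / (x - a) ^ (1 + j))"
    have "(\<lambda>z. 1 / (x - a - z) ^ 1) has_fps_expansion
            Abs_fps (\<lambda>f. of_nat ((1 + f - 1) choose f) / (x - a) ^ (1 + f))"
      by (rule has_fps_expansion_inverse_power) (use a x in auto)
    hence "(\<lambda>z. 1 / (x - a - z)) has_fps_expansion E"
      by (simp add: E_def)
    hence W: "(\<lambda>z. V a z * (1 / (x - a - z))) has_fps_expansion U a * E"
      using V[OF a] by (intro fps_expansion_intros)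
    have "residue g a = residue (\<lambda>z. g (a + z)) 0"
      by (rule residue_shift_0)
    also have "\<dots> = residue (\<lambda>z. - ((V a z * (1 / (x - a - z))) / z ^ Suc (D a - 1))) 0"
    proof (rule residue_cong)
      show "eventually (\<lambda>z. g (a + z) = - ((V a z * (1 / (x - a - z))) / z ^ Suc (D a - 1))) (at 0)"
        using f[OF a]
      proof eventually_elim
        case (elim z)
        have "g (a + z) = f (a + z) / - (x - a - z)" by (simp add: g_def)
        thus ?case using D[OF a] elim by (simp add: minus_divide_right [symmetric] mult.commute del: minus_diff_eq)
      qed
    qed simp
    also have "\<dots> = residue (\<lambda>z. ((- V a z * (1 / (x - a - z))) / z ^ Suc (D a - 1))) 0"
      by simp
    also have "\<dots> = fps_nth (- U a * E) (D a - 1)"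
      using V[OF a] \<open>(\<lambda>z. 1 / (x - a - z)) has_fps_expansion E\<close>
      by (intro residue_fps_expansion_over_power_at_0 fps_expansion_intros)
    finally have "- residue g a = (\<Sum>i=0..D a - 1. fps_nth (E * U a) i * 0 + fps_nth E i * fps_nth (U a) (D a - 1 - i))"
      by (simp add: mult.commute[of "U a"] fps_mult_nth)
    also have "\<dots> = (\<Sum>d<D a. fps_nth (U a) (D a - 1 - d) / (x - a) ^ (d + 1))"
      using D[OF a] by (intro sum.cong) (auto simp: E_def)
    finally show "- residue g a = \<dots>" .
  qed
  finally show ?thesis .
qed

section \<open>Rational polynomial expressions\<close>

lemma rat_polynomial_in_elem: "x \<in> A \<Longrightarrow> rat_polynomial_in A x"
  unfolding rat_polynomial_in_def
  by (rule exI[of _ "{{#x#}}"], rule exI[of _ "\<lambda>_. 1"]) auto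

lemma rat_polynomial_in_monomial:
  assumes "set_mset m \<subseteq> A"
  shows "rat_polynomial_in A (of_rat r * prod_mset m)"
  unfolding rat_polynomial_in_def
  by (rule exI[of _ "{m}"], rule exI[of _ "\<lambda>_. r"]) (use assms in auto)

lemma rat_polynomial_in_of_rat: "rat_polynomial_in A (of_rat r)"
  using rat_polynomial_in_monomial[of "{#}" A r] by simp

lemma rat_polynomial_in_add:
  assumes "rat_polynomial_in A x" "rat_polynomial_in A y"
  shows "rat_polynomial_in A (x + y)"
proof -
  from assms obtain M c N d where
    M: "finite M" "\<forall>m\<in>M. set_mset m \<subseteq> A" "x = (\<Sum>m\<in>M. of_rat (c m) * prod_mset m)" and
    N: "finite N" "\<forall>m\<in>N. set_mset m \<subseteq> A" "y = (\<Sum>m\<in>N. of_rat (d m) * prod_mset m)"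
    unfolding rat_polynomial_in_def by blast
  define e where "e = (\<lambda>m. (if m \<in> M then c m else 0) + (if m \<in> N then d m else 0))"
  have "x = (\<Sum>m\<in>M \<union> N. of_rat (if m \<in> M then c m else 0) * prod_mset m)"
    unfolding M(3) using M(1) N(1) by (intro sum.mono_neutral_cong_left) auto
  moreover have "y = (\<Sum>m\<in>M \<union> N. of_rat (if m \<in> N then d m else 0) * prod_mset m)"
    unfolding N(3) using M(1) N(1) by (intro sum.mono_neutral_cong_left) auto
  ultimately have "x + y = (\<Sum>m\<in>M \<union> N. of_rat (e m) * prod_mset m)"
    by (simp only: e_def of_rat_add distrib_right sum.distrib)
  thus ?thesis
    unfolding rat_polynomial_in_def using M(1,2) N(1,2)
    by (intro exI[of _ "M \<union> N"] exI[of _ e]) auto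
qed

lemma rat_polynomial_in_sum:
  assumes "\<And>i. i \<in> I \<Longrightarrow> rat_polynomial_in A (f i)"
  shows "rat_polynomial_in A (\<Sum>i\<in>I. f i)"
  using assms
  by (induction I rule: infinite_finite_induct)
     (auto intro: rat_polynomial_in_add rat_polynomial_in_of_rat[of A 0, simplified])

lemma rat_polynomial_in_mult:
  assumes "rat_polynomial_in A x" "rat_polynomial_in A y"
  shows "rat_polynomial_in A (x * y)"
proof -
  from assms obtain M c N d where
    M: "\<forall>m\<in>M. set_mset m \<subseteq> A" "x = (\<Sum>m\<in>M. of_rat (c m) * prod_mset m)" and
    N: "\<forall>m\<in>N. set_mset m \<subseteq> A" "y = (\<Sum>m\<in>N. of_rat (d m) * prod_mset m)"
    unfolding rat_polynomial_in_def by blast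
  have "x * y = (\<Sum>m\<in>M. \<Sum>n\<in>N. of_rat (c m * d n) * prod_mset (m + n))"
    unfolding M(2) N(2) by (simp add: sum_product of_rat_mult mult_ac)
  also have "rat_polynomial_in A \<dots>"
    using M(1) N(1) by (intro rat_polynomial_in_sum rat_polynomial_in_monomial) auto
  finally show ?thesis .
qed

lemma rat_polynomial_in_minus:
  assumes "rat_polynomial_in A x" shows "rat_polynomial_in A (- x)"
  using rat_polynomial_in_mult[OF rat_polynomial_in_of_rat[of A "-1"] assms]
  by (simp add: of_rat_minus)

lemma rat_polynomial_in_diff:
  assumes "rat_polynomial_in A x" "rat_polynomial_in A y"
  shows "rat_polynomial_in A (x - y)"
  using rat_polynomial_in_add[OF assms(1) rat_polynomial_in_minus[OF assms(2)]] by simp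

lemma rat_polynomial_in_of_int: "rat_polynomial_in A (of_int n)"
  using rat_polynomial_in_of_rat[of A "of_int n"] by simp

lemma rat_polynomial_in_of_nat: "rat_polynomial_in A (of_nat n)"
  using rat_polynomial_in_of_int[of A "int n"] by simp

section \<open>Slowly varying sequences and alternating series\<close>

text \<open>Models powers of logarithms: growth below every positive power, with increments smaller
  by one further power. Admitting every \<open>\<delta>\<close> closes the class under products,
  which a fixed exponent would not.\<close>

definition slow :: "(nat \<Rightarrow> real) \<Rightarrow> bool" where
  "slow u \<longleftrightarrow> (\<forall>\<delta>>0. \<exists>C. \<forall>n. \<bar>u n\<bar> \<le> C * (real n + 1) powr \<delta> \<and>
      \<bar>u (Suc n) - u n\<bar> \<le> C * (real n + 1) powr (\<delta> - 1))"

lemma slowE: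
  assumes "slow u" "\<delta> > 0"
  obtains C where "C \<ge> 0" "\<And>n. \<bar>u n\<bar> \<le> C * (real n + 1) powr \<delta>"
    "\<And>n. \<bar>u (Suc n) - u n\<bar> \<le> C * (real n + 1) powr (\<delta> - 1)"
proof -
  from assms obtain C where C: "\<And>n. \<bar>u n\<bar> \<le> C * (real n + 1) powr \<delta>"
      "\<And>n. \<bar>u (Suc n) - u n\<bar> \<le> C * (real n + 1) powr (\<delta> - 1)"
    unfolding slow_def by blast
  from C(1)[of 0] have "C \<ge> 0" by simp
  thus ?thesis using C that by blast
qed

text \<open>Adding up the increments bounds \<open>u\<close> by a multiple of the harmonic numbers,
  hence of the logarithm, which is at most \<open>x powr \<delta> / \<delta>\<close>.\<close>

lemma slow_of_diff_bound:
  assumes "\<And>n. \<bar>u (Suc n) - u n\<bar> \<le> C / (real n + 1)"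
  shows "slow u"
  unfolding slow_def
proof (intro allI impI)
  fix \<delta> :: real assume \<delta>: "\<delta> > 0"
  have C: "C \<ge> 0" using assms[of 0] by simp
  have h: "\<bar>u n\<bar> \<le> \<bar>u 0\<bar> + C * harm n" for n
  proof (induction n)
    case (Suc n)
    have "\<bar>u (Suc n)\<bar> \<le> \<bar>u n\<bar> + \<bar>u (Suc n) - u n\<bar>" by linarith
    also have "\<dots> \<le> (\<bar>u 0\<bar> + C * harm n) + C / (real n + 1)"
      using Suc assms[of n] by linarith
    also have "\<dots> = \<bar>u 0\<bar> + C * harm (Suc n)"
      by (simp add: harm_Suc field_simps)
    finally show ?case .
  qed (auto simp: harm_def)
  define D where "D = \<bar>u 0\<bar> + C + C / \<delta>"
  have bound: "\<bar>u n\<bar> \<le> D * (real n + 1) powr \<delta>" for n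
  proof -
    have "harm n \<le> (harm (Suc n) :: real)" by (simp add: harm_Suc)
    also have "harm (Suc n) \<le> ln (real (Suc n)) + (1 :: real)"
      using decseqD[OF decseq_harm_diff_ln, of 0 n] by (simp add: harm_def)
    also have "ln (real (Suc n)) \<le> (real n + 1) powr \<delta> / \<delta>"
      using ln_powr_bound[of "real n + 1" \<delta>] \<delta> by (simp add: add.commute)
    finally have "harm n \<le> (real n + 1) powr \<delta> / \<delta> + 1" by simp
    hence "\<bar>u n\<bar> \<le> \<bar>u 0\<bar> + C * ((real n + 1) powr \<delta> / \<delta> + 1)"
      using h[of n] C by (smt (verit) mult_left_mono)
    also have "\<dots> \<le> (\<bar>u 0\<bar> + C) * (real n + 1) powr \<delta> + C * ((real n + 1) powr \<delta> / \<delta>)"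
    proof -
      have "1 \<le> (real n + 1) powr \<delta>" using \<delta> by (simp add: ge_one_powr_ge_zero)
      hence "(\<bar>u 0\<bar> + C) * 1 \<le> (\<bar>u 0\<bar> + C) * (real n + 1) powr \<delta>"
        using C by (intro mult_left_mono) auto
      thus ?thesis by (simp add: algebra_simps)
    qed
    also have "\<dots> = D * (real n + 1) powr \<delta>" by (simp add: D_def algebra_simps)
    finally show ?thesis .
  qed
  have D: "D \<ge> C" using C \<delta> by (simp add: D_def)
  have "\<bar>u (Suc n) - u n\<bar> \<le> D * (real n + 1) powr (\<delta> - 1)" for n
  proof -
    have "\<bar>u (Suc n) - u n\<bar> \<le> C * (real n + 1) powr (- 1)"
      using assms[of n] by (simp add: powr_minus_divide)
    also have "\<dots> \<le> D * (real n + 1) powr (\<delta> - 1)"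
      using C D \<delta> by (intro mult_mono powr_mono) auto
    finally show ?thesis .
  qed
  with bound show "\<exists>C. \<forall>n. \<bar>u n\<bar> \<le> C * (real n + 1) powr \<delta> \<and>
      \<bar>u (Suc n) - u n\<bar> \<le> C * (real n + 1) powr (\<delta> - 1)" by blast
qed

lemma slow_const: "slow (\<lambda>_. c)"
  by (rule slow_of_diff_bound[of _ 0]) simp

lemma slow_of_bound:
  assumes "\<And>n. \<bar>u n\<bar> \<le> C / (real n + 1)"
  shows "slow u"
proof (rule slow_of_diff_bound[of _ "2 * C"])
  fix n
  have C: "C \<ge> 0" using assms[of 0] by simp
  have "\<bar>u (Suc n) - u n\<bar> \<le> \<bar>u (Suc n)\<bar> + \<bar>u n\<bar>" by linarith
  also have "\<dots> \<le> C / (real (Suc n) + 1) + C / (real n + 1)" by (intro add_mono assms)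
  also have "C / (real (Suc n) + 1) \<le> C / (real n + 1)" using C by (intro divide_left_mono) auto
  finally show "\<bar>u (Suc n) - u n\<bar> \<le> 2 * C / (real n + 1)" by simp
qed

lemma slow_add:
  assumes "slow u" "slow v"
  shows "slow (\<lambda>n. u n + v n)"
  unfolding slow_def
proof (intro allI impI)
  fix \<delta> :: real assume \<delta>: "\<delta> > 0"
  obtain C where C: "C \<ge> 0" "\<And>n. \<bar>u n\<bar> \<le> C * (real n + 1) powr \<delta>"
    "\<And>n. \<bar>u (Suc n) - u n\<bar> \<le> C * (real n + 1) powr (\<delta> - 1)"
    by (rule slowE[OF assms(1) \<delta>]) auto
  obtain D where D: "D \<ge> 0" "\<And>n. \<bar>v n\<bar> \<le> D * (real n + 1) powr \<delta>"
    "\<And>n. \<bar>v (Suc n) - v n\<bar> \<le> D * (real n + 1) powr (\<delta> - 1)"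
    by (rule slowE[OF assms(2) \<delta>]) auto
  have "\<bar>u n + v n\<bar> \<le> (C + D) * (real n + 1) powr \<delta>" for n
    using C(2)[of n] D(2)[of n] by (simp add: algebra_simps)
  moreover have "\<bar>(u (Suc n) + v (Suc n)) - (u n + v n)\<bar> \<le> (C + D) * (real n + 1) powr (\<delta> - 1)" for n
    using C(3)[of n] D(3)[of n] by (simp add: algebra_simps)
  ultimately show "\<exists>C. \<forall>n. \<bar>u n + v n\<bar> \<le> C * (real n + 1) powr \<delta> \<and>
      \<bar>(u (Suc n) + v (Suc n)) - (u n + v n)\<bar> \<le> C * (real n + 1) powr (\<delta> - 1)" by blast
qed

lemma slow_mult:
  assumes "slow u" "slow v"
  shows "slow (\<lambda>n. u n * v n)"
  unfolding slow_def
proof (intro allI impI)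
  fix \<delta> :: real assume \<delta>: "\<delta> > 0"
  define \<epsilon> where "\<epsilon> = \<delta> / 2"
  have \<epsilon>: "\<epsilon> > 0" and \<delta>_eq: "\<delta> = \<epsilon> + \<epsilon>" using \<delta> by (auto simp: \<epsilon>_def)
  obtain C where C: "C \<ge> 0" "\<And>n. \<bar>u n\<bar> \<le> C * (real n + 1) powr \<epsilon>"
    "\<And>n. \<bar>u (Suc n) - u n\<bar> \<le> C * (real n + 1) powr (\<epsilon> - 1)"
    by (rule slowE[OF assms(1) \<epsilon>]) auto
  obtain D where D: "D \<ge> 0" "\<And>n. \<bar>v n\<bar> \<le> D * (real n + 1) powr \<epsilon>"
    "\<And>n. \<bar>v (Suc n) - v n\<bar> \<le> D * (real n + 1) powr (\<epsilon> - 1)"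
    by (rule slowE[OF assms(2) \<epsilon>]) auto
  \<comment> \<open>The factor 3 is dictated by the increments below: \<open>2 * C * D\<close> from
    the shifted value \<open>v (Suc n)\<close> and \<open>C * D\<close> from the other term.\<close>
  have b1: "\<bar>u n * v n\<bar> \<le> (3 * C * D) * (real n + 1) powr \<delta>" for n
  proof -
    have "\<bar>u n * v n\<bar> \<le> (C * (real n + 1) powr \<epsilon>) * (D * (real n + 1) powr \<epsilon>)"
      unfolding abs_mult by (intro mult_mono C D) (use C in auto)
    also have "\<dots> = C * D * ((real n + 1) powr \<epsilon> * (real n + 1) powr \<epsilon>)" by simp
    also have "\<dots> = C * D * (real n + 1) powr \<delta>"
      by (simp only: \<delta>_eq powr_add)
    also have "\<dots> \<le> (3 * C * D) * (real n + 1) powr \<delta>"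
      using C D by (intro mult_right_mono) auto
    finally show ?thesis .
  qed
  have b2: "\<bar>u (Suc n) * v (Suc n) - u n * v n\<bar> \<le> (3 * C * D) * (real n + 1) powr (\<delta> - 1)" for n
  proof -
    let ?x = "real n + 1"
    have x: "?x powr (\<epsilon> - 1) \<le> ?x powr \<epsilon>" by (intro powr_mono) auto
    have "\<bar>v (Suc n)\<bar> \<le> \<bar>v n\<bar> + \<bar>v (Suc n) - v n\<bar>" by linarith
    also have "\<dots> \<le> D * ?x powr \<epsilon> + D * ?x powr (\<epsilon> - 1)" by (intro add_mono D)
    also have "\<dots> \<le> D * ?x powr \<epsilon> + D * ?x powr \<epsilon>" using D x by (intro add_mono mult_left_mono) auto
    finally have v: "\<bar>v (Suc n)\<bar> \<le> 2 * D * ?x powr \<epsilon>" by simp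
    have "u (Suc n) * v (Suc n) - u n * v n = (u (Suc n) - u n) * v (Suc n) + u n * (v (Suc n) - v n)"
      by (simp add: algebra_simps)
    hence "\<bar>u (Suc n) * v (Suc n) - u n * v n\<bar> \<le>
            \<bar>u (Suc n) - u n\<bar> * \<bar>v (Suc n)\<bar> + \<bar>u n\<bar> * \<bar>v (Suc n) - v n\<bar>"
      by (metis abs_mult abs_triangle_ineq)
    also have "\<dots> \<le> (C * ?x powr (\<epsilon> - 1)) * (2 * D * ?x powr \<epsilon>) + (C * ?x powr \<epsilon>) * (D * ?x powr (\<epsilon> - 1))"
      by (intro add_mono mult_mono C D v) (use C in auto)
    also have "\<dots> = (3 * C * D) * (?x powr \<epsilon> * ?x powr (\<epsilon> - 1))"
      by (simp add: algebra_simps)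
    also have "?x powr \<epsilon> * ?x powr (\<epsilon> - 1) = ?x powr (\<delta> - 1)"
      by (simp add: \<delta>_eq powr_add [symmetric] algebra_simps)
    finally show ?thesis .
  qed
  show "\<exists>C. \<forall>n. \<bar>u n * v n\<bar> \<le> C * (real n + 1) powr \<delta> \<and>
      \<bar>u (Suc n) * v (Suc n) - u n * v n\<bar> \<le> C * (real n + 1) powr (\<delta> - 1)"
    using b1 b2 by blast
qed

section \<open>Convergence of the sums and summation by parts\<close>

lemma summable_Suc_powr:
  assumes "s < -1"
  shows "summable (\<lambda>n. (real n + 1) powr s)"
proof -
  have "summable (\<lambda>n. real (Suc n) powr s)"
    using assms by (subst summable_Suc_iff) (simp add: summable_real_powr_iff)
  thus ?thesis by (simp add: add.commute)
qed

text \<open>Twice a partial sum is \<open>a 0\<close> plus the partial sum of signed differences, up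
  to a boundary term tending to 0. Conditional convergence is thus traded for absolute
  convergence.\<close>

lemma alternating_by_parts:
  fixes a :: "nat \<Rightarrow> real"
  assumes "a \<longlonglongrightarrow> 0" "summable (\<lambda>m. \<bar>a m - a (Suc m)\<bar>)"
  shows "(\<lambda>m. (-1) ^ m * a m) sums ((a 0 + (\<Sum>m. (-1) ^ m * (a m - a (Suc m)))) / 2)"
proof -
  have eq: "(\<Sum>m<n. (-1) ^ m * a m) = (a 0 + (\<Sum>m<n. (-1) ^ m * (a m - a (Suc m))) - (-1) ^ n * a n) / 2" for n
    by (induction n) (auto simp: field_simps)
  have "summable (\<lambda>m. (-1) ^ m * (a m - a (Suc m)))"
    by (rule summable_comparison_test[OF _ assms(2)]) (auto simp: abs_mult)
  hence 1: "(\<lambda>n. \<Sum>m<n. (-1) ^ m * (a m - a (Suc m))) \<longlonglongrightarrow> (\<Sum>m. (-1) ^ m * (a m - a (Suc m)))"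
    by (rule summable_LIMSEQ)
  have "(\<lambda>n. \<bar>(-1) ^ n * a n\<bar>) \<longlonglongrightarrow> 0"
    using tendsto_rabs[OF assms(1)] by (simp add: abs_mult)
  hence 2: "(\<lambda>n. (-1) ^ n * a n) \<longlonglongrightarrow> 0" by (rule tendsto_rabs_zero_cancel)
  show ?thesis unfolding sums_def eq
    by (rule tendsto_eq_intros 1 2 refl)+ auto
qed

text \<open>Slowness is used with exponent 1/4. The exponent \<open>-7/4\<close> leaves room for one
  more factor of growth 1/4, the later bound on the kernel, and still yields the summable
  \<open>-3/2\<close>.\<close>

lemma slow_div_bounds:
  assumes "slow u" "0 < c" "c \<le> 1"
  obtains C where "C \<ge> 0"
    "\<And>m. \<bar>u m / (real m + c)\<bar> \<le> C * (real m + 1) powr (- 3 / 4)"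
    "\<And>m. \<bar>u m / (real m + c) - u (Suc m) / (real (Suc m) + c)\<bar> \<le> C * (real m + 1) powr (- 7 / 4)"
proof -
  obtain C where C: "C \<ge> 0" "\<And>n. \<bar>u n\<bar> \<le> C * (real n + 1) powr (1 / 4)"
    "\<And>n. \<bar>u (Suc n) - u n\<bar> \<le> C * (real n + 1) powr (1 / 4 - 1)"
    by (rule slowE[OF assms(1), of "1 / 4"]) auto
  have inv: "1 / (real m + c) \<le> (real m + 1) powr (- 1) / c" for m
  proof -
    have "c * (real m + 1) \<le> real m + c"
      using assms(2,3) mult_right_mono[of c 1 "real m"] by (simp add: algebra_simps)
    hence "1 / (real m + c) \<le> 1 / (c * (real m + 1))"
      using assms(2) by (intro divide_left_mono) auto
    thus ?thesis by (simp add: powr_minus_divide field_simps)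
  qed
  have b1: "\<bar>u m / (real m + c)\<bar> \<le> (C / c) * (real m + 1) powr (- 3 / 4)" for m
  proof -
    have "\<bar>u m / (real m + c)\<bar> = \<bar>u m\<bar> * (1 / (real m + c))" using assms by simp
    also have "\<dots> \<le> (C * (real m + 1) powr (1 / 4)) * ((real m + 1) powr (- 1) / c)"
      by (intro mult_mono C inv) (use C assms in auto)
    also have "\<dots> = (C / c) * ((real m + 1) powr (1 / 4) * (real m + 1) powr (- 1))" by simp
    also have "\<dots> = (C / c) * (real m + 1) powr (- 3 / 4)" by (subst powr_add [symmetric]) simp
    finally show ?thesis .
  qed
  have b2: "\<bar>u m / (real m + c) - u (Suc m) / (real (Suc m) + c)\<bar> \<le> (2 * C / c) * (real m + 1) powr (- 7 / 4)" for m
  proof -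
    have pos: "0 < real m + c" "0 < real m + (1 + c)" using assms by auto
    have "u m / (real m + c) - u (Suc m) / (real (Suc m) + c) =
            (u m / (real m + c)) * (1 / (real (Suc m) + c)) - (u (Suc m) - u m) * (1 / (real (Suc m) + c))"
    proof -
      define p where "p = real m + c"
      have p: "real (Suc m) + c = p + 1" "p \<noteq> 0" "p + 1 \<noteq> 0" using pos by (auto simp: p_def)
      show ?thesis unfolding p(1) p_def [symmetric] using p(2,3) by (simp add: divide_simps) (simp add: algebra_simps)
    qed
    hence "\<bar>u m / (real m + c) - u (Suc m) / (real (Suc m) + c)\<bar> \<le>
            \<bar>u m / (real m + c)\<bar> * \<bar>1 / (real (Suc m) + c)\<bar> + \<bar>u (Suc m) - u m\<bar> * \<bar>1 / (real (Suc m) + c)\<bar>"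
      by (metis abs_mult abs_triangle_ineq4)
    also have "\<dots> \<le> ((C / c) * (real m + 1) powr (- 3 / 4)) * (real m + 1) powr (- 1) +
                      (C * (real m + 1) powr (1 / 4 - 1)) * ((real m + 1) powr (- 1))"
      using assms pos
      by (intro add_mono mult_mono C b1) (auto simp: powr_minus_divide frac_le C(1))
    also have "\<dots> = (C / c + C) * ((real m + 1) powr (- 3 / 4) * (real m + 1) powr (- 1))"
      by (simp only: distrib_right mult.assoc) simp
    also have "(real m + 1) powr (- 3 / 4) * (real m + 1) powr (- 1) = (real m + 1) powr (- 7 / 4)"
      by (subst powr_add [symmetric]) simp
    also have "(C / c + C) * (real m + 1) powr (- 7 / 4) \<le> (C / c + C / c) * (real m + 1) powr (- 7 / 4)"
    proof (intro mult_right_mono add_left_mono)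
      show "C \<le> C / c" using C(1) assms by (simp add: le_divide_eq mult_left_le)
    qed auto
    finally show ?thesis by simp
  qed
  have b1': "\<bar>u m / (real m + c)\<bar> \<le> (2 * C / c) * (real m + 1) powr (- 3 / 4)" for m
    using C assms by (intro order_trans[OF b1] mult_right_mono divide_right_mono) auto
  show ?thesis
    by (rule that[of "2 * C / c", OF _ b1' b2]) (use C assms in auto)
qed

lemma slow_power_bound:
  assumes "slow u" "0 < c" "c \<le> 1" "q \<ge> 2"
  obtains C where "C \<ge> 0"
    "\<And>m. \<bar>u m / (real m + c) ^ q\<bar> \<le> C * (real m + 1) powr (- 7 / 4)"
proof -
  obtain C where C: "C \<ge> 0" "\<And>m. \<bar>u m / (real m + c)\<bar> \<le> C * (real m + 1) powr (- 3 / 4)"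
    using slow_div_bounds[OF assms(1-3)] by metis
  have inv: "1 / (real m + c) \<le> (real m + 1) powr (- 1) / c" for m
  proof -
    have "c * (real m + 1) \<le> real m + c"
      using assms(2,3) mult_right_mono[of c 1 "real m"] by (simp add: algebra_simps)
    hence "1 / (real m + c) \<le> 1 / (c * (real m + 1))"
      using assms(2) by (intro divide_left_mono) auto
    thus ?thesis by (simp add: powr_minus_divide field_simps)
  qed
  have inv2: "1 / (real m + c) \<le> 1 / c" for m using assms by (intro divide_left_mono) auto
  obtain r where q: "q = Suc (Suc r)" using assms(4) by (metis add_2_eq_Suc le_Suc_ex)
  have "\<bar>u m / (real m + c) ^ q\<bar> \<le> (C / c * (1 / c) ^ r) * (real m + 1) powr (- 7 / 4)" for m
  proof -
    have "\<bar>u m / (real m + c) ^ q\<bar> = \<bar>u m / (real m + c)\<bar> * (1 / (real m + c)) * (1 / (real m + c)) ^ r"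
      using assms by (simp add: q power_one_over field_simps)
    also have "\<dots> \<le> (C * (real m + 1) powr (- 3 / 4)) * ((real m + 1) powr (- 1) / c) * (1 / c) ^ r"
      by (intro mult_mono C inv inv2 power_mono) (use C assms in auto)
    also have "\<dots> = (C / c * (1 / c) ^ r) * ((real m + 1) powr (- 3 / 4) * (real m + 1) powr (- 1))"
      by (simp add: mult_ac)
    also have "\<dots> = (C / c * (1 / c) ^ r) * (real m + 1) powr (- 7 / 4)" by (subst powr_add [symmetric]) simp
    finally show ?thesis .
  qed
  thus ?thesis by (rule that[rotated]) (use C assms in auto)
qed

lemma powr_tendsto_0: "s < 0 \<Longrightarrow> (\<lambda>m. (real m + 1) powr s) \<longlonglongrightarrow> 0"
  by real_asymp

text \<open>Convergence is absolute for \<open>q \<ge> 2\<close>. For \<open>q = 1\<close>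
  admissibility forces \<open>\<sigma> = -1\<close>, and summation by parts applies.\<close>

lemma slow_summable:
  assumes "slow u" "0 < c" "c \<le> 1" "q \<ge> 1" "\<sigma> \<in> {1, -1 :: int}" "(q, \<sigma>) \<noteq> (1, 1)"
  shows "summable (\<lambda>m. of_int \<sigma> ^ m * u m / (real m + c) ^ q)"
proof (cases "q = 1")
  case False
  hence "q \<ge> 2" using assms by auto
  then obtain C where C: "C \<ge> 0" "\<And>m. \<bar>u m / (real m + c) ^ q\<bar> \<le> C * (real m + 1) powr (- 7 / 4)"
    using slow_power_bound[OF assms(1-3)] by blast
  show ?thesis
  proof (rule summable_comparison_test)
    show "summable (\<lambda>m. C * (real m + 1) powr (- 7 / 4))"
      by (intro summable_mult summable_Suc_powr) auto
    show "\<exists>N. \<forall>n\<ge>N. norm (of_int \<sigma> ^ n * u n / (real n + c) ^ q) \<le> C * (real n + 1) powr (- 7 / 4)"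
      using C(2) assms(5) by (auto simp: abs_mult)
  qed
next
  case True
  hence \<sigma>: "\<sigma> = -1" using assms by auto
  obtain C where C: "C \<ge> 0"
    "\<And>m. \<bar>u m / (real m + c)\<bar> \<le> C * (real m + 1) powr (- 3 / 4)"
    "\<And>m. \<bar>u m / (real m + c) - u (Suc m) / (real (Suc m) + c)\<bar> \<le> C * (real m + 1) powr (- 7 / 4)"
    using slow_div_bounds[OF assms(1-3)] by blast
  have "(\<lambda>m. (-1) ^ m * (u m / (real m + c))) sums
          ((u 0 / (real 0 + c) + (\<Sum>m. (-1) ^ m * (u m / (real m + c) - u (Suc m) / (real (Suc m) + c)))) / 2)"
  proof (rule alternating_by_parts)
    show "(\<lambda>m. u m / (real m + c)) \<longlonglongrightarrow> 0"
    proof (rule Lim_null_comparison)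
      show "\<forall>\<^sub>F m in sequentially. norm (u m / (real m + c)) \<le> C * (real m + 1) powr (- 3 / 4)"
        using C(2) by (intro always_eventually) auto
      show "(\<lambda>m. C * (real m + 1) powr (- 3 / 4)) \<longlonglongrightarrow> 0"
        using tendsto_mult_left[OF powr_tendsto_0[of "-3/4"], of C] by simp
    qed
    show "summable (\<lambda>m. \<bar>u m / (real m + c) - u (Suc m) / (real (Suc m) + c)\<bar>)"
    proof (rule summable_comparison_test)
      show "summable (\<lambda>m. C * (real m + 1) powr (- 7 / 4))"
        by (intro summable_mult summable_Suc_powr) auto
    qed (use C(3) in auto)
  qed
  thus ?thesis using True \<sigma> by (auto simp: sums_iff)
qed

section \<open>Limits of conditionally convergent sums with a varying kernel\<close>

lemma powr_mult_le_max:
  fixes u v :: real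
  assumes "u > 0" "v > 0"
  shows "u powr (-3/4) / v \<le> (max u v) powr (-1/4) * (u powr (-3/2) + v powr (-3/2))"
proof (cases "u \<ge> v")
  case True
  have "u powr (-3/4) / v = u powr (-3/4) * (v powr (-3/2) * v powr (1/2))"
  proof -
    have "v powr (-3/2) * v powr (1/2) = v powr (-1)" by (subst powr_add [symmetric]) simp
    thus ?thesis using assms by (simp add: powr_minus_divide)
  qed
  also have "\<dots> \<le> u powr (-3/4) * (v powr (-3/2) * u powr (1/2))"
    using True assms by (intro mult_left_mono powr_mono2) auto
  also have "\<dots> = (u powr (-3/4) * u powr (1/2)) * v powr (-3/2)" by simp
  also have "\<dots> = u powr (-1/4) * v powr (-3/2)" by (subst powr_add [symmetric]) simp
  also have "\<dots> \<le> u powr (-1/4) * (u powr (-3/2) + v powr (-3/2))"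
    by (intro mult_left_mono) auto
  finally show ?thesis using True by (simp add: max_def)
next
  case False
  have "u powr (-3/4) / v = u powr (-3/4) * (v powr (-3/4) * v powr (-1/4))"
  proof -
    have "v powr (-3/4) * v powr (-1/4) = v powr (-1)" by (subst powr_add [symmetric]) simp
    thus ?thesis using assms by (simp add: powr_minus_divide)
  qed
  also have "\<dots> \<le> u powr (-3/4) * (u powr (-3/4) * v powr (-1/4))"
    using False assms by (intro mult_left_mono mult_right_mono powr_mono2') auto
  also have "\<dots> = (u powr (-3/4) * u powr (-3/4)) * v powr (-1/4)" by simp
  also have "\<dots> = v powr (-1/4) * u powr (-3/2)" by (subst powr_add [symmetric]) simp
  also have "\<dots> \<le> v powr (-1/4) * (u powr (-3/2) + v powr (-3/2))"
    by (intro mult_left_mono) auto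
  finally show ?thesis using False by (simp add: max_def)
qed

text \<open>The peak of \<open>b N\<close> moves with \<open>N\<close>, so there is no summable
  majorant independent of \<open>N\<close>. Instead \<open>powr_mult_le_max\<close> splits off a
  power \<open>-1/4\<close> of the maximum of \<open>m + 1\<close> and the distance, which cannot
  both be below \<open>N / 4\<close>; what remains has a sum bounded independently of
  \<open>N\<close>.\<close>

lemma boundary_sum_tendsto_0:
  defines "b \<equiv> \<lambda>N m. (real m + 1) powr (-3/4) / \<bar>real N - real m - 3/2\<bar>"
  shows "\<And>N. N \<ge> 1 \<Longrightarrow> summable (b N)" and "(\<lambda>N. \<Sum>m. b N m) \<longlonglongrightarrow> 0"
proof -
  define v where "v = (\<lambda>N m :: nat. \<bar>real N - real m - 3/2\<bar>)"
  define h where "h = (\<lambda>i :: nat. (real i + 1/2) powr (-3/2))"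
  define w where "w = (\<lambda>m :: nat. (real m + 1) powr (-3/2))"
  have w: "summable w" unfolding w_def by (rule summable_Suc_powr) simp
  have h: "summable h"
  proof (rule summable_comparison_test)
    show "summable (\<lambda>i. (1/2) powr (-3/2) * w i)" by (intro summable_mult w)
    have "h i \<le> (1/2) powr (-3/2) * w i" for i
    proof -
      have "h i \<le> ((1/2) * (real i + 1)) powr (-3/2)"
        unfolding h_def by (intro powr_mono2') auto
      thus ?thesis unfolding w_def by (subst (asm) powr_mult) auto
    qed
    thus "\<exists>N. \<forall>n\<ge>N. norm (h n) \<le> (1/2) powr (-3/2) * w n" by (auto simp: h_def)
  qed
  have v_pos: "v N m > 0" for N m
  proof -
    have "2 * int N - 2 * int m \<noteq> 3" by presburger
    hence "2 * real N - 2 * real m \<noteq> 3" by linarith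
    thus ?thesis by (auto simp: v_def)
  qed
  have v1: "v N (m + (N - 1)) powr (-3/2) = h m" if "N \<ge> 1" for N m
    using that by (auto simp: v_def h_def of_nat_diff)
  have sv: "summable (\<lambda>m. v N m powr (-3/2))" if "N \<ge> 1" for N
    using h by (subst summable_iff_shift[of _ "N - 1", symmetric]) (simp only: v1[OF that])
  \<comment> \<open>Each half-integer distance occurs at most twice: once for
    \<open>m \<ge> N - 1\<close> and once for \<open>m < N - 1\<close>.\<close>
  have sv2: "(\<Sum>m. v N m powr (-3/2)) \<le> 2 * suminf h" if "N \<ge> 1" for N
  proof -
    have "(\<Sum>m. v N m powr (-3/2)) = suminf h + (\<Sum>m<N-1. v N m powr (-3/2))"
      by (subst suminf_split_initial_segment[OF sv[OF that], of "N - 1"]) (simp only: v1[OF that])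
    also have "(\<Sum>m<N-1. v N m powr (-3/2)) = (\<Sum>m<N-1. h (N - 1 - Suc m))"
      using that by (intro sum.cong refl) (auto simp: v_def h_def of_nat_diff)
    also have "\<dots> = (\<Sum>m<N-1. h m)" by (rule sum.nat_diff_reindex)
    also have "\<dots> \<le> suminf h" by (rule sum_le_suminf[OF h]) (auto simp: h_def)
    finally show ?thesis by simp
  qed
  have bnd: "b N m \<le> (real N / 4) powr (-1/4) * (w m + v N m powr (-3/2))" if "N \<ge> 1" for N m
  proof -
    have "real N / 4 \<le> max (real m + 1) (v N m)"
      using that unfolding v_def le_max_iff_disj by (auto simp: abs_if)
    hence "(max (real m + 1) (v N m)) powr (-1/4) \<le> (real N / 4) powr (-1/4)"
      using that by (intro powr_mono2') auto
    hence "(max (real m + 1) (v N m)) powr (-1/4) * (w m + v N m powr (-3/2)) \<le>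
           (real N / 4) powr (-1/4) * (w m + v N m powr (-3/2))"
      by (intro mult_right_mono) (auto simp: w_def)
    with powr_mult_le_max[of "real m + 1" "v N m"] v_pos[of N m] show ?thesis
      unfolding b_def w_def v_def by simp
  qed
  have b_nonneg: "b N m \<ge> 0" for N m by (simp add: b_def)
  have s: "summable (\<lambda>m. (real N / 4) powr (-1/4) * (w m + v N m powr (-3/2)))" if "N \<ge> 1" for N
    by (intro summable_mult summable_add w sv that)
  show sb: "summable (b N)" if "N \<ge> 1" for N
    by (rule summable_comparison_test[OF _ s[OF that]]) (use bnd[OF that] b_nonneg in auto)
  show "(\<lambda>N. \<Sum>m. b N m) \<longlonglongrightarrow> 0"
  proof (rule Lim_null_comparison)
    show "(\<lambda>N. (real N / 4) powr (-1/4) * (suminf w + 2 * suminf h)) \<longlonglongrightarrow> 0"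
      by (rule tendsto_mult_left_zero) real_asymp
    show "\<forall>\<^sub>F N in sequentially. norm (\<Sum>m. b N m) \<le> (real N / 4) powr (-1/4) * (suminf w + 2 * suminf h)"
      using eventually_ge_at_top[of 1]
    proof eventually_elim
      case (elim N)
      have "norm (\<Sum>m. b N m) = (\<Sum>m. b N m)"
        using suminf_nonneg[OF sb[OF elim]] b_nonneg by simp
      also have "\<dots> \<le> (\<Sum>m. (real N / 4) powr (-1/4) * (w m + v N m powr (-3/2)))"
        by (intro suminf_le bnd elim sb s)
      also have "\<dots> = (real N / 4) powr (-1/4) * (suminf w + (\<Sum>m. v N m powr (-3/2)))"
        unfolding suminf_mult[OF summable_add[OF w sv[OF elim]]] suminf_add[OF w sv[OF elim], symmetric] ..
      also have "\<dots> \<le> (real N / 4) powr (-1/4) * (suminf w + 2 * suminf h)"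
        using sv2[OF elim] by (intro mult_left_mono) auto
      finally show ?case .
    qed
  qed
qed

text \<open>For \<open>q \<ge> 2\<close> dominated convergence suffices. For \<open>q = 1\<close>
  the differences of \<open>a m * k N m\<close> are split: in \<open>D1\<close> they fall on
  \<open>a\<close>, and a majorant exists; in \<open>D2\<close> they fall on the kernel, and the sum
  vanishes by \<open>boundary_sum_tendsto_0\<close>. This fits together because
  \<open>\<kappa>\<close> does not depend on \<open>m\<close>.\<close>

lemma slow_kernel_limit:
  fixes k :: "nat \<Rightarrow> nat \<Rightarrow> real"
  assumes u: "slow u" and q: "q \<ge> 1" "\<sigma> \<in> {1, -1 :: int}" "(q, \<sigma>) \<noteq> (1, 1)"
    and lim: "\<And>m. (\<lambda>N. k N m) \<longlonglongrightarrow> \<kappa>"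
    and bound: "\<And>N m. \<bar>k N m\<bar> \<le> B * (real m + 1) powr (1/4)"
    and diff: "\<And>N m. \<bar>k N (Suc m) - k N m\<bar> \<le> B / \<bar>real N - real m - 3/2\<bar>"
  shows "(\<lambda>N. \<Sum>m. of_int \<sigma> ^ m * u m * k N m / (real m + 1) ^ q) \<longlonglongrightarrow>
           \<kappa> * (\<Sum>m. of_int \<sigma> ^ m * u m / (real m + 1) ^ q)"
proof (cases "q = 1")
  case False
  hence "q \<ge> 2" using q by auto
  then obtain C where C: "C \<ge> 0" "\<And>m. \<bar>u m / (real m + 1) ^ q\<bar> \<le> C * (real m + 1) powr (- 7 / 4)"
    using slow_power_bound[OF u, of 1] by auto
  have "(\<lambda>N. \<Sum>m. of_int \<sigma> ^ m * u m * k N m / (real m + 1) ^ q) \<longlonglongrightarrow>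
          (\<Sum>m. of_int \<sigma> ^ m * u m * \<kappa> / (real m + 1) ^ q)"
  proof (rule tannerys_theorem[THEN conjunct2, THEN conjunct2])
    show "(\<lambda>N. of_int \<sigma> ^ m * u m * k N m / (real m + 1) ^ q) \<longlonglongrightarrow>
            of_int \<sigma> ^ m * u m * \<kappa> / (real m + 1) ^ q" for m
      by (intro tendsto_intros lim) auto
    show "summable (\<lambda>m. (C * B) * (real m + 1) powr (- 3 / 2))"
      by (intro summable_mult summable_Suc_powr) auto
    have "norm (of_int \<sigma> ^ m * u m * k N m / (real m + 1) ^ q) \<le> (C * B) * (real m + 1) powr (- 3 / 2)" for N m
    proof -
      have "norm (of_int \<sigma> ^ m * u m * k N m / (real m + 1) ^ q) = \<bar>u m / (real m + 1) ^ q\<bar> * \<bar>k N m\<bar>"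
        using q(2) by (auto simp: abs_mult)
      also have "\<dots> \<le> (C * (real m + 1) powr (- 7 / 4)) * (B * (real m + 1) powr (1 / 4))"
        by (intro mult_mono C bound) (use C in auto)
      also have "\<dots> = (C * B) * ((real m + 1) powr (- 7 / 4) * (real m + 1) powr (1 / 4))" by simp
      also have "(real m + 1) powr (- 7 / 4) * (real m + 1) powr (1 / 4) = (real m + 1) powr (- 3 / 2)"
        by (subst powr_add [symmetric]) simp
      finally show ?thesis .
    qed
    thus "\<forall>\<^sub>F (m, N) in sequentially \<times>\<^sub>F sequentially.
            norm (of_int \<sigma> ^ m * u m * k N m / (real m + 1) ^ q) \<le> (C * B) * (real m + 1) powr (- 3 / 2)"
      by (intro always_eventually) auto
  qed auto
  also have "(\<Sum>m. of_int \<sigma> ^ m * u m * \<kappa> / (real m + 1) ^ q) = \<kappa> * (\<Sum>m. of_int \<sigma> ^ m * u m / (real m + 1) ^ q)"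
    by (subst suminf_mult [symmetric]) (use slow_summable[OF u _ _ q, of 1] in \<open>auto simp: mult_ac\<close>)
  finally show ?thesis .
next
  case True
  hence \<sigma>: "\<sigma> = -1" using q by auto
  define a where "a = (\<lambda>m. u m / (real m + 1))"
  obtain C where C: "C \<ge> 0"
    "\<And>m. \<bar>a m\<bar> \<le> C * (real m + 1) powr (- 3 / 4)"
    "\<And>m. \<bar>a m - a (Suc m)\<bar> \<le> C * (real m + 1) powr (- 7 / 4)"
    unfolding a_def by (rule slow_div_bounds[OF u, of 1]) auto
  have B: "B \<ge> 0" using bound[of 0 0] by simp
  define b where "b = (\<lambda>N m :: nat. (real m + 1) powr (-3/4) / \<bar>real N - real m - 3/2\<bar>)"
  define D1 where "D1 = (\<lambda>N m. (a m - a (Suc m)) * k N m)"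
  define D2 where "D2 = (\<lambda>N m. a (Suc m) * (k N m - k N (Suc m)))"
  have D1: "\<bar>D1 N m\<bar> \<le> (C * B) * (real m + 1) powr (- 3 / 2)" for N m
  proof -
    have "\<bar>D1 N m\<bar> \<le> (C * (real m + 1) powr (- 7 / 4)) * (B * (real m + 1) powr (1 / 4))"
      unfolding D1_def abs_mult by (intro mult_mono C bound) (use C in auto)
    also have "\<dots> = (C * B) * ((real m + 1) powr (- 7 / 4) * (real m + 1) powr (1 / 4))" by simp
    also have "(real m + 1) powr (- 7 / 4) * (real m + 1) powr (1 / 4) = (real m + 1) powr (- 3 / 2)"
      by (subst powr_add [symmetric]) simp
    finally show ?thesis .
  qed
  have D2: "\<bar>D2 N m\<bar> \<le> (C * B) * b N m" for N m
  proof -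
    have "\<bar>a (Suc m)\<bar> \<le> C * (real m + 1) powr (- 3 / 4)"
    proof -
      have "\<bar>a (Suc m)\<bar> \<le> C * (real (Suc m) + 1) powr (- 3 / 4)" by (rule C)
      also have "\<dots> \<le> C * (real m + 1) powr (- 3 / 4)"
        using C(1) by (intro mult_left_mono powr_mono2') auto
      finally show ?thesis .
    qed
    moreover have "\<bar>k N m - k N (Suc m)\<bar> \<le> B / \<bar>real N - real m - 3/2\<bar>"
      using diff[of N m] by (simp add: abs_minus_commute)
    ultimately have "\<bar>D2 N m\<bar> \<le> (C * (real m + 1) powr (- 3 / 4)) * (B / \<bar>real N - real m - 3/2\<bar>)"
      unfolding D2_def abs_mult by (intro mult_mono) (use C in auto)
    thus ?thesis by (simp add: b_def mult_ac)
  qed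
  have sD1: "summable (\<lambda>m. \<bar>D1 N m\<bar>)" for N
    by (rule summable_comparison_test[OF _ summable_mult[OF summable_Suc_powr[of "- 3 / 2"], of "C * B"]])
       (use D1 in auto)
  have sD2: "summable (\<lambda>m. \<bar>D2 N m\<bar>)" if "N \<ge> 1" for N
    by (rule summable_comparison_test[OF _ summable_mult[OF boundary_sum_tendsto_0(1)[OF that], of "C * B"]])
       (use D2 in \<open>auto simp: b_def\<close>)
  have abs_summable_sign: "summable (\<lambda>m. (-1) ^ m * f m)" if "summable (\<lambda>m. \<bar>f m\<bar>)" for f :: "nat \<Rightarrow> real"
    by (rule summable_comparison_test[OF _ that]) (auto simp: abs_mult)
  have eq: "(\<Sum>m. of_int \<sigma> ^ m * u m * k N m / (real m + 1) ^ q) =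
              (a 0 * k N 0 + ((\<Sum>m. (-1) ^ m * D1 N m) + (\<Sum>m. (-1) ^ m * D2 N m))) / 2" if N: "N \<ge> 1" for N
  proof -
    have D12: "a m * k N m - a (Suc m) * k N (Suc m) = D1 N m + D2 N m" for m
      by (simp add: D1_def D2_def algebra_simps)
    have "(\<lambda>m. (-1) ^ m * (a m * k N m)) sums
            ((a 0 * k N 0 + (\<Sum>m. (-1) ^ m * (a m * k N m - a (Suc m) * k N (Suc m)))) / 2)"
    proof (rule alternating_by_parts)
      show "(\<lambda>m. a m * k N m) \<longlonglongrightarrow> 0"
      proof (rule Lim_null_comparison)
        have "\<bar>a m * k N m\<bar> \<le> (C * B) * (real m + 1) powr (- 1 / 2)" for m
        proof -
          have "\<bar>a m * k N m\<bar> \<le> (C * (real m + 1) powr (- 3 / 4)) * (B * (real m + 1) powr (1 / 4))"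
            unfolding abs_mult by (intro mult_mono C bound) (use C in auto)
          also have "\<dots> = (C * B) * ((real m + 1) powr (- 3 / 4) * (real m + 1) powr (1 / 4))" by simp
          also have "(real m + 1) powr (- 3 / 4) * (real m + 1) powr (1 / 4) = (real m + 1) powr (- 1 / 2)"
            by (subst powr_add [symmetric]) simp
          finally show ?thesis .
        qed
        thus "\<forall>\<^sub>F m in sequentially. norm (a m * k N m) \<le> (C * B) * (real m + 1) powr (- 1 / 2)"
          by (intro always_eventually) auto
        show "(\<lambda>m. (C * B) * (real m + 1) powr (- 1 / 2)) \<longlonglongrightarrow> 0"
          using tendsto_mult_left[OF powr_tendsto_0[of "-1/2"], of "C * B"] by simp
      qed
      show "summable (\<lambda>m. \<bar>a m * k N m - a (Suc m) * k N (Suc m)\<bar>)"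
        unfolding D12
        by (rule summable_comparison_test[OF _ summable_add[OF sD1[of N] sD2[OF N]]]) auto
    qed
    also have "(\<Sum>m. (-1) ^ m * (a m * k N m - a (Suc m) * k N (Suc m))) =
                 (\<Sum>m. (-1) ^ m * D1 N m) + (\<Sum>m. (-1) ^ m * D2 N m)"
      unfolding D12 distrib_left
      by (intro suminf_add [symmetric] abs_summable_sign sD1 sD2 N)
    finally show ?thesis using True \<sigma> by (simp add: sums_iff a_def mult.assoc)
  qed
  have s: "summable (\<lambda>m. \<bar>a m - a (Suc m)\<bar>)"
    by (rule summable_comparison_test[OF _ summable_mult[OF summable_Suc_powr[of "- 7 / 4"], of C]])
       (use C in auto)
  have eq': "(\<Sum>m. of_int \<sigma> ^ m * u m / (real m + 1) ^ q) =
               (a 0 + (\<Sum>m. (-1) ^ m * (a m - a (Suc m)))) / 2"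
  proof -
    have "a \<longlonglongrightarrow> 0"
    proof (rule Lim_null_comparison)
      show "\<forall>\<^sub>F m in sequentially. norm (a m) \<le> C * (real m + 1) powr (- 3 / 4)"
        using C(2) by (intro always_eventually) auto
      show "(\<lambda>m. C * (real m + 1) powr (- 3 / 4)) \<longlonglongrightarrow> 0"
        using tendsto_mult_left[OF powr_tendsto_0[of "-3/4"], of C] by simp
    qed
    from alternating_by_parts[OF this s] show ?thesis
      using True \<sigma> by (simp add: sums_iff a_def)
  qed
  have lim1: "(\<lambda>N. \<Sum>m. (-1) ^ m * D1 N m) \<longlonglongrightarrow> (\<Sum>m. (-1) ^ m * ((a m - a (Suc m)) * \<kappa>))"
  proof (rule tannerys_theorem[THEN conjunct2, THEN conjunct2])
    show "(\<lambda>N. (-1) ^ m * D1 N m) \<longlonglongrightarrow> (-1) ^ m * ((a m - a (Suc m)) * \<kappa>)" for m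
      unfolding D1_def by (intro tendsto_intros lim)
    show "summable (\<lambda>m. (C * B) * (real m + 1) powr (- 3 / 2))"
      by (intro summable_mult summable_Suc_powr) auto
    show "\<forall>\<^sub>F (m, N) in sequentially \<times>\<^sub>F sequentially.
            norm ((-1) ^ m * D1 N m) \<le> (C * B) * (real m + 1) powr (- 3 / 2)"
      using D1 by (intro always_eventually) (auto simp: abs_mult)
  qed auto
  have lim2: "(\<lambda>N. \<Sum>m. (-1) ^ m * D2 N m) \<longlonglongrightarrow> 0"
  proof (rule Lim_null_comparison)
    show "(\<lambda>N. (C * B) * (\<Sum>m. b N m)) \<longlonglongrightarrow> 0"
      using tendsto_mult_left[OF boundary_sum_tendsto_0(2), of "C * B"] by (simp add: b_def)
    show "\<forall>\<^sub>F N in sequentially. norm (\<Sum>m. (-1) ^ m * D2 N m) \<le> (C * B) * (\<Sum>m. b N m)"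
      using eventually_ge_at_top[of 1]
    proof eventually_elim
      case (elim N)
      have sb: "summable (b N)" unfolding b_def by (rule boundary_sum_tendsto_0(1)[OF elim])
      have "norm (\<Sum>m. (-1) ^ m * D2 N m) \<le> (\<Sum>m. norm ((-1) ^ m * D2 N m))"
        by (rule summable_norm) (use sD2[OF elim] in \<open>simp add: abs_mult\<close>)
      also have "\<dots> = (\<Sum>m. \<bar>D2 N m\<bar>)" by (simp add: abs_mult)
      also have "\<dots> \<le> (\<Sum>m. (C * B) * b N m)"
        by (intro suminf_le D2 sD2 elim summable_mult sb)
      also have "\<dots> = (C * B) * (\<Sum>m. b N m)" by (rule suminf_mult[OF sb])
      finally show ?case .
    qed
  qed
  have "(\<lambda>N. (a 0 * k N 0 + ((\<Sum>m. (-1) ^ m * D1 N m) + (\<Sum>m. (-1) ^ m * D2 N m))) / 2) \<longlonglongrightarrow>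
          (a 0 * \<kappa> + ((\<Sum>m. (-1) ^ m * ((a m - a (Suc m)) * \<kappa>)) + 0)) / 2"
    by (intro tendsto_intros lim lim1 lim2) auto
  also have "(\<Sum>m. (-1) ^ m * ((a m - a (Suc m)) * \<kappa>)) = (\<Sum>m. (-1) ^ m * (a m - a (Suc m))) * \<kappa>"
    using suminf_mult2[OF abs_summable_sign[OF s], of \<kappa>] by (simp add: mult.assoc)
  also have "(a 0 * \<kappa> + ((\<Sum>m. (-1) ^ m * (a m - a (Suc m))) * \<kappa> + 0)) / 2 =
               \<kappa> * (\<Sum>m. of_int \<sigma> ^ m * u m / (real m + 1) ^ q)"
    unfolding eq' by (simp add: field_simps)
  finally show ?thesis
    by (rule Lim_transform_eventually) (intro eventually_mono[OF eventually_ge_at_top[of 1]] eq [symmetric])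
qed

section \<open>Polynomials in harmonic numbers\<close>

text \<open>Sequences \<open>g p s\<close> play the role of harmonic numbers and \<open>w\<close> that of the summation index. A factor
  \<open>\<tau>\<^sup>m\<close> is only admitted together with a positive power of \<open>1 / w m\<close>, so that multiplying by the term
  \<open>\<sigma>\<^sup>m / (w m)\<^sup>q\<close> of a convergent sum never produces the divergent case \<open>(q, \<sigma>) = (1, 1)\<close>.\<close>

inductive hpoly :: "real set \<Rightarrow> (nat \<Rightarrow> int \<Rightarrow> nat \<Rightarrow> real) \<Rightarrow> (nat \<Rightarrow> real) \<Rightarrow> nat \<Rightarrow> (nat \<Rightarrow> real) \<Rightarrow> bool"
  for A g w where
  monomial: "\<lbrakk>rat_polynomial_in A b; length ps \<le> d; \<And>p s. (p, s) \<in> set ps \<Longrightarrow> 1 \<le> p \<and> s \<in> {1, -1};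
     \<tau> \<in> {1, -1}; r = 0 \<Longrightarrow> \<tau> = 1\<rbrakk> \<Longrightarrow>
     hpoly A g w d (\<lambda>m. b * of_int \<tau> ^ m * (\<Prod>(p, s)\<leftarrow>ps. g p s m) / w m ^ r)"
| add: "\<lbrakk>hpoly A g w d u; hpoly A g w d v\<rbrakk> \<Longrightarrow> hpoly A g w d (\<lambda>m. u m + v m)"

lemma hpoly_mono: "hpoly A g w d u \<Longrightarrow> d \<le> d' \<Longrightarrow> hpoly A g w d' u"
proof (induction rule: hpoly.induct)
  case (monomial b ps d \<tau> r)
  thus ?case by (intro hpoly.monomial) auto
qed (auto intro: hpoly.add)

lemma hpoly_const: "rat_polynomial_in A b \<Longrightarrow> hpoly A g w d (\<lambda>_. b)"
  using hpoly.monomial[of A b "[]" d 1 0 g w] by simp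

lemma hpoly_base: "1 \<le> p \<Longrightarrow> s \<in> {1, -1} \<Longrightarrow> 1 \<le> d \<Longrightarrow> hpoly A g w d (g p s)"
  using hpoly.monomial[of A 1 "[(p, s)]" d 1 0 g w] rat_polynomial_in_of_nat[of A 1] by auto

lemma hpoly_inverse_power: "1 \<le> r \<Longrightarrow> \<tau> \<in> {1, -1} \<Longrightarrow> hpoly A g w d (\<lambda>m. of_int \<tau> ^ m / w m ^ r)"
  using hpoly.monomial[of A 1 "[]" d \<tau> r g w] rat_polynomial_in_of_nat[of A 1] by auto

lemma hpoly_mult:
  assumes "hpoly A g w d u" "hpoly A g w e v"
  shows "hpoly A g w (d + e) (\<lambda>m. u m * v m)"
  using assms(1)
proof (induction rule: hpoly.induct)
  case (monomial b ps d \<tau> r)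
  note 1 = monomial
  show ?case using assms(2)
  proof (induction rule: hpoly.induct)
    case (monomial b' ps' e \<tau>' r')
    have "hpoly A g w (d + e) (\<lambda>m. (b * b') * of_int (\<tau> * \<tau>') ^ m * (\<Prod>(p, s)\<leftarrow>ps @ ps'. g p s m) / w m ^ (r + r'))"
      using 1 monomial by (intro hpoly.monomial rat_polynomial_in_mult) auto
    moreover have "(\<lambda>m. (b * b') * of_int (\<tau> * \<tau>') ^ m * (\<Prod>(p, s)\<leftarrow>ps @ ps'. g p s m) / w m ^ (r + r')) =
        (\<lambda>m. (b * of_int \<tau> ^ m * (\<Prod>(p, s)\<leftarrow>ps. g p s m) / w m ^ r) *
             (b' * of_int \<tau>' ^ m * (\<Prod>(p, s)\<leftarrow>ps'. g p s m) / w m ^ r'))"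
      by (simp add: power_add power_mult_distrib mult_ac)
    ultimately show ?case by simp
  qed (simp add: distrib_left hpoly.add)
qed (simp add: distrib_right hpoly.add)

lemma hpoly_mult_le:
  assumes "hpoly A g w d u" "hpoly A g w e v" "d + e \<le> n"
  shows "hpoly A g w n (\<lambda>m. u m * v m)"
  using hpoly_mono[OF hpoly_mult[OF assms(1,2)] assms(3)] .

lemma hpoly_cmult:
  assumes "rat_polynomial_in A c" "hpoly A g w d u"
  shows "hpoly A g w d (\<lambda>m. c * u m)"
  using hpoly_mult_le[OF hpoly_const[OF assms(1), of g w 0] assms(2)] by simp

lemma hpoly_sum:
  assumes "\<And>i. i \<in> I \<Longrightarrow> hpoly A g w d (u i)"
  shows "hpoly A g w d (\<lambda>m. \<Sum>i\<in>I. u i m)"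
  using assms
  by (induction I rule: infinite_finite_induct)
     (auto intro: hpoly.add hpoly_const rat_polynomial_in_of_nat[of A 0, simplified])

lemma inverse_shift_le:
  assumes "0 < c" "c \<le> 1" "r \<ge> 1"
  shows "1 / (real m + c) ^ r \<le> (1 / c) ^ r / (real m + 1)"
proof -
  obtain r' where r: "r = Suc r'" using assms(3) by (cases r) auto
  have "c * (real m + 1) \<le> real m + c"
    using assms(1,2) mult_right_mono[of c 1 "real m"] by (simp add: algebra_simps)
  hence "1 / (real m + c) \<le> 1 / (c * (real m + 1))"
    using assms by (intro divide_left_mono) auto
  moreover have "1 / (real m + c) \<le> 1 / c" using assms by (intro divide_left_mono) auto
  ultimately have "1 / (real m + c) * (1 / (real m + c)) ^ r' \<le> 1 / (c * (real m + 1)) * (1 / c) ^ r'"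
    using assms by (intro mult_mono power_mono) auto
  thus ?thesis by (simp add: r power_one_over field_simps)
qed

lemma hpoly_slow:
  assumes "hpoly A g w d u" "0 < c" "c \<le> 1" "\<And>m. w m = real m + c"
    and g: "\<And>p s. 1 \<le> p \<Longrightarrow> s \<in> {1, -1} \<Longrightarrow> slow (g p s)"
  shows "slow u"
  using assms(1)
proof (induction rule: hpoly.induct)
  case (monomial b ps d \<tau> r)
  have 1: "slow (\<lambda>m. of_int \<tau> ^ m / w m ^ r)"
  proof (cases "r = 0")
    case True thus ?thesis using monomial by (simp add: slow_const)
  next
    case False
    show ?thesis
    proof (rule slow_of_bound)
      fix m
      have "\<bar>of_int \<tau> ^ m / w m ^ r\<bar> = 1 / (real m + c) ^ r"
        using monomial(4) assms by (auto simp: abs_mult power_abs)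
      also have "\<dots> \<le> (1 / c) ^ r / (real m + 1)" using False assms by (intro inverse_shift_le) auto
      finally show "\<bar>of_int \<tau> ^ m / w m ^ r\<bar> \<le> (1 / c) ^ r / (real m + 1)" .
    qed
  qed
  have 2: "slow (\<lambda>m. \<Prod>(p, s)\<leftarrow>ps. g p s m)" using monomial(3)
  proof (induction ps)
    case (Cons x ps)
    obtain p s where x: "x = (p, s)" by (cases x)
    have "slow (\<lambda>m. g p s m * (\<Prod>(p, s)\<leftarrow>ps. g p s m))"
      using Cons x by (intro slow_mult g Cons.IH) auto
    thus ?case by (simp add: x)
  qed (simp add: slow_const)
  have "slow (\<lambda>m. b * ((of_int \<tau> ^ m / w m ^ r) * (\<Prod>(p, s)\<leftarrow>ps. g p s m)))"
    by (intro slow_mult 1 2 slow_const)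
  thus ?case by (simp add: mult_ac)
qed (rule slow_add)

text \<open>A monomial merges with \<open>\<sigma> ^ m / w m ^ q\<close> into a term as in
  \<open>val\<close>, with sign \<open>\<sigma> * \<tau>\<close> and exponent \<open>q + r\<close>.
  Slowness supplies the convergence of every piece, which the splitting of the series rests
  on.\<close>

lemma hpoly_value:
  assumes "hpoly A g w d u" "0 < c" "c \<le> 1" "\<And>m. w m = real m + c"
    and g: "\<And>p s. 1 \<le> p \<Longrightarrow> s \<in> {1, -1} \<Longrightarrow> slow (g p s)"
    and val: "\<And>ps \<sigma> q. \<lbrakk>length ps \<le> d; \<And>p s. (p, s) \<in> set ps \<Longrightarrow> 1 \<le> p \<and> s \<in> {1, -1};
       q \<ge> 1; \<sigma> \<in> {1, -1}; (q, \<sigma>) \<noteq> (1, 1)\<rbrakk> \<Longrightarrow>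
       rat_polynomial_in A (\<Sum>m. of_int \<sigma> ^ m * (\<Prod>(p, s)\<leftarrow>ps. g p s m) / w m ^ q)"
    and q: "q \<ge> 1" "\<sigma> \<in> {1, -1 :: int}" "(q, \<sigma>) \<noteq> (1, 1)"
  shows "rat_polynomial_in A (\<Sum>m. of_int \<sigma> ^ m * u m / w m ^ q)"
  using assms(1) val
proof (induction rule: hpoly.induct)
  case (monomial b ps d \<tau> r)
  have adm: "q + r \<ge> 1" "\<sigma> * \<tau> \<in> {1, -1}" "(q + r, \<sigma> * \<tau>) \<noteq> (1, 1)"
    using q monomial(4,5) by auto
  have ps: "hpoly A g w d (\<lambda>m. \<Prod>(p, s)\<leftarrow>ps. g p s m)"
    using hpoly.monomial[of A 1 ps d 1 0 g w] monomial rat_polynomial_in_of_nat[of A 1] by auto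
  have "summable (\<lambda>m. of_int (\<sigma> * \<tau>) ^ m * (\<Prod>(p, s)\<leftarrow>ps. g p s m) / w m ^ (q + r))"
    unfolding assms(4) by (rule slow_summable[OF hpoly_slow[OF ps assms(2,3,4) g] assms(2,3) adm])
  hence "(\<Sum>m. b * (of_int (\<sigma> * \<tau>) ^ m * (\<Prod>(p, s)\<leftarrow>ps. g p s m) / w m ^ (q + r))) =
          b * (\<Sum>m. of_int (\<sigma> * \<tau>) ^ m * (\<Prod>(p, s)\<leftarrow>ps. g p s m) / w m ^ (q + r))"
    by (rule suminf_mult)
  moreover have "rat_polynomial_in A \<dots>"
    using monomial.hyps(3)
    by (intro rat_polynomial_in_mult monomial.hyps(1) monomial.prems monomial.hyps(2) adm)
  moreover have "(\<lambda>m. b * (of_int (\<sigma> * \<tau>) ^ m * (\<Prod>(p, s)\<leftarrow>ps. g p s m) / w m ^ (q + r))) =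
       (\<lambda>m. of_int \<sigma> ^ m * (b * of_int \<tau> ^ m * (\<Prod>(p, s)\<leftarrow>ps. g p s m) / w m ^ r) / w m ^ q)"
    by (simp add: power_add power_mult_distrib mult_ac)
  ultimately show ?case by simp
next
  case (add d u v)
  have s: "summable (\<lambda>m. of_int \<sigma> ^ m * x m / w m ^ q)" if "hpoly A g w d x" for x
    unfolding assms(4) by (rule slow_summable[OF hpoly_slow[OF that assms(2,3,4) g] assms(2,3) q])
  have "(\<Sum>m. of_int \<sigma> ^ m * (u m + v m) / w m ^ q) =
          (\<Sum>m. of_int \<sigma> ^ m * u m / w m ^ q) + (\<Sum>m. of_int \<sigma> ^ m * v m / w m ^ q)"
    using suminf_add[OF s[OF add(1)] s[OF add(2)]] by (simp add: distrib_left add_divide_distrib)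
  moreover have "rat_polynomial_in A (\<Sum>m. of_int \<sigma> ^ m * u m / w m ^ q)" by (rule add.IH(1)[OF add.prems])
  moreover have "rat_polynomial_in A (\<Sum>m. of_int \<sigma> ^ m * v m / w m ^ q)" by (rule add.IH(2)[OF add.prems])
  ultimately show ?case by (simp add: rat_polynomial_in_add)
qed

section \<open>From monomials in harmonic numbers to Euler sums\<close>

lemma prod_list_conv_prod_nth_shift:
  "(\<Prod>x\<leftarrow>xs. f x) = (\<Prod>i=1..length xs. f (xs ! (i - 1)))"
proof -
  have "(\<Prod>x\<leftarrow>xs. f x) = (\<Prod>i<length xs. f (xs ! i))"
    by (simp add: prod.list_conv_set_nth atLeast0LessThan)
  also have "\<dots> = (\<Prod>i=1..length xs. f (xs ! (i - 1)))"
    by (rule prod.reindex_bij_witness[of _ "\<lambda>i. i - 1" Suc]) auto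
  finally show ?thesis .
qed

text \<open>S-sums contain \<open>H_harm p s n\<close>, T-sums \<open>h_harm p s (n - 1)\<close>.
  With the summation index \<open>m = n - 1\<close> only the former need a shifted argument.\<close>

abbreviation H_seq :: "nat \<Rightarrow> int \<Rightarrow> nat \<Rightarrow> real" where
  "H_seq p s m \<equiv> H_harm p s (Suc m)"

lemma S_value:
  assumes "length ps < k" "\<And>p s. (p, s) \<in> set ps \<Longrightarrow> 1 \<le> p \<and> s \<in> {1, -1}"
    "q \<ge> 1" "\<sigma> \<in> {1, -1}" "(q, \<sigma>) \<noteq> (1, 1)"
  shows "rat_polynomial_in (Euler_sums_below k)
           (\<Sum>m. of_int \<sigma> ^ m * (\<Prod>(p, s)\<leftarrow>ps. H_seq p s m) / (real m + 1) ^ q)"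
proof -
  define p where "p = (\<lambda>i. fst (ps ! (i - 1)))"
  define s where "s = (\<lambda>i. snd (ps ! (i - 1)))"
  have "(p i, s i) \<in> set ps" if "i \<in> {1..length ps}" for i
    using that by (auto simp: p_def s_def)
  hence adm: "Euler_admissible (length ps) p s q \<sigma>"
    using assms(2-5) unfolding Euler_admissible_def by blast
  have "(\<Sum>m. of_int \<sigma> ^ m * (\<Prod>(p, s)\<leftarrow>ps. H_seq p s m) / (real m + 1) ^ q) =
          Euler_S_sum (length ps) p s q \<sigma>"
    unfolding Euler_S_sum_def Euler_S_term_def prod_list_conv_prod_nth_shift
    by (simp add: p_def s_def case_prod_unfold add.commute)
  thus ?thesis using adm assms(1)
    by (auto simp: Euler_sums_below_def intro!: rat_polynomial_in_elem)
qed

lemma T_value: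
  assumes "length ps < k" "\<And>p s. (p, s) \<in> set ps \<Longrightarrow> 1 \<le> p \<and> s \<in> {1, -1}"
    "q \<ge> 1" "\<sigma> \<in> {1, -1}" "(q, \<sigma>) \<noteq> (1, 1)"
  shows "rat_polynomial_in (Euler_sums_below k)
           (\<Sum>m. of_int \<sigma> ^ m * (\<Prod>(p, s)\<leftarrow>ps. h_harm p s m) / (real m + 1/2) ^ q)"
proof -
  define p where "p = (\<lambda>i. fst (ps ! (i - 1)))"
  define s where "s = (\<lambda>i. snd (ps ! (i - 1)))"
  have "(p i, s i) \<in> set ps" if "i \<in> {1..length ps}" for i
    using that by (auto simp: p_def s_def)
  hence adm: "Euler_admissible (length ps) p s q \<sigma>"
    using assms(2-5) unfolding Euler_admissible_def by blast
  have "(\<Sum>m. of_int \<sigma> ^ m * (\<Prod>(p, s)\<leftarrow>ps. h_harm p s m) / (real m + 1/2) ^ q) =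
          Euler_T_sum (length ps) p s q \<sigma>"
    unfolding Euler_T_sum_def Euler_T_term_def prod_list_conv_prod_nth_shift
    by (simp add: p_def s_def case_prod_unfold algebra_simps)
  thus ?thesis using adm assms(1)
    by (auto simp: Euler_sums_below_def intro!: rat_polynomial_in_elem)
qed

lemma h_harm_0 [simp]: "h_harm p s 0 = 0"
  by (simp add: h_harm_def)

lemma h_harm_Suc: "h_harm p s (Suc m) = h_harm p s m + of_int s ^ m / (real m + 1/2) ^ p"
  by (simp add: h_harm_def algebra_simps)

lemma H_harm_0 [simp]: "H_harm p s 0 = 0"
  by (simp add: H_harm_def)

lemma H_harm_Suc: "H_harm p s (Suc m) = H_harm p s m + of_int s ^ m / (real m + 1) ^ p"
  by (simp add: H_harm_def algebra_simps)

lemma slow_h_harm: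
  assumes "1 \<le> p" "s \<in> {1, -1}" shows "slow (h_harm p s)"
proof (rule slow_of_diff_bound)
  fix m
  have "\<bar>h_harm p s (Suc m) - h_harm p s m\<bar> = 1 / (real m + 1/2) ^ p"
    using assms by (auto simp: h_harm_Suc abs_mult power_abs)
  also have "\<dots> \<le> (1 / (1/2)) ^ p / (real m + 1)"
    using assms by (intro inverse_shift_le) auto
  finally show "\<bar>h_harm p s (Suc m) - h_harm p s m\<bar> \<le> (1 / (1/2)) ^ p / (real m + 1)" .
qed

lemma slow_H_seq:
  assumes "1 \<le> p" "s \<in> {1, -1}" shows "slow (H_seq p s)"
proof (rule slow_of_diff_bound)
  fix m
  have "\<bar>H_seq p s (Suc m) - H_seq p s m\<bar> = 1 / (real (Suc m) + 1) ^ p"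
    using assms by (auto simp: H_harm_Suc[of p s "Suc m"] abs_mult power_abs)
  also have "\<dots> \<le> 1 / (real m + 1) ^ p"
    by (intro divide_left_mono power_mono) auto
  also have "\<dots> \<le> (1 / 1) ^ p / (real m + 1)"
    using assms by (intro inverse_shift_le) auto
  finally show "\<bar>H_seq p s (Suc m) - H_seq p s m\<bar> \<le> 1 / (real m + 1)" by simp
qed

lemma hpoly_S_value:
  assumes "hpoly (Euler_sums_below k) H_seq (\<lambda>m. real m + 1) d u" "d < k"
    "q \<ge> 1" "\<sigma> \<in> {1, -1}" "(q, \<sigma>) \<noteq> (1, 1)"
  shows "rat_polynomial_in (Euler_sums_below k) (\<Sum>m. of_int \<sigma> ^ m * u m / (real m + 1) ^ q)"
  by (rule hpoly_value[OF assms(1), of 1]) (use assms S_value slow_H_seq in auto)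

lemma hpoly_T_value:
  assumes "hpoly (Euler_sums_below k) h_harm (\<lambda>m. real m + 1/2) d u" "d < k"
    "q \<ge> 1" "\<sigma> \<in> {1, -1}" "(q, \<sigma>) \<noteq> (1, 1)"
  shows "rat_polynomial_in (Euler_sums_below k) (\<Sum>m. of_int \<sigma> ^ m * u m / (real m + 1/2) ^ q)"
  by (rule hpoly_value[OF assms(1), of "1/2"]) (use assms T_value slow_h_harm in auto)

lemma hpoly_S_slow:
  assumes "hpoly A H_seq (\<lambda>m. real m + 1) d u" shows "slow u"
  by (rule hpoly_slow[OF assms, of 1]) (use slow_H_seq in auto)

lemma hpoly_T_slow:
  assumes "hpoly A h_harm (\<lambda>m. real m + 1/2) d u" shows "slow u"
  by (rule hpoly_slow[OF assms, of "1/2"]) (use slow_h_harm in auto)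

section \<open>Partial fractions of the truncated products\<close>

text \<open>\<open>psi\<close> truncates \<open>\<Sum>j\<ge>0. s\<^sup>j / (j - x)\<^sup>p\<close>. The subtracted constant makes the only divergent case
  \<open>p = s = 1\<close> converge, as in the series of the digamma function.\<close>

definition reg_const :: "nat \<Rightarrow> int \<Rightarrow> nat \<Rightarrow> real" where
  "reg_const p s M = (if p = 1 \<and> s = 1 then H_harm 1 1 M else 0)"

definition psi :: "nat \<Rightarrow> nat \<Rightarrow> int \<Rightarrow> 'a \<Rightarrow> 'a :: real_normed_field" where
  "psi M p s x = (\<Sum>j\<le>M. of_int s ^ j / (of_nat j - x) ^ p) - of_real (reg_const p s M)"

text \<open>For \<open>n \<le> M\<close> the Laurent expansion of \<open>psi M p s\<close> at \<open>n\<close> is \<open>s\<^sup>n z\<^sup>-\<^sup>p\<close> times the power series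
  \<open>psi_fps M p s n\<close>.\<close>

definition psi_coeff :: "nat \<Rightarrow> nat \<Rightarrow> int \<Rightarrow> nat \<Rightarrow> nat \<Rightarrow> real" where
  "psi_coeff M p s n f =
     of_nat ((p + f - 1) choose f) *
       ((\<Sum>l=1..M-n. of_int s ^ l / real l ^ (p + f)) + (-1) ^ (p + f) * of_int s * H_harm (p + f) s n)
     - (if f = 0 then reg_const p s M else 0)"

definition psi_fps :: "nat \<Rightarrow> nat \<Rightarrow> int \<Rightarrow> nat \<Rightarrow> real fps" where
  "psi_fps M p s n =
     Abs_fps (\<lambda>j. if j = 0 then (-1) ^ p else if j < p then 0 else psi_coeff M p s n (j - p))"

text \<open>Residues live over the complex numbers, while limits and rational expressions concern
  real coefficients; this embedding connects the two.\<close>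

definition cfps :: "real fps \<Rightarrow> complex fps" where
  "cfps F = Abs_fps (\<lambda>n. of_real (fps_nth F n))"

lemma cfps_nth [simp]: "fps_nth (cfps F) n = of_real (fps_nth F n)"
  by (simp add: cfps_def)

lemma cfps_mult: "cfps (F * G) = cfps F * cfps G"
  by (simp add: fps_eq_iff fps_mult_nth)

lemma cfps_1: "cfps 1 = 1"
  by (simp add: fps_eq_iff)

lemma cfps_prod: "cfps (\<Prod>i\<in>I. F i) = (\<Prod>i\<in>I. cfps (F i))"
  by (induction I rule: infinite_finite_induct) (simp_all add: cfps_mult cfps_1)

lemma fps_const_prod: "(\<Prod>i\<in>I. fps_const (f i)) = fps_const (\<Prod>i\<in>I. f i)"
  by (induction I rule: infinite_finite_induct) auto

lemma inverse_minus_power: "1 / (- x) ^ n = (-1) ^ n / (x :: 'a :: field) ^ n"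
  by (cases "even n") auto

text \<open>Indices above \<open>n\<close> are shifted. Those below are reflected, which produces
  \<open>(-1) ^ w\<close> and, because \<open>s * s = 1\<close>, the sign
  \<open>s ^ (n - l) = s ^ n * s * s ^ (l - 1)\<close>.\<close>

lemma sum_punctured:
  fixes s :: int
  assumes "n \<le> M" "s \<in> {1, -1}"
  shows "(\<Sum>j\<in>{..M} - {n}. of_int s ^ j / (real j - real n) ^ w) =
           of_int s ^ n * ((\<Sum>l=1..M-n. of_int s ^ l / real l ^ w) + (-1) ^ w * of_int s * H_harm w s n)"
proof -
  have split: "{..M} - {n} = {..<n} \<union> {n<..M}" using assms by auto
  have "(\<Sum>j\<in>{..M} - {n}. of_int s ^ j / (real j - real n) ^ w) =
          (\<Sum>j<n. of_int s ^ j / (real j - real n) ^ w) + (\<Sum>j\<in>{n<..M}. of_int s ^ j / (real j - real n) ^ w)"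
    unfolding split by (rule sum.union_disjoint) auto
  also have "(\<Sum>j<n. of_int s ^ j / (real j - real n) ^ w) =
               (\<Sum>l=1..n. of_int s ^ n * ((-1) ^ w * of_int s * (of_int s ^ (l - 1) / real l ^ w)))"
  proof (rule sum.reindex_bij_witness[of _ "\<lambda>l. n - l" "\<lambda>j. n - j"])
    fix j assume j: "j \<in> {..<n}"
    define l where "l = n - j"
    have l: "n = j + l" "l \<ge> 1" using j by (auto simp: l_def)
    have "(of_int s :: real) ^ n * (of_int s * of_int s ^ (l - 1)) = of_int s ^ j * (of_int s * of_int s) ^ l"
      using l by (simp add: power_add power_mult_distrib flip: power_Suc)
    hence "(of_int s :: real) ^ n * (of_int s * of_int s ^ (l - 1)) = of_int s ^ j"
      using assms(2) by auto
    moreover have "(real j - real n) ^ w = (-1) ^ w * real l ^ w"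
      using l by (simp add: power_mult_distrib [symmetric])
    moreover have "1 / ((-1 :: real) ^ w * real l ^ w) = (-1) ^ w / real l ^ w"
      using inverse_minus_power[of "real l" w] by (simp flip: power_mult_distrib)
    ultimately show "of_int s ^ n * ((-1) ^ w * of_int s * (of_int s ^ (n - j - 1) / real (n - j) ^ w)) =
          of_int s ^ j / (real j - real n) ^ w"
      unfolding l_def [symmetric]
      by (metis (no_types, opaque_lifting) divide_divide_eq_left' mult.assoc mult.commute times_divide_eq_right mult.right_neutral)
  qed auto
  also have "(\<Sum>j\<in>{n<..M}. of_int s ^ j / (real j - real n) ^ w) =
               (\<Sum>l=1..M-n. of_int s ^ n * (of_int s ^ l / real l ^ w))"
    by (rule sum.reindex_bij_witness[of _ "\<lambda>l. n + l" "\<lambda>j. j - n"])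
       (use assms in \<open>auto simp: power_add [symmetric] of_nat_diff\<close>)
  finally show ?thesis
    by (simp add: H_harm_def sum_distrib_left distrib_left mult_ac)
qed

text \<open>The summand \<open>j = n\<close> is the entire pole. The others are analytic at
  \<open>n\<close>, so after multiplication by \<open>z ^ p\<close> they start at order
  \<open>p\<close>; this explains the gap of zero coefficients strictly between 0 and
  \<open>p\<close>.\<close>

lemma psi_expansion:
  fixes s :: int
  assumes "n \<le> M" "s \<in> {1, -1}" "p \<ge> 1"
  obtains V where "V has_fps_expansion (fps_const (of_int s ^ n) * cfps (psi_fps M p s n))"
    "\<And>z. z \<noteq> 0 \<Longrightarrow> psi M p s (of_nat n + z) = V z / (z :: complex) ^ p"
proof -
  define c :: complex where "c = of_real (reg_const p s M)"
  define E where "E = (\<lambda>j. Abs_fps (\<lambda>f. of_nat ((p + f - 1) choose f) / (of_nat j - of_nat n :: complex) ^ (p + f)))"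
  define V where "V = (\<lambda>z. of_int s ^ n * (-1) ^ p +
     z ^ p * ((\<Sum>j\<in>{..M} - {n}. of_int s ^ j * (1 / ((of_nat j - of_nat n :: complex) - z) ^ p)) - c))"
  have "V has_fps_expansion (fps_const (of_int s ^ n * (-1) ^ p) +
     fps_X ^ p * ((\<Sum>j\<in>{..M} - {n}. fps_const (of_int s ^ j) * E j) - fps_const c))"
    unfolding V_def E_def
    using assms by (intro fps_expansion_intros has_fps_expansion_inverse_power) auto
  also have "(fps_const (of_int s ^ n * (-1) ^ p) +
     fps_X ^ p * ((\<Sum>j\<in>{..M} - {n}. fps_const (of_int s ^ j) * E j) - fps_const c)) =
     fps_const (of_int s ^ n) * cfps (psi_fps M p s n)"
  proof (rule fps_ext)
    fix i
    \<comment> \<open>The regularising constant is nonzero only for \<open>s = 1\<close>, so the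
      sign can be taken out of it as well.\<close>
    have sc: "of_int s ^ n * c = c"
      using assms by (auto simp: c_def reg_const_def)
    have "(\<Sum>j\<in>{..M} - {n}. of_int s ^ j * fps_nth (E j) f) = of_int s ^ n * of_real (of_nat ((p + f - 1) choose f) *
       ((\<Sum>l=1..M-n. of_int s ^ l / real l ^ (p + f)) + (-1) ^ (p + f) * of_int s * H_harm (p + f) s n))" for f
    proof -
      have "(\<Sum>j\<in>{..M} - {n}. of_int s ^ j * fps_nth (E j) f) =
              of_nat ((p + f - 1) choose f) * of_real (\<Sum>j\<in>{..M} - {n}. of_int s ^ j / (real j - real n) ^ (p + f))"
        by (simp add: E_def sum_distrib_left mult_ac)
      thus ?thesis unfolding sum_punctured[OF assms(1,2)] by (simp add: mult_ac)
    qed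
    note sum = this
    show "fps_nth (fps_const (of_int s ^ n * (-1) ^ p) +
     fps_X ^ p * ((\<Sum>j\<in>{..M} - {n}. fps_const (of_int s ^ j) * E j) - fps_const c)) i =
     fps_nth (fps_const (of_int s ^ n) * cfps (psi_fps M p s n)) i"
    proof (cases "i < p")
      case True
      thus ?thesis using assms(3) by (auto simp: psi_fps_def fps_X_power_mult_nth)
    next
      case False
      hence i: "i \<noteq> 0" using assms(3) by auto
      have "fps_nth (fps_const (of_int s ^ n * (-1) ^ p) +
         fps_X ^ p * ((\<Sum>j\<in>{..M} - {n}. fps_const (of_int s ^ j) * E j) - fps_const c)) i =
         (\<Sum>j\<in>{..M} - {n}. of_int s ^ j * fps_nth (E j) (i - p)) - (if i - p = 0 then c else 0)"
        using False i by (simp add: fps_X_power_mult_nth fps_sum_nth)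
      also have "\<dots> = of_int s ^ n * of_real (psi_coeff M p s n (i - p))"
        unfolding sum psi_coeff_def using sc
        by (auto simp: c_def right_diff_distrib)
      also have "\<dots> = fps_nth (fps_const (of_int s ^ n) * cfps (psi_fps M p s n)) i"
        using False i by (simp add: psi_fps_def)
      finally show ?thesis .
    qed
  qed
  finally have V: "V has_fps_expansion (fps_const (of_int s ^ n) * cfps (psi_fps M p s n))" .
  have "psi M p s (of_nat n + z) = V z / z ^ p" if "z \<noteq> 0" for z
  proof -
    have "(\<Sum>j\<le>M. of_int s ^ j / (of_nat j - (of_nat n + z)) ^ p) =
       of_int s ^ n / (- z) ^ p + (\<Sum>j\<in>{..M} - {n}. of_int s ^ j * (1 / ((of_nat j - of_nat n) - z) ^ p))"
      using assms(1) by (subst sum.remove[of _ n]) (auto simp: algebra_simps)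
    moreover have "of_int s ^ n / (- z) ^ p = of_int s ^ n * (-1) ^ p / z ^ p"
      using inverse_minus_power[of z p] by (metis mult.right_neutral times_divide_eq_right)
    ultimately show ?thesis
      using that by (simp add: psi_def V_def c_def add_divide_distrib)
  qed
  with V show ?thesis using that by blast
qed

text \<open>At \<open>n \<noteq> 0\<close> the function \<open>1 / z\<^sup>q\<close> expands as \<open>weight_fps q n / weight q n\<close>; at \<open>0\<close> it is a pole, which
  is accounted for by the order of the pole instead.\<close>

definition weight_fps :: "nat \<Rightarrow> nat \<Rightarrow> real fps" where
  "weight_fps q n = (if n = 0 then 1 else
     Abs_fps (\<lambda>e. (-1) ^ e * of_nat ((q + e - 1) choose e) / real n ^ e))"

definition weight :: "nat \<Rightarrow> nat \<Rightarrow> real" where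
  "weight q n = (if n = 0 then 1 else real n ^ q)"

lemma weight_expansion:
  assumes "n \<noteq> 0" "q \<ge> 1"
  shows "(\<lambda>z :: complex. 1 / (of_nat n + z) ^ q) has_fps_expansion
           fps_const (of_real (1 / weight q n)) * cfps (weight_fps q n)"
proof -
  have "(\<lambda>z :: complex. (-1) ^ q * (1 / (- of_nat n - z) ^ q)) has_fps_expansion
          fps_const ((-1) ^ q) * Abs_fps (\<lambda>f. of_nat ((q + f - 1) choose f) / (- of_nat n) ^ (q + f))"
    using assms by (intro fps_expansion_intros has_fps_expansion_inverse_power) auto
  also have "fps_const ((-1 :: complex) ^ q) * Abs_fps (\<lambda>f. of_nat ((q + f - 1) choose f) / (- of_nat n) ^ (q + f)) =
               fps_const (of_real (1 / weight q n)) * cfps (weight_fps q n)"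
  proof (rule fps_ext)
    fix f
    have "(-1 :: complex) ^ q / (- of_nat n) ^ (q + f) = (-1) ^ q * (1 / (- of_nat n) ^ (q + f))" by simp
    also have "\<dots> = (-1) ^ q * (-1) ^ (q + f) / of_nat n ^ (q + f)"
      unfolding inverse_minus_power by simp
    also have "(-1 :: complex) ^ q * (-1) ^ (q + f) = (-1) ^ f"
      by (simp add: power_add mult.assoc [symmetric] flip: power_mult_distrib)
    finally have "(-1 :: complex) ^ q / (- of_nat n) ^ (q + f) = (-1) ^ f / of_nat n ^ (q + f)" .
    hence "of_nat ((q + f - 1) choose f) * ((-1 :: complex) ^ q / (- of_nat n) ^ (q + f)) =
           of_nat ((q + f - 1) choose f) * ((-1) ^ f / of_nat n ^ (q + f))" by simp
    thus "fps_nth (fps_const ((-1 :: complex) ^ q) * Abs_fps (\<lambda>f. of_nat ((q + f - 1) choose f) / (- of_nat n) ^ (q + f))) f =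
          fps_nth (fps_const (of_real (1 / weight q n)) * cfps (weight_fps q n)) f"
      using assms by (simp add: weight_fps_def weight_def power_add mult_ac)
  qed
  also have "(\<lambda>z :: complex. (-1) ^ q * (1 / (- of_nat n - z) ^ q)) = (\<lambda>z. 1 / (of_nat n + z) ^ q)"
  proof
    fix z :: complex
    have eq: "- of_nat n - z = - (of_nat n + z)" by simp
    show "(-1) ^ q * (1 / (- of_nat n - z) ^ q) = 1 / (of_nat n + z) ^ q"
      unfolding eq inverse_minus_power times_divide_eq_right by (simp flip: power_mult_distrib)
  qed
  finally show ?thesis .
qed

text \<open>The sign \<open>s ^ n\<close> of each factor and \<open>1 / weight q n\<close> stay
  outside, so that what is left has coefficients converging with \<open>M\<close> and growing slowly
  in \<open>n\<close>.\<close>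

definition res_fps :: "nat \<Rightarrow> nat \<Rightarrow> (nat \<Rightarrow> nat) \<Rightarrow> (nat \<Rightarrow> int) \<Rightarrow> nat \<Rightarrow> nat \<Rightarrow> real fps" where
  "res_fps M k p s q n = (\<Prod>i=1..k. psi_fps M (p i) (s i) n) * weight_fps q n"

text \<open>Regularisation can make this limit nonzero; the decay of the whole product then comes
  from \<open>1 / z ^ q\<close> with \<open>q \<ge> 1\<close>.\<close>

lemma psi_tendsto_at_infinity:
  assumes "p \<ge> 1"
  shows "((\<lambda>z :: complex. psi M p s z) \<longlongrightarrow> - of_real (reg_const p s M)) at_infinity"
proof -
  have "((\<lambda>z :: complex. (\<Sum>j\<le>M. of_int s ^ j * inverse (of_nat j - z) ^ p) - of_real (reg_const p s M))
          \<longlongrightarrow> (\<Sum>j\<le>M. of_int s ^ j * 0 ^ p) - of_real (reg_const p s M)) at_infinity"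
  proof (intro tendsto_intros)
    fix j
    have "filterlim (\<lambda>z :: complex. z + (- of_nat j)) at_infinity at_infinity"
      by (rule tendsto_add_filterlim_at_infinity'[OF filterlim_ident tendsto_const])
    from tendsto_minus[OF filterlim_compose[OF tendsto_inverse_0 this]]
    show "((\<lambda>z :: complex. inverse (of_nat j - z)) \<longlongrightarrow> 0) at_infinity"
      by (simp flip: inverse_minus_eq)
  qed
  thus ?thesis using assms by (simp add: psi_def divide_inverse power_inverse zero_power)
qed

text \<open>Each \<open>psi\<close> contributes \<open>p i\<close> to the order of the pole at
  \<open>n \<le> M\<close>, and \<open>1 / x ^ q\<close> adds \<open>q\<close> to the order at 0.
  All coefficients are real, so the complex identity descends to real \<open>x\<close>.\<close>

lemma partial_fractions_real:
  fixes x :: real and s :: "nat \<Rightarrow> int"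
  assumes k: "k \<ge> 1" and p: "\<And>i. i \<in> {1..k} \<Longrightarrow> 1 \<le> p i" and s: "\<And>i. i \<in> {1..k} \<Longrightarrow> s i \<in> {1, -1}"
    and q: "q \<ge> 1" and x: "x \<notin> \<nat>"
  defines "P \<equiv> (\<Sum>i=1..k. p i)"
  shows "(\<Prod>i=1..k. psi M (p i) (s i) x) / x ^ q =
     (\<Sum>n\<le>M. \<Sum>d<(if n = 0 then P + q else P).
        (\<Prod>i=1..k. of_int (s i)) ^ n / weight q n * fps_nth (res_fps M k p s q n) ((if n = 0 then P + q else P) - 1 - d)
          / (x - real n) ^ (d + 1))"
proof -
  define f where "f = (\<lambda>z :: complex. (\<Prod>i=1..k. psi M (p i) (s i) z) / z ^ q)"
  define D where "D = (\<lambda>n :: nat. if n = 0 then P + q else P)"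
  define U where "U = (\<lambda>n. fps_const (of_real ((\<Prod>i=1..k. of_int (s i)) ^ n / weight q n)) * cfps (res_fps M k p s q n))"
  have "\<exists>W. W has_fps_expansion U n \<and> (\<forall>\<^sub>F z in at 0. f (of_nat n + z) = W z / z ^ D n)" if n: "n \<le> M" for n
  proof -
    have "\<exists>V. V has_fps_expansion (fps_const (of_int (s i) ^ n) * cfps (psi_fps M (p i) (s i) n)) \<and>
            (\<forall>z. z \<noteq> 0 \<longrightarrow> psi M (p i) (s i) (of_nat n + z) = V z / (z :: complex) ^ p i)" if "i \<in> {1..k}" for i
      using psi_expansion[OF n s[OF that] p[OF that]] by metis
    then obtain V where V: "\<And>i. i \<in> {1..k} \<Longrightarrow> V i has_fps_expansion (fps_const (of_int (s i) ^ n) * cfps (psi_fps M (p i) (s i) n))"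
       "\<And>i z. i \<in> {1..k} \<Longrightarrow> z \<noteq> 0 \<Longrightarrow> psi M (p i) (s i) (of_nat n + z) = V i z / (z :: complex) ^ p i"
      by metis
    define R where "R = (\<lambda>z :: complex. if n = 0 then 1 else 1 / (of_nat n + z) ^ q)"
    have R: "R has_fps_expansion fps_const (of_real (1 / weight q n)) * cfps (weight_fps q n)"
    proof (cases "n = 0")
      case True
      have "cfps (weight_fps q n) = 1" using True by (simp add: weight_fps_def fps_eq_iff)
      thus ?thesis using True by (simp add: R_def weight_def)
    qed (use weight_expansion[of n q] q in \<open>simp add: R_def\<close>)
    have "(\<lambda>z. (\<Prod>i=1..k. V i z) * R z) has_fps_expansion
            (\<Prod>i=1..k. fps_const (of_int (s i) ^ n) * cfps (psi_fps M (p i) (s i) n)) *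
            (fps_const (of_real (1 / weight q n)) * cfps (weight_fps q n))"
      by (intro fps_expansion_intros V R)
    also have "(\<Prod>i=1..k. fps_const (of_int (s i) ^ n) * cfps (psi_fps M (p i) (s i) n)) *
            (fps_const (of_real (1 / weight q n)) * cfps (weight_fps q n)) = U n"
    proof -
      have "(\<Prod>i=1..k. fps_const ((of_int (s i) :: complex) ^ n)) = fps_const ((\<Prod>i=1..k. of_int (s i)) ^ n)"
        by (simp add: fps_const_prod prod_power_distrib)
      moreover have "fps_const a * X * (fps_const b * Y) = fps_const (a * b) * (X * Y)" for a b :: complex and X Y
        by (simp add: mult_ac flip: fps_const_mult)
      ultimately show ?thesis
        by (simp add: U_def res_fps_def cfps_mult cfps_prod prod.distrib)
    qed
    finally have "(\<lambda>z. (\<Prod>i=1..k. V i z) * R z) has_fps_expansion U n" .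
    moreover have "\<forall>\<^sub>F z in at 0. f (of_nat n + z) = ((\<Prod>i=1..k. V i z) * R z) / z ^ D n"
      unfolding eventually_at_filter
    proof (intro always_eventually allI impI)
      fix z :: complex assume z: "z \<noteq> 0"
      have "(\<Prod>i=1..k. psi M (p i) (s i) (of_nat n + z)) = (\<Prod>i=1..k. V i z) / z ^ P"
        unfolding P_def power_sum prod_dividef [symmetric] using z by (intro prod.cong refl V)
      thus "f (of_nat n + z) = ((\<Prod>i=1..k. V i z) * R z) / z ^ D n"
        by (auto simp: f_def R_def D_def power_add)
    qed
    ultimately show ?thesis by blast
  qed
  then obtain W where W: "\<And>n. n \<le> M \<Longrightarrow> W n has_fps_expansion U n"
     "\<And>n. n \<le> M \<Longrightarrow> \<forall>\<^sub>F z in at 0. f (of_nat n + z) = W n z / z ^ D n" by metis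
  define A where "A = (of_nat :: nat \<Rightarrow> complex) ` {..M}"
  \<comment> \<open>\<open>partial_fraction_expansion\<close> is indexed by the poles as complex
    numbers; \<open>idx\<close> recovers the natural number.\<close>
  define idx where "idx = inv (of_nat :: nat \<Rightarrow> complex)"
  have idx: "idx (of_nat n) = n" for n unfolding idx_def by (rule inv_f_f) (simp add: inj_of_nat)
  have xA: "of_real x \<notin> A" using x by (auto simp: A_def complex_eq_iff)
  have P: "P > 0"
    unfolding P_def using k p[of 1] by (intro sum_pos2[of _ 1]) auto
  have "f (of_real x) = (\<Sum>a\<in>A. \<Sum>d<D (idx a). fps_nth (U (idx a)) (D (idx a) - 1 - d) / (of_real x - a) ^ (d + 1))"
  proof (rule partial_fraction_expansion[of A _ f "\<lambda>a. W (idx a)"])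
    show "finite A" by (simp add: A_def)
    show "f holomorphic_on - A"
    proof -
      have "0 \<in> A" by (force simp: A_def)
      hence "z \<noteq> 0" if "z \<in> -A" for z using that by auto
      moreover have "of_nat j \<noteq> z" if "z \<in> -A" "j \<le> M" for z j using that by (auto simp: A_def)
      ultimately show ?thesis unfolding f_def psi_def by (intro holomorphic_intros) auto
    qed
    have "((\<lambda>z :: complex. (\<Prod>i=1..k. psi M (p i) (s i) z) * inverse z ^ q) \<longlongrightarrow>
             (\<Prod>i=1..k. - of_real (reg_const (p i) (s i) M)) * 0 ^ q) at_infinity"
      by (intro tendsto_mult tendsto_prod tendsto_power psi_tendsto_at_infinity p tendsto_inverse_0)
    thus "(f \<longlongrightarrow> 0) at_infinity"
      using q by (simp add: f_def divide_inverse power_inverse zero_power)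
    show "W (idx a) has_fps_expansion U (idx a)" if "a \<in> A" for a
      using that W(1) by (auto simp: A_def idx)
    show "\<forall>\<^sub>F z in at 0. f (a + z) = W (idx a) z / z ^ D (idx a)" if "a \<in> A" for a
    proof -
      from that obtain n where "n \<le> M" "a = of_nat n" by (auto simp: A_def)
      thus ?thesis using W(2)[of n] by (simp only: idx)
    qed
    show "D (idx a) > 0" for a using P by (simp add: D_def)
  qed (rule xA)
  also have "\<dots> = (\<Sum>n\<le>M. \<Sum>d<D n. fps_nth (U n) (D n - 1 - d) / (of_real x - of_nat n) ^ (d + 1))"
    unfolding A_def by (subst sum.reindex) (auto simp: idx inj_of_nat inj_on_def)
  also have "\<dots> = of_real (\<Sum>n\<le>M. \<Sum>d<D n.
        (\<Prod>i=1..k. of_int (s i)) ^ n / weight q n * fps_nth (res_fps M k p s q n) (D n - 1 - d)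
          / (x - real n) ^ (d + 1))"
    by (simp add: U_def)
  also have "f (of_real x) = of_real ((\<Prod>i=1..k. psi M (p i) (s i) x) / x ^ q)"
    by (simp add: f_def psi_def)
  finally show ?thesis unfolding of_real_eq_iff D_def .
qed

section \<open>Removing the truncation\<close>

text \<open>What dominated convergence in \<open>M\<close> asks of a coefficient: a limit for each
  \<open>n\<close>, and a bound independent of \<open>M\<close> at the poles
  \<open>n \<le> M\<close> that are present. As for \<open>slow\<close>, arbitrary small exponents
  keep products in the class.\<close>

definition tame :: "(nat \<Rightarrow> nat \<Rightarrow> real) \<Rightarrow> (nat \<Rightarrow> real) \<Rightarrow> bool" where
  "tame a b \<longleftrightarrow> (\<forall>n. (\<lambda>M. a M n) \<longlonglongrightarrow> b n) \<and>
     (\<forall>\<delta>>0. \<exists>C. \<forall>M n. n \<le> M \<longrightarrow> \<bar>a M n\<bar> \<le> C * (real n + 1) powr \<delta>)"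

lemma tameE:
  assumes "tame a b" "\<delta> > 0"
  obtains C where "C \<ge> 0" "\<And>M n. n \<le> M \<Longrightarrow> \<bar>a M n\<bar> \<le> C * (real n + 1) powr \<delta>"
proof -
  from assms obtain C where C: "\<And>M n. n \<le> M \<Longrightarrow> \<bar>a M n\<bar> \<le> C * (real n + 1) powr \<delta>"
    unfolding tame_def by blast
  from C[of 0 0] have "C \<ge> 0" by simp
  thus ?thesis using C that by blast
qed

lemma tame_bounded:
  assumes "\<And>n. \<bar>b n\<bar> \<le> C"
  shows "tame (\<lambda>_. b) b"
  unfolding tame_def
proof (intro conjI allI impI)
  fix \<delta> :: real assume \<delta>: "\<delta> > 0"
  have "\<bar>b n\<bar> \<le> C * (real n + 1) powr \<delta>" for n
  proof -
    have "C \<ge> 0" using assms[of n] by linarith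
    moreover have "1 \<le> (real n + 1) powr \<delta>" using \<delta> by (simp add: ge_one_powr_ge_zero)
    ultimately have "C * 1 \<le> C * (real n + 1) powr \<delta>" by (intro mult_left_mono)
    thus ?thesis using assms[of n] by simp
  qed
  thus "\<exists>C. \<forall>M n. n \<le> M \<longrightarrow> \<bar>b n\<bar> \<le> C * (real n + 1) powr \<delta>" by blast
qed auto

lemma tame_slow: "slow b \<Longrightarrow> tame (\<lambda>_. b) b"
  unfolding tame_def
proof (intro conjI allI impI)
  fix \<delta> :: real assume "slow b" "\<delta> > 0"
  then obtain C where "\<And>n. \<bar>b n\<bar> \<le> C * (real n + 1) powr \<delta>"
    by (rule slowE) auto
  thus "\<exists>C. \<forall>M n. n \<le> M \<longrightarrow> \<bar>b n\<bar> \<le> C * (real n + 1) powr \<delta>" by blast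
qed auto

lemma tame_add:
  assumes "tame a b" "tame a' b'"
  shows "tame (\<lambda>M n. a M n + a' M n) (\<lambda>n. b n + b' n)"
  unfolding tame_def
proof (intro conjI allI impI)
  fix \<delta> :: real assume \<delta>: "\<delta> > 0"
  obtain C where C: "C \<ge> 0" "\<And>M n. n \<le> M \<Longrightarrow> \<bar>a M n\<bar> \<le> C * (real n + 1) powr \<delta>"
    using tameE[OF assms(1) \<delta>] by metis
  obtain D where D: "D \<ge> 0" "\<And>M n. n \<le> M \<Longrightarrow> \<bar>a' M n\<bar> \<le> D * (real n + 1) powr \<delta>"
    using tameE[OF assms(2) \<delta>] by metis
  have "\<bar>a M n + a' M n\<bar> \<le> (C + D) * (real n + 1) powr \<delta>" if "n \<le> M" for M n
    using C(2)[OF that] D(2)[OF that] by (simp add: algebra_simps)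
  thus "\<exists>C. \<forall>M n. n \<le> M \<longrightarrow> \<bar>a M n + a' M n\<bar> \<le> C * (real n + 1) powr \<delta>" by blast
qed (use assms in \<open>auto simp: tame_def intro: tendsto_add\<close>)

lemma tame_mult:
  assumes "tame a b" "tame a' b'"
  shows "tame (\<lambda>M n. a M n * a' M n) (\<lambda>n. b n * b' n)"
  unfolding tame_def
proof (intro conjI allI impI)
  fix \<delta> :: real assume \<delta>: "\<delta> > 0"
  hence \<delta>': "\<delta> / 2 > 0" by simp
  obtain C where C: "C \<ge> 0" "\<And>M n. n \<le> M \<Longrightarrow> \<bar>a M n\<bar> \<le> C * (real n + 1) powr (\<delta> / 2)"
    using tameE[OF assms(1) \<delta>'] by metis
  obtain D where D: "D \<ge> 0" "\<And>M n. n \<le> M \<Longrightarrow> \<bar>a' M n\<bar> \<le> D * (real n + 1) powr (\<delta> / 2)"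
    using tameE[OF assms(2) \<delta>'] by metis
  have "\<bar>a M n * a' M n\<bar> \<le> (C * D) * (real n + 1) powr \<delta>" if "n \<le> M" for M n
  proof -
    have "\<bar>a M n * a' M n\<bar> \<le> (C * (real n + 1) powr (\<delta> / 2)) * (D * (real n + 1) powr (\<delta> / 2))"
      unfolding abs_mult by (intro mult_mono C D that) (use C in auto)
    also have "\<dots> = (C * D) * ((real n + 1) powr (\<delta> / 2) * (real n + 1) powr (\<delta> / 2))" by simp
    also have "(real n + 1) powr (\<delta> / 2) * (real n + 1) powr (\<delta> / 2) = (real n + 1) powr \<delta>"
      by (subst powr_add [symmetric]) simp
    finally show ?thesis .
  qed
  thus "\<exists>C. \<forall>M n. n \<le> M \<longrightarrow> \<bar>a M n * a' M n\<bar> \<le> C * (real n + 1) powr \<delta>" by blast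
qed (use assms in \<open>auto simp: tame_def intro: tendsto_mult\<close>)

lemma tame_const: "tame (\<lambda>_ _. c) (\<lambda>_. c)"
  by (rule tame_bounded[of _ "\<bar>c\<bar>"]) simp

lemma tame_sum:
  assumes "\<And>i. i \<in> I \<Longrightarrow> tame (a i) (b i)"
  shows "tame (\<lambda>M n. \<Sum>i\<in>I. a i M n) (\<lambda>n. \<Sum>i\<in>I. b i n)"
  using assms
proof (induction I rule: infinite_finite_induct)
  case (insert i I)
  hence "tame (a i) (b i)" "tame (\<lambda>M n. \<Sum>i\<in>I. a i M n) (\<lambda>n. \<Sum>i\<in>I. b i n)" by blast+
  from tame_add[OF this] show ?case using insert.hyps by simp
qed (simp_all add: tame_const)

lemma tame_fps_mult:
  assumes "\<And>j. tame (\<lambda>M n. fps_nth (F M n) j) (\<lambda>n. fps_nth (F' n) j)"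
    and "\<And>j. tame (\<lambda>M n. fps_nth (G M n) j) (\<lambda>n. fps_nth (G' n) j)"
  shows "tame (\<lambda>M n. fps_nth (F M n * G M n) j) (\<lambda>n. fps_nth (F' n * G' n) j)"
  unfolding fps_mult_nth
proof (rule tame_sum)
  fix i
  show "tame (\<lambda>M n. fps_nth (F M n) i * fps_nth (G M n) (j - i)) (\<lambda>n. fps_nth (F' n) i * fps_nth (G' n) (j - i))"
    by (rule tame_mult[OF assms(1)[of i] assms(2)[of "j - i"]])
qed

lemma tame_fps_prod:
  assumes "\<And>i j. i \<in> I \<Longrightarrow> tame (\<lambda>M n. fps_nth (F i M n) j) (\<lambda>n. fps_nth (F' i n) j)"
  shows "tame (\<lambda>M n. fps_nth (\<Prod>i\<in>I. F i M n) j) (\<lambda>n. fps_nth (\<Prod>i\<in>I. F' i n) j)"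
  using assms
proof (induction I arbitrary: j rule: infinite_finite_induct)
  case (insert i I)
  thus ?case by (auto intro!: tame_fps_mult)
qed (auto intro: tame_const)

text \<open>The exceptional values belong to the regularised sums: \<open>H_M - H_M\<close> and the limit \<open>2 ln 2\<close> of
  \<open>h_M - H_M\<close>.\<close>

definition S_const :: "nat \<Rightarrow> int \<Rightarrow> real" where
  "S_const w s = (if w = 1 \<and> s = 1 then 0 else of_int s * (\<Sum>m. of_int s ^ m / (real m + 1) ^ w))"

definition T_const :: "nat \<Rightarrow> int \<Rightarrow> real" where
  "T_const p s = (if p = 1 \<and> s = 1 then 2 * (\<Sum>m. (-1) ^ m / (real m + 1)) else (\<Sum>m. of_int s ^ m / (real m + 1/2) ^ p))"

definition psi_coeff_lim :: "nat \<Rightarrow> int \<Rightarrow> nat \<Rightarrow> nat \<Rightarrow> real" where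
  "psi_coeff_lim p s n f = of_nat ((p + f - 1) choose f) *
       (S_const (p + f) s + (-1) ^ (p + f) * of_int s * H_harm (p + f) s n)"

definition psi_fps_lim :: "nat \<Rightarrow> int \<Rightarrow> nat \<Rightarrow> real fps" where
  "psi_fps_lim p s n =
     Abs_fps (\<lambda>j. if j = 0 then (-1) ^ p else if j < p then 0 else psi_coeff_lim p s n (j - p))"

definition res_fps_lim :: "nat \<Rightarrow> (nat \<Rightarrow> nat) \<Rightarrow> (nat \<Rightarrow> int) \<Rightarrow> nat \<Rightarrow> nat \<Rightarrow> real fps" where
  "res_fps_lim k p s q n = (\<Prod>i=1..k. psi_fps_lim (p i) (s i) n) * weight_fps q n"

section \<open>Convergence of the Laurent coefficients\<close>

lemma H_harm_conv_sum: "H_harm p s n = (\<Sum>m<n. of_int s ^ m / (real m + 1) ^ p)"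
  by (induction n) (simp_all add: H_harm_Suc)

lemma h_harm_conv_sum: "h_harm p s n = (\<Sum>m<n. of_int s ^ m / (real m + 1/2) ^ p)"
  by (induction n) (simp_all add: h_harm_Suc)

lemma sum_power_eq_H_harm: "(\<Sum>l=1..L. of_int s ^ l / real l ^ w) = of_int s * H_harm w s L"
  by (induction L) (simp_all add: H_harm_Suc algebra_simps)

lemma H_harm_tendsto:
  assumes "w \<ge> 1" "s \<in> {1, -1}" "(w, s) \<noteq> (1, 1)"
  shows "(\<lambda>L. of_int s * H_harm w s L) \<longlonglongrightarrow> S_const w s"
proof -
  have "summable (\<lambda>m. of_int s ^ m / (real m + 1) ^ w)"
    using slow_summable[OF slow_const[of 1], of 1 w s] assms by simp
  from tendsto_mult_left[OF summable_LIMSEQ[OF this], of "of_int s"] show ?thesis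
    using assms(3) by (auto simp: H_harm_conv_sum S_const_def)
qed

lemma slow_H_harm:
  assumes "1 \<le> p" "s \<in> {1, -1}" shows "slow (H_harm p s)"
proof (rule slow_of_diff_bound)
  fix m
  have "\<bar>H_harm p s (Suc m) - H_harm p s m\<bar> = 1 / (real m + 1) ^ p"
    using assms by (auto simp: H_harm_Suc abs_mult power_abs)
  also have "\<dots> \<le> (1 / 1) ^ p / (real m + 1)"
    using assms by (intro inverse_shift_le) auto
  finally show "\<bar>H_harm p s (Suc m) - H_harm p s m\<bar> \<le> 1 / (real m + 1)" by simp
qed

lemma H_harm_shift_plus: "(\<lambda>M. H_harm 1 1 (M + c) - H_harm 1 1 M) \<longlonglongrightarrow> 0"
proof (induction c)
  case (Suc c)
  have "(\<lambda>M. 1 / (real (M + c) + 1)) \<longlonglongrightarrow> 0" by real_asymp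
  from tendsto_add[OF Suc this] show ?case by (simp add: H_harm_Suc algebra_simps)
qed simp

lemma H_harm_shift_minus: "(\<lambda>M. H_harm 1 1 (M - c) - H_harm 1 1 M) \<longlonglongrightarrow> 0"
proof -
  have "filterlim (\<lambda>M :: nat. M - c) at_top at_top" by (rule filterlim_minus_const_nat_at_top)
  from filterlim_compose[OF H_harm_shift_plus[of c] this]
  have "(\<lambda>M. - (H_harm 1 1 (M - c + c) - H_harm 1 1 (M - c))) \<longlonglongrightarrow> 0"
    using tendsto_minus by force
  moreover have "\<forall>\<^sub>F M in sequentially. - (H_harm 1 1 (M - c + c) - H_harm 1 1 (M - c)) = H_harm 1 1 (M - c) - H_harm 1 1 M"
    using eventually_ge_at_top[of c] by eventually_elim auto
  ultimately show ?thesis by (rule Lim_transform_eventually)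
qed

lemma H_harm_mono: "m \<le> n \<Longrightarrow> H_harm 1 1 m \<le> H_harm 1 1 n"
  unfolding H_harm_conv_sum by (intro sum_mono2) auto

text \<open>With \<open>a = M - n\<close> and \<open>b = n\<close> this bounds the loss from
  shortening the harmonic sum by \<open>n\<close> terms, uniformly in \<open>M\<close>.\<close>

lemma H_harm_subadd: "H_harm 1 1 (a + b) \<le> H_harm 1 1 a + H_harm 1 1 b"
proof (induction b)
  case (Suc b)
  have "1 / (real (a + b) + 1) \<le> 1 / (real b + 1)" by (intro divide_left_mono) auto
  with Suc show ?case by (simp add: H_harm_Suc)
qed simp

text \<open>Only \<open>E\<close> depends on \<open>M\<close>. In the regularised case it is
  \<open>H_harm 1 1 (M - n) - H_harm 1 1 M\<close>, which tends to 0 for fixed \<open>n\<close> and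
  is bounded by the harmonic number at \<open>n\<close>; otherwise its convergence already makes it
  bounded.\<close>

lemma tame_psi_coeff:
  assumes p: "p \<ge> 1" and s: "s \<in> {1, -1}"
  shows "tame (\<lambda>M n. psi_coeff M p s n f) (\<lambda>n. psi_coeff_lim p s n f)"
proof -
  define E where "E = (\<lambda>M n. of_int s * H_harm (p + f) s (M - n) - (if f = 0 then reg_const p s M else 0))"
  have binom: "real ((p + f - 1) choose f) = 1" if "f = 0" using that by simp
  have eq: "psi_coeff M p s n f = of_nat ((p + f - 1) choose f) *
       (E M n + (-1) ^ (p + f) * of_int s * H_harm (p + f) s n)" for M n
    unfolding psi_coeff_def sum_power_eq_H_harm E_def using binom by (auto simp: algebra_simps)
  have "tame E (\<lambda>n. S_const (p + f) s)"
  proof (cases "p + f = 1 \<and> s = 1")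
    case True
    hence T: "p = 1" "f = 0" "s = 1" using p by auto
    have E: "E M n = H_harm 1 1 (M - n) - H_harm 1 1 M" for M n
      using T by (simp add: E_def reg_const_def)
    show ?thesis unfolding tame_def
    proof (intro conjI allI impI)
      show "(\<lambda>M. E M n) \<longlonglongrightarrow> S_const (p + f) s" for n
        using H_harm_shift_minus[of n] T by (simp add: E S_const_def)
      fix \<delta> :: real assume \<delta>: "\<delta> > 0"
      obtain C where C: "\<And>n. \<bar>H_harm 1 1 n\<bar> \<le> C * (real n + 1) powr \<delta>"
        by (rule slowE[OF slow_H_harm[of 1 1] \<delta>]) auto
      have "\<bar>E M n\<bar> \<le> C * (real n + 1) powr \<delta>" if "n \<le> M" for M n
        using H_harm_mono[of "M - n" M] H_harm_subadd[of "M - n" n] C[of n] that unfolding E by simp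
      thus "\<exists>C. \<forall>M n. n \<le> M \<longrightarrow> \<bar>E M n\<bar> \<le> C * (real n + 1) powr \<delta>" by blast
    qed
  next
    case False
    have E: "E M n = of_int s * H_harm (p + f) s (M - n)" for M n
      using False by (auto simp: E_def reg_const_def)
    have lim: "(\<lambda>L. of_int s * H_harm (p + f) s L) \<longlonglongrightarrow> S_const (p + f) s"
      using False p s by (intro H_harm_tendsto) auto
    then obtain K where K: "\<And>L. \<bar>of_int s * H_harm (p + f) s L\<bar> \<le> K"
      using Bseq_eq_bounded convergent_imp_Bseq[OF convergentI[OF lim]] unfolding Bseq_def by auto
    show ?thesis unfolding tame_def
    proof (intro conjI allI impI)
      show "(\<lambda>M. E M n) \<longlonglongrightarrow> S_const (p + f) s" for n
        unfolding E by (rule filterlim_compose[OF lim filterlim_minus_const_nat_at_top])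
      fix \<delta> :: real assume \<delta>: "\<delta> > 0"
      have "\<bar>E M n\<bar> \<le> K * (real n + 1) powr \<delta>" for M n
      proof -
        have "1 \<le> (real n + 1) powr \<delta>" using \<delta> by (simp add: ge_one_powr_ge_zero)
        moreover have "K \<ge> 0" using K[of 0] by linarith
        ultimately have "K * 1 \<le> K * (real n + 1) powr \<delta>" by (intro mult_left_mono)
        thus ?thesis using K[of "M - n"] by (simp add: E)
      qed
      thus "\<exists>C. \<forall>M n. n \<le> M \<longrightarrow> \<bar>E M n\<bar> \<le> C * (real n + 1) powr \<delta>" by blast
    qed
  qed
  moreover have "tame (\<lambda>_. H_harm (p + f) s) (H_harm (p + f) s)"
    using p s by (intro tame_slow slow_H_harm) auto
  ultimately show ?thesis
    unfolding eq psi_coeff_lim_def by (intro tame_mult tame_add tame_const)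
qed

lemma tame_psi_fps:
  assumes "p \<ge> 1" "s \<in> {1, -1}"
  shows "tame (\<lambda>M n. fps_nth (psi_fps M p s n) j) (\<lambda>n. fps_nth (psi_fps_lim p s n) j)"
proof -
  consider "j = 0" | "0 < j" "j < p" | "0 < j" "p \<le> j" by linarith
  thus ?thesis
  proof cases
    case 3
    thus ?thesis using tame_psi_coeff[OF assms, of "j - p"] by (simp add: psi_fps_def psi_fps_lim_def)
  qed (simp_all add: psi_fps_def psi_fps_lim_def tame_const)
qed

lemma tame_weight_fps:
  "tame (\<lambda>_ n. fps_nth (weight_fps q n) e) (\<lambda>n. fps_nth (weight_fps q n) e)"
proof -
  define K where "K = real ((q + e - 1) choose e)"
  have K: "K \<ge> 0" by (simp add: K_def)
  have bound: "\<bar>fps_nth (weight_fps q n) e\<bar> \<le> 1 + K" for n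
  proof (cases "n = 0")
    case True
    have "\<bar>fps_nth (1 :: real fps) e\<bar> \<le> 1" by simp
    moreover have "weight_fps q n = 1" using True by (simp add: weight_fps_def)
    ultimately show ?thesis using K by simp
  next
    case False
    have "1 \<le> real n ^ e" by (rule one_le_power) (use False in simp)
    hence "K / real n ^ e \<le> K"
      using K mult_left_mono[of 1 "real n ^ e" K] by (simp add: divide_le_eq)
    moreover have "fps_nth (weight_fps q n) e = (-1) ^ e * K / real n ^ e"
      unfolding weight_fps_def K_def using False by (simp only: if_False fps_nth_Abs_fps)
    moreover have "\<bar>(-1) ^ e * K / real n ^ e\<bar> = K / real n ^ e"
      using K by (simp only: abs_mult abs_divide power_abs abs_minus_cancel abs_one power_one mult_1_left abs_of_nat abs_of_nonneg)
    ultimately show ?thesis using K by linarith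
  qed
  define b where "b = (\<lambda>n. fps_nth (weight_fps q n) e)"
  have "\<bar>b n\<bar> \<le> 1 + K" for n unfolding b_def by (rule bound)
  hence "tame (\<lambda>_. b) b" by (rule tame_bounded)
  thus ?thesis by (simp only: b_def)
qed

lemma tame_res_fps:
  assumes "\<And>i. i \<in> {1..k} \<Longrightarrow> 1 \<le> p i" "\<And>i. i \<in> {1..k} \<Longrightarrow> s i \<in> {1, -1}"
  shows "tame (\<lambda>M n. fps_nth (res_fps M k p s q n) j) (\<lambda>n. fps_nth (res_fps_lim k p s q n) j)"
  unfolding res_fps_def res_fps_lim_def
proof (rule tame_fps_mult[where F = "\<lambda>M n. \<Prod>i=1..k. psi_fps M (p i) (s i) n"
      and F' = "\<lambda>n. \<Prod>i=1..k. psi_fps_lim (p i) (s i) n"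
      and G = "\<lambda>_ n. weight_fps q n" and G' = "weight_fps q"])
  fix j
  show "tame (\<lambda>M n. fps_nth (\<Prod>i=1..k. psi_fps M (p i) (s i) n) j)
          (\<lambda>n. fps_nth (\<Prod>i=1..k. psi_fps_lim (p i) (s i) n) j)"
  proof (rule tame_fps_prod[where F = "\<lambda>i M n. psi_fps M (p i) (s i) n"
        and F' = "\<lambda>i n. psi_fps_lim (p i) (s i) n"])
    fix i j assume i: "i \<in> {1..k}"
    show "tame (\<lambda>M n. fps_nth (psi_fps M (p i) (s i) n) j) (\<lambda>n. fps_nth (psi_fps_lim (p i) (s i) n) j)"
      by (rule tame_psi_fps) (use assms i in auto)
  qed
  show "tame (\<lambda>_ n. fps_nth (weight_fps q n) j) (\<lambda>n. fps_nth (weight_fps q n) j)"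
    by (rule tame_weight_fps)
qed

section \<open>Limits of \<open>psi\<close> at the half-integers\<close>

lemma h_harm_reg_tendsto:
  assumes "p \<ge> 1" "s \<in> {1, -1}"
  shows "(\<lambda>M. h_harm p s M - reg_const p s M) \<longlonglongrightarrow> T_const p s"
proof (cases "p = 1 \<and> s = 1")
  case True
  \<comment> \<open>The difference of two corresponding terms is twice a pair of consecutive terms
    of the alternating harmonic series, hence the \<open>2*M\<close> terms.\<close>
  have "h_harm 1 1 M - H_harm 1 1 M = 2 * (\<Sum>m<2*M. (-1) ^ m / (real m + 1))" for M
  proof (induction M)
    case (Suc M)
    have "1 / (real M + 1/2) - 1 / (real M + 1) = 2 * (1 / (2 * real M + 1) - 1 / (2 * real M + 2))"
      by (simp add: divide_simps) (simp add: algebra_simps)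
    with Suc show ?case by (simp add: h_harm_Suc H_harm_Suc algebra_simps)
  qed simp
  moreover have "summable (\<lambda>m. (-1) ^ m / (real m + 1))"
    using slow_summable[OF slow_const[of 1], of 1 1 "-1"] by simp
  hence "(\<lambda>M. 2 * (\<Sum>m<2*M. (-1) ^ m / (real m + 1))) \<longlonglongrightarrow> 2 * (\<Sum>m. (-1) ^ m / (real m + 1))"
    by (intro tendsto_intros filterlim_compose[OF summable_LIMSEQ] mult_nat_left_at_top) auto
  ultimately show ?thesis using True by (simp add: reg_const_def T_const_def)
next
  case False
  have "summable (\<lambda>m. of_int s ^ m / (real m + 1/2) ^ p)"
    using slow_summable[OF slow_const[of 1], of "1/2" p s] assms False by auto
  from summable_LIMSEQ[OF this] show ?thesis
    using False by (auto simp: h_harm_conv_sum T_const_def reg_const_def)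
qed

lemma reg_const_shift:
  "(\<lambda>M. reg_const p s (M + c) - reg_const p s M) \<longlonglongrightarrow> 0"
  "(\<lambda>M. reg_const p s (M - c) - reg_const p s M) \<longlonglongrightarrow> 0"
proof -
  consider "p = 1" "s = 1" | "\<not> (p = 1 \<and> s = 1)" by blast
  hence "(\<lambda>M. reg_const p s (M + c) - reg_const p s M) \<longlonglongrightarrow> 0 \<and>
         (\<lambda>M. reg_const p s (M - c) - reg_const p s M) \<longlonglongrightarrow> 0"
  proof cases
    case 1
    thus ?thesis unfolding reg_const_def using H_harm_shift_plus[of c] H_harm_shift_minus[of c] by simp
  qed (auto simp: reg_const_def)
  thus "(\<lambda>M. reg_const p s (M + c) - reg_const p s M) \<longlonglongrightarrow> 0"
    "(\<lambda>M. reg_const p s (M - c) - reg_const p s M) \<longlonglongrightarrow> 0" by blast+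
qed

text \<open>At \<open>-(m + 1/2)\<close> the denominators are powers of \<open>j + m + 1/2\<close>:
  the series behind \<open>T_const\<close> without its first \<open>m\<close> terms. Reindexing
  costs the sign \<open>s ^ m\<close>.\<close>

lemma psi_tendsto_neg:
  assumes "p \<ge> 1" "s \<in> {1, -1}"
  shows "(\<lambda>M. psi M p s (- (real m + 1/2))) \<longlonglongrightarrow> of_int s ^ m * (T_const p s - h_harm p s m)"
proof -
  have sq: "(of_int s :: real) ^ n * of_int s ^ n = 1" for n
    using assms(2) by (auto simp flip: power_mult_distrib)
  have reg: "of_int s ^ m * reg_const p s M = reg_const p s M" for M
    by (auto simp: reg_const_def)
  have eq: "psi M p s (- (real m + 1/2)) =
      of_int s ^ m * ((h_harm p s (M + Suc m) - reg_const p s (M + Suc m)) +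
         (reg_const p s (M + Suc m) - reg_const p s M) - h_harm p s m)" for M
  proof -
    have "h_harm p s (M + Suc m) = h_harm p s m + (\<Sum>j\<le>M. of_int s ^ (j + m) / (real (j + m) + 1/2) ^ p)"
    proof -
      have "h_harm p s (M + Suc m) = h_harm p s m + (\<Sum>l=m..<M + Suc m. of_int s ^ l / (real l + 1/2) ^ p)"
        unfolding h_harm_conv_sum lessThan_atLeast0 by (subst sum.atLeastLessThan_concat) auto
      also have "(\<Sum>l=m..<M + Suc m. of_int s ^ l / (real l + 1/2) ^ p) =
                   (\<Sum>j\<le>M. of_int s ^ (j + m) / (real (j + m) + 1/2) ^ p)"
        by (rule sum.reindex_bij_witness[of _ "\<lambda>j. j + m" "\<lambda>l. l - m"]) auto
      finally show ?thesis .
    qed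
    hence "of_int s ^ m * (h_harm p s (M + Suc m) - h_harm p s m) =
             (\<Sum>j\<le>M. (of_int s ^ m * of_int s ^ m) * (of_int s ^ j / (real (j + m) + 1/2) ^ p))"
      by (simp add: sum_distrib_left power_add mult_ac)
    hence "of_int s ^ m * (h_harm p s (M + Suc m) - h_harm p s m) =
             (\<Sum>j\<le>M. of_int s ^ j / (real (j + m) + 1/2) ^ p)" unfolding sq by simp
    moreover have "of_int s ^ m * ((h_harm p s (M + Suc m) - reg_const p s (M + Suc m)) +
         (reg_const p s (M + Suc m) - reg_const p s M) - h_harm p s m) =
         of_int s ^ m * (h_harm p s (M + Suc m) - h_harm p s m) - of_int s ^ m * reg_const p s M"
      by (simp add: algebra_simps)
    moreover have "real j - - (real m + 1/2) = real (j + m) + 1/2" for j by simp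
    ultimately show ?thesis by (simp only: psi_def reg of_real_eq_id id_apply of_int_eq_id)
  qed
  have "(\<lambda>M. h_harm p s (M + Suc m) - reg_const p s (M + Suc m)) \<longlonglongrightarrow> T_const p s"
    using LIMSEQ_ignore_initial_segment[OF h_harm_reg_tendsto[OF assms], of "Suc m"] by simp
  hence "(\<lambda>M. of_int s ^ m * ((h_harm p s (M + Suc m) - reg_const p s (M + Suc m)) +
         (reg_const p s (M + Suc m) - reg_const p s M) - h_harm p s m)) \<longlonglongrightarrow> of_int s ^ m * (T_const p s + 0 - h_harm p s m)"
    by (intro tendsto_intros reg_const_shift)
  thus ?thesis unfolding eq by simp
qed

text \<open>The poles \<open>j > m\<close>, to the right of the point, give the full series. The
  \<open>m + 1\<close> poles on its left are reflected, which explains both the sign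
  \<open>(-1) ^ p\<close> and the argument \<open>Suc m\<close>.\<close>

lemma psi_tendsto_pos:
  assumes "p \<ge> 1" "s \<in> {1, -1}"
  shows "(\<lambda>M. psi M p s (real m + 1/2)) \<longlonglongrightarrow>
           of_int s ^ Suc m * (T_const p s + (-1) ^ p * of_int s * h_harm p s (Suc m))"
proof -
  have sq: "(of_int s :: real) ^ n * of_int s ^ n = 1" "(of_int s :: real) * of_int s = 1" for n
    using assms(2) by (auto simp flip: power_mult_distrib)
  have reg: "of_int s ^ n * reg_const p s M = reg_const p s M" for M n
    by (auto simp: reg_const_def)
  have eq: "psi M p s (real m + 1/2) =
      of_int s ^ Suc m * ((h_harm p s (M - m) - reg_const p s (M - m)) +
         (reg_const p s (M - m) - reg_const p s M) + (-1) ^ p * of_int s * h_harm p s (Suc m))" if "M \<ge> m" for M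
  proof -
    have "(\<Sum>j\<le>M. of_int s ^ j / (real j - (real m + 1/2)) ^ p) =
            (\<Sum>j\<le>m. of_int s ^ j / (real j - (real m + 1/2)) ^ p) +
            (\<Sum>j\<in>{m<..M}. of_int s ^ j / (real j - (real m + 1/2)) ^ p)"
      using that by (subst sum.union_disjoint [symmetric]) (auto intro!: sum.cong)
    also have "(\<Sum>j\<in>{m<..M}. of_int s ^ j / (real j - (real m + 1/2)) ^ p) =
                 (\<Sum>l<M-m. of_int s ^ Suc m * (of_int s ^ l / (real l + 1/2) ^ p))"
    proof (rule sum.reindex_bij_witness[of _ "\<lambda>l. Suc m + l" "\<lambda>j. j - Suc m"])
      fix j assume j: "j \<in> {m<..M}"
      define l where "l = j - Suc m"
      have l: "j = Suc m + l" using j by (simp add: l_def)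
      have "real j - (real m + 1/2) = real l + 1/2" by (simp add: l)
      thus "of_int s ^ Suc m * (of_int s ^ (j - Suc m) / (real (j - Suc m) + 1/2) ^ p) =
            of_int s ^ j / (real j - (real m + 1/2)) ^ p"
        unfolding l_def [symmetric] by (simp only: l power_add times_divide_eq_right)
    qed auto
    also have "\<dots> = of_int s ^ Suc m * h_harm p s (M - m)"
      by (simp add: h_harm_conv_sum sum_distrib_left)
    also have "(\<Sum>j\<le>m. of_int s ^ j / (real j - (real m + 1/2)) ^ p) =
                 (\<Sum>l<Suc m. of_int s ^ m * (-1) ^ p * (of_int s ^ l / (real l + 1/2) ^ p))"
    proof (rule sum.reindex_bij_witness[of _ "\<lambda>l. m - l" "\<lambda>j. m - j"])
      fix j assume j: "j \<in> {..m}"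
      define l where "l = m - j"
      have m: "m = j + l" using j by (simp add: l_def)
      have "of_int s ^ m * of_int s ^ l = (of_int s ^ j * (of_int s ^ l * of_int s ^ l) :: real)"
        by (simp add: m power_add mult_ac)
      hence 1: "of_int s ^ m * of_int s ^ l = (of_int s ^ j :: real)" unfolding sq by simp
      have 2: "real j - (real m + 1/2) = - (real l + 1/2)" by (simp add: m)
      have "of_int s ^ j / (real j - (real m + 1/2)) ^ p = of_int s ^ j * (1 / (- (real l + 1/2)) ^ p)"
        unfolding 2 by simp
      also have "\<dots> = of_int s ^ m * (-1) ^ p * (of_int s ^ l / (real l + 1/2) ^ p)"
        unfolding inverse_minus_power 1 [symmetric] by simp
      finally show "of_int s ^ m * (-1) ^ p * (of_int s ^ (m - j) / (real (m - j) + 1/2) ^ p) =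
          of_int s ^ j / (real j - (real m + 1/2)) ^ p"
        unfolding l_def by simp
    qed auto
    also have "\<dots> = of_int s ^ m * (-1) ^ p * h_harm p s (Suc m)"
      unfolding h_harm_conv_sum sum_distrib_left ..
    also have "of_int s ^ m * (-1) ^ p * h_harm p s (Suc m) =
                 of_int s ^ Suc m * ((-1) ^ p * of_int s * h_harm p s (Suc m))"
      using sq(2) by (simp add: mult_ac)
    finally have "(\<Sum>j\<le>M. of_int s ^ j / (real j - (real m + 1/2)) ^ p) =
        of_int s ^ Suc m * ((-1) ^ p * of_int s * h_harm p s (Suc m)) + of_int s ^ Suc m * h_harm p s (M - m)" .
    moreover have "of_int s ^ Suc m * ((h_harm p s (M - m) - reg_const p s (M - m)) +
         (reg_const p s (M - m) - reg_const p s M) + (-1) ^ p * of_int s * h_harm p s (Suc m)) =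
         of_int s ^ Suc m * ((-1) ^ p * of_int s * h_harm p s (Suc m)) + of_int s ^ Suc m * h_harm p s (M - m)
           - of_int s ^ Suc m * reg_const p s M"
      by (simp add: algebra_simps)
    ultimately show ?thesis
      by (simp only: psi_def reg of_real_eq_id id_apply)
  qed
  have "(\<lambda>M. h_harm p s (M - m) - reg_const p s (M - m)) \<longlonglongrightarrow> T_const p s"
    by (rule filterlim_compose[OF h_harm_reg_tendsto[OF assms] filterlim_minus_const_nat_at_top])
  hence "(\<lambda>M. of_int s ^ Suc m * ((h_harm p s (M - m) - reg_const p s (M - m)) +
         (reg_const p s (M - m) - reg_const p s M) + (-1) ^ p * of_int s * h_harm p s (Suc m))) \<longlonglongrightarrow>
         of_int s ^ Suc m * (T_const p s + 0 + (-1) ^ p * of_int s * h_harm p s (Suc m))"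
    by (intro tendsto_intros reg_const_shift)
  moreover have "\<forall>\<^sub>F M in sequentially. of_int s ^ Suc m * ((h_harm p s (M - m) - reg_const p s (M - m)) +
         (reg_const p s (M - m) - reg_const p s M) + (-1) ^ p * of_int s * h_harm p s (Suc m)) = psi M p s (real m + 1/2)"
    using eventually_ge_at_top[of m] by eventually_elim (rule eq [symmetric])
  ultimately have "(\<lambda>M. psi M p s (real m + 1/2)) \<longlonglongrightarrow>
         of_int s ^ Suc m * (T_const p s + 0 + (-1) ^ p * of_int s * h_harm p s (Suc m))"
    by (rule Lim_transform_eventually)
  thus ?thesis by simp
qed

section \<open>Summation over the half-integers\<close>

text \<open>The truncation is removed from \<open>partial_fractions_real\<close>. The coefficients
  at \<open>n \<ge> 1\<close> are bounded by a multiple of \<open>n powr (1/2)\<close>, and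
  \<open>n ^ q\<close> and \<open>x - n\<close> each gain at least one power, so the majorant has
  exponent \<open>-3/2\<close> even for \<open>q = 1\<close>. The pole at 0, of higher order, is
  kept apart.\<close>

lemma mittag_leffler:
  fixes x :: real and s :: "nat \<Rightarrow> int"
  assumes k: "k \<ge> 1" and p: "\<And>i. i \<in> {1..k} \<Longrightarrow> 1 \<le> p i" and s: "\<And>i. i \<in> {1..k} \<Longrightarrow> s i \<in> {1, -1}"
    and q: "q \<ge> 1" and x: "x \<notin> \<nat>"
    and L: "\<And>i. i \<in> {1..k} \<Longrightarrow> (\<lambda>M. psi M (p i) (s i) x) \<longlonglongrightarrow> L i"
  defines "P \<equiv> (\<Sum>i=1..k. p i)" and "e \<equiv> (\<Prod>i=1..k. of_int (s i))"
    and "R \<equiv> \<lambda>n. fps_nth (res_fps_lim k p s q n)"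
  shows "\<And>d. summable (\<lambda>m. e ^ Suc m * R (Suc m) (P - 1 - d) / (real m + 1) ^ q / (x - (real m + 1)) ^ (d + 1))"
    and "(\<Prod>i=1..k. L i) / x ^ q = (\<Sum>d<P+q. R 0 (P + q - 1 - d) / x ^ (d + 1)) +
       (\<Sum>d<P. \<Sum>m. e ^ Suc m * R (Suc m) (P - 1 - d) / (real m + 1) ^ q / (x - (real m + 1)) ^ (d + 1))"
proof -
  define A where "A = (\<lambda>M n. fps_nth (res_fps M k p s q n))"
  have tame: "tame (\<lambda>M n. A M n j) (\<lambda>n. R n j)" for j
    unfolding A_def R_def by (intro tame_res_fps p s)
  have lim: "(\<lambda>M. A M n j) \<longlonglongrightarrow> R n j" for n j using tame[of j] by (simp add: tame_def)
  have e: "\<bar>e\<bar> = 1"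
    unfolding e_def abs_prod
  proof (intro prod.neutral ballI)
    fix i assume "i \<in> {1..k}"
    from s[OF this] show "\<bar>of_int (s i)\<bar> = (1 :: real)" by auto
  qed
  \<comment> \<open>The distance from \<open>x\<close> to the poles is comparable with
    \<open>m + 1\<close> uniformly in \<open>m\<close>, because the quotient converges.\<close>
  obtain D where D: "\<And>m. \<bar>(real m + 1) / (x - (real m + 1))\<bar> \<le> D"
  proof -
    have "(\<lambda>m. (real m + 1) / (x - (real m + 1))) \<longlonglongrightarrow> -1" by real_asymp
    hence "Bseq (\<lambda>m. (real m + 1) / (x - (real m + 1)))" by (intro convergent_imp_Bseq convergentI)
    thus ?thesis using that by (auto simp: Bseq_def)
  qed
  have D0: "D \<ge> 0" using D[of 0] by linarith
  have xm: "x - (real m + 1) \<noteq> 0" for m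
    using x by (metis Nats_1 Nats_add of_nat_in_Nats eq_iff_diff_eq_0)
  have D': "1 / \<bar>x - (real m + 1)\<bar> \<le> D / (real m + 1)" for m
    using D[of m] by (simp add: field_simps abs_mult)
  define a where "a = (\<lambda>d M m. e ^ Suc m * A M (Suc m) (P - 1 - d) / (real m + 1) ^ q / (x - (real m + 1)) ^ (d + 1))"
  define b where "b = (\<lambda>d m. e ^ Suc m * R (Suc m) (P - 1 - d) / (real m + 1) ^ q / (x - (real m + 1)) ^ (d + 1))"
  have main: "summable (\<lambda>m. norm (b d m)) \<and> (\<lambda>M. \<Sum>m. if m < M then a d M m else 0) \<longlonglongrightarrow> (\<Sum>m. b d m)" for d
  proof -
    obtain C where C: "C \<ge> 0" "\<And>M n. n \<le> M \<Longrightarrow> \<bar>A M n (P - 1 - d)\<bar> \<le> C * (real n + 1) powr (1/2)"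
      by (rule tameE[OF tame[of "P - 1 - d"], of "1/2"]) auto
    have bound: "\<bar>a d M m\<bar> \<le> (C * 2 * D ^ (d + 1)) * (real m + 1) powr (- 3 / 2)" if m: "m < M" for M m
    proof -
      have "\<bar>A M (Suc m) (P - 1 - d)\<bar> \<le> C * (real (Suc m) + 1) powr (1/2)"
        using m by (intro C) auto
      \<comment> \<open>Here \<open>m + 2 \<le> 4 * (m + 1)\<close>; the constant 4 is taken for its
        square root 2.\<close>
      also have "\<dots> \<le> C * (4 * (real m + 1)) powr (1/2)"
        using C(1) by (intro mult_left_mono powr_mono2) auto
      also have "\<dots> = C * 2 * (real m + 1) powr (1/2)"
        by (subst powr_mult) (auto simp: powr_half_sqrt)
      finally have 1: "\<bar>A M (Suc m) (P - 1 - d)\<bar> \<le> C * 2 * (real m + 1) powr (1/2)" .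
      have 2: "1 / (real m + 1) ^ q \<le> (real m + 1) powr (-1)"
      proof -
        have "(real m + 1) ^ 1 \<le> (real m + 1) ^ q" using q by (intro power_increasing) auto
        thus ?thesis by (simp add: powr_minus_divide frac_le)
      qed
      have 3: "(1 / \<bar>x - (real m + 1)\<bar>) ^ (d + 1) \<le> D ^ (d + 1) * (real m + 1) powr (-1)"
      proof -
        have "(1 / \<bar>x - (real m + 1)\<bar>) ^ (d + 1) \<le> (D / (real m + 1)) ^ (d + 1)"
          by (intro power_mono D') auto
        also have "\<dots> = D ^ (d + 1) * (1 / (real m + 1) ^ (d + 1))" by (simp add: power_divide)
        also have "1 / (real m + 1) ^ (d + 1) \<le> 1 / (real m + 1) ^ 1"
          by (intro divide_left_mono power_increasing) auto
        finally show ?thesis using D0 by (simp add: powr_minus_divide mult_left_mono)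
      qed
      have "\<bar>a d M m\<bar> = \<bar>A M (Suc m) (P - 1 - d)\<bar> * (1 / (real m + 1) ^ q) * (1 / \<bar>x - (real m + 1)\<bar>) ^ (d + 1)"
        by (simp add: a_def abs_mult power_abs e power_one_over divide_simps)
      also have "\<dots> \<le> (C * 2 * (real m + 1) powr (1/2)) * (real m + 1) powr (-1) * (D ^ (d + 1) * (real m + 1) powr (-1))"
        by (intro mult_mono 1 2 3) (use C D0 in auto)
      also have "\<dots> = (C * 2 * D ^ (d + 1)) * ((real m + 1) powr (1/2) * (real m + 1) powr (-1) * (real m + 1) powr (-1))"
        by (simp only: mult_ac)
      also have "(real m + 1) powr (1/2) * (real m + 1) powr (-1) * (real m + 1) powr (-1) = (real m + 1) powr (- 3 / 2)"
        by (simp only: powr_add [symmetric]) simp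
      finally show ?thesis .
    qed
    \<comment> \<open>Setting the terms with \<open>m \<ge> M\<close> to 0 turns the finite sums
      into series over a fixed index set, the form of Tannery's theorem.\<close>
    have "(\<forall>\<^sub>F M in sequentially. summable (\<lambda>m. norm (if m < M then a d M m else 0))) \<and>
          summable (\<lambda>m. norm (b d m)) \<and> (\<lambda>M. \<Sum>m. if m < M then a d M m else 0) \<longlonglongrightarrow> suminf (b d)"
    proof (rule tannerys_theorem)
      show "(\<lambda>M. if m < M then a d M m else 0) \<longlonglongrightarrow> b d m" for m
      proof (rule Lim_transform_eventually)
        show "(\<lambda>M. a d M m) \<longlonglongrightarrow> b d m"
          unfolding a_def b_def by (intro tendsto_intros lim) (use xm in auto)
        show "\<forall>\<^sub>F M in sequentially. a d M m = (if m < M then a d M m else 0)"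
          using eventually_gt_at_top[of m] by eventually_elim auto
      qed
      have bound': "norm (if m < M then a d M m else 0) \<le> (C * 2 * D ^ (d + 1)) * (real m + 1) powr (- 3 / 2)" for M m
        using bound[of m M] C(1) D0 by auto
      show "\<forall>\<^sub>F (m, M) in sequentially \<times>\<^sub>F sequentially.
          norm (if m < M then a d M m else 0) \<le> (C * 2 * D ^ (d + 1)) * (real m + 1) powr (- 3 / 2)"
        using bound' by (intro always_eventually) auto
      show "summable (\<lambda>m. (C * 2 * D ^ (d + 1)) * (real m + 1) powr (- 3 / 2))"
        by (intro summable_mult summable_Suc_powr) auto
    qed auto
    thus ?thesis by blast
  qed
  show "summable (\<lambda>m. e ^ Suc m * R (Suc m) (P - 1 - d) / (real m + 1) ^ q / (x - (real m + 1)) ^ (d + 1))" for d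
    using summable_norm_cancel[of "b d"] main[of d] unfolding b_def by blast
  have eq: "(\<Prod>i=1..k. psi M (p i) (s i) x) / x ^ q =
      (\<Sum>d<P+q. A M 0 (P + q - 1 - d) / x ^ (d + 1)) + (\<Sum>d<P. \<Sum>m. if m < M then a d M m else 0)" for M
  proof -
    have "(\<Prod>i=1..k. psi M (p i) (s i) x) / x ^ q =
       (\<Sum>n\<le>M. \<Sum>d<(if n = 0 then P + q else P).
        e ^ n / weight q n * A M n ((if n = 0 then P + q else P) - 1 - d) / (x - real n) ^ (d + 1))"
      unfolding A_def P_def e_def by (rule partial_fractions_real[OF k p s q x])
    also have "\<dots> = (\<Sum>d<P+q. A M 0 (P + q - 1 - d) / x ^ (d + 1)) +
        (\<Sum>m<M. \<Sum>d<P. e ^ Suc m / weight q (Suc m) * A M (Suc m) (P - 1 - d) / (x - real (Suc m)) ^ (d + 1))"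
      unfolding lessThan_Suc_atMost [symmetric] by (subst sum.lessThan_Suc_shift) (simp add: weight_def)
    also have "(\<Sum>m<M. \<Sum>d<P. e ^ Suc m / weight q (Suc m) * A M (Suc m) (P - 1 - d) / (x - real (Suc m)) ^ (d + 1)) =
        (\<Sum>m<M. \<Sum>d<P. a d M m)"
      by (intro sum.cong refl) (simp add: a_def weight_def add_ac)
    also have "\<dots> = (\<Sum>d<P. \<Sum>m<M. a d M m)" by (rule sum.swap)
    also have "\<dots> = (\<Sum>d<P. \<Sum>m. if m < M then a d M m else 0)"
    proof (intro sum.cong refl)
      fix d
      have "(\<Sum>m. if m < M then a d M m else 0) = (\<Sum>m<M. if m < M then a d M m else 0)"
        by (rule suminf_finite) auto
      thus "(\<Sum>m<M. a d M m) = (\<Sum>m. if m < M then a d M m else 0)" by simp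
    qed
    finally show ?thesis .
  qed
  have x0: "x \<noteq> 0" using x by auto
  have "(\<lambda>M. (\<Prod>i=1..k. psi M (p i) (s i) x) / x ^ q) \<longlonglongrightarrow> (\<Prod>i=1..k. L i) / x ^ q"
    by (intro tendsto_intros L) (use x0 in auto)
  moreover have "(\<lambda>M. (\<Prod>i=1..k. psi M (p i) (s i) x) / x ^ q) \<longlonglongrightarrow>
      (\<Sum>d<P+q. R 0 (P + q - 1 - d) / x ^ (d + 1)) + (\<Sum>d<P. \<Sum>m. b d m)"
    unfolding eq using main x0 by (intro tendsto_add tendsto_sum tendsto_divide lim tendsto_const) auto
  ultimately show "(\<Prod>i=1..k. L i) / x ^ q = (\<Sum>d<P+q. R 0 (P + q - 1 - d) / x ^ (d + 1)) +
       (\<Sum>d<P. \<Sum>m. e ^ Suc m * R (Suc m) (P - 1 - d) / (real m + 1) ^ q / (x - (real m + 1)) ^ (d + 1))"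
    unfolding b_def by (rule LIMSEQ_unique)
qed

text \<open>The sum of \<open>\<chi> x / (x - n) ^ (d + 1)\<close> over the half-integers \<open>\<bar>x\<bar> < N\<close>, where \<open>\<chi> x = t ^ (x + 1/2)\<close>;
  it replaces the derivatives of \<open>\<pi> tan \<pi>z\<close> (\<open>t = 1\<close>) and \<open>\<pi> / cos \<pi>z\<close> (\<open>t = -1\<close>).\<close>

definition half_kernel :: "int \<Rightarrow> nat \<Rightarrow> nat \<Rightarrow> nat \<Rightarrow> real" where
  "half_kernel t d N n = (\<Sum>r<N. of_int t ^ Suc r / (real r + 1/2 - real n) ^ (d + 1) +
     of_int t ^ r / (- (real r + 1/2) - real n) ^ (d + 1))"

text \<open>Raising \<open>n\<close> by one amounts to shifting the window of half-integers by one,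
  which multiplies the weight by \<open>t\<close>. The two windows differ only at their ends, so
  everything but two end terms cancels.\<close>

lemma half_kernel_Suc:
  assumes "t \<in> {1, -1}"
  shows "of_int t * half_kernel t d N (Suc n) - half_kernel t d N n =
    of_int t ^ N * (1 / (- real N - 1/2 - real n) ^ (d + 1) - 1 / (real N - 1/2 - real n) ^ (d + 1))"
proof (induction N)
  case 0
  show ?case by (simp add: half_kernel_def)
next
  case (Suc N)
  have tt: "of_int t * (of_int t * y) = (y :: real)" for y using assms by auto
  define a where "a = 1 / (real N - 1/2 - real n) ^ (d + 1)"
  define b where "b = 1 / (real N + 1/2 - real n) ^ (d + 1)"
  define c where "c = 1 / (- real N - 1/2 - real n) ^ (d + 1)"
  define f where "f = 1 / (- real N - 3/2 - real n) ^ (d + 1)"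
  define T where "T = (of_int t :: real) ^ N"
  have 1: "half_kernel t d (Suc N) n = half_kernel t d N n + (of_int t * T * b + T * c)"
    by (simp add: half_kernel_def T_def b_def c_def)
  have 2: "real N + 1/2 - real (Suc n) = real N - 1/2 - real n" "- (real N + 1/2) - real (Suc n) = - real N - 3/2 - real n"
    by simp_all
  have 3: "half_kernel t d (Suc N) (Suc n) = half_kernel t d N (Suc n) + (of_int t * T * a + T * f)"
    unfolding half_kernel_def sum.lessThan_Suc 2 by (simp add: T_def a_def f_def)
  have 4: "real (Suc N) - 1/2 - real n = real N + 1/2 - real n" "- real (Suc N) - 1/2 - real n = - real N - 3/2 - real n"
    by simp_all
  have IH: "of_int t * half_kernel t d N (Suc n) - half_kernel t d N n = T * (c - a)"
    using Suc by (simp only: T_def a_def c_def)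
  have "of_int t * half_kernel t d (Suc N) (Suc n) - half_kernel t d (Suc N) n =
          T * (c - a) + of_int t * (of_int t * (T * a)) + of_int t * (T * f) - (of_int t * (T * b) + T * c)"
    unfolding 1 3 IH [symmetric] by (simp add: algebra_simps)
  also have "\<dots> = of_int t * T * (f - b)" unfolding tt by (simp add: algebra_simps)
  finally show ?case unfolding 4 by (simp add: T_def f_def b_def)
qed

text \<open>The weight \<open>t ^ (x + 1/2)\<close> is centred at 0; the factor \<open>t ^ n\<close>
  recentres it at \<open>n\<close> and makes the limit in \<open>N\<close> independent of
  \<open>n\<close>.\<close>

definition signed_kernel :: "int \<Rightarrow> nat \<Rightarrow> nat \<Rightarrow> nat \<Rightarrow> real" where
  "signed_kernel t d N n = of_int t ^ n * half_kernel t d N n"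

text \<open>The sum of \<open>t ^ (x + 1/2) / x ^ (d + 1)\<close> over all half-integers, with the
  negative ones folded onto the positive ones. For \<open>d = 0\<close> and \<open>t = 1\<close> the
  first factor is 0, as the symmetric summation of \<open>1 / x\<close> demands.\<close>

definition kernel_lim :: "int \<Rightarrow> nat \<Rightarrow> real" where
  "kernel_lim t d = (of_int t + (-1) ^ (d + 1)) * T_const (d + 1) t"

lemma half_dist_pos: "\<bar>real N - real n - 1/2\<bar> \<ge> 1/2"
proof (cases "n < N")
  case True
  hence "real n + 1 \<le> real N" by linarith
  thus ?thesis by linarith
next
  case False
  hence "real N \<le> real n" by linarith
  thus ?thesis by linarith
qed

lemma signed_kernel_diff_eq:
  assumes "t \<in> {1, -1}"
  shows "signed_kernel t d N (Suc n) - signed_kernel t d N n =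
    of_int t ^ n * of_int t ^ N * (1 / (- real N - 1/2 - real n) ^ (d + 1) - 1 / (real N - 1/2 - real n) ^ (d + 1))"
proof -
  have "signed_kernel t d N (Suc n) - signed_kernel t d N n = of_int t ^ n * (of_int t * half_kernel t d N (Suc n) - half_kernel t d N n)"
    by (simp add: signed_kernel_def algebra_simps)
  thus ?thesis unfolding half_kernel_Suc[OF assms] by simp
qed

text \<open>Each of the two end terms is at most \<open>1 / v ^ (d + 1)\<close>, since the left end
  lies farther from \<open>n\<close> than the right one. As \<open>v \<ge> 1/2\<close>, all but one
  of the factors \<open>1 / v\<close> are replaced by 2, so one first-order bound serves every
  \<open>d\<close>.\<close>

lemma signed_kernel_diff:
  assumes "t \<in> {1, -1}"
  shows "\<bar>signed_kernel t d N (Suc n) - signed_kernel t d N n\<bar> \<le> 2 * 2 ^ d / \<bar>real N - real n - 1/2\<bar>"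
proof -
  define v where "v = \<bar>real N - real n - 1/2\<bar>"
  have v: "v \<ge> 1/2" unfolding v_def by (rule half_dist_pos)
  have t: "\<bar>of_int t ^ n\<bar> = (1 :: real)" for n using assms by (auto simp: power_abs)
  have inv: "1 / v ^ (d + 1) \<le> 2 ^ d / v"
  proof -
    have "(1 / v) ^ d \<le> 2 ^ d" using v by (intro power_mono) (auto simp: field_simps)
    hence "(1 / v) ^ d * (1 / v) \<le> 2 ^ d * (1 / v)" using v by (intro mult_right_mono) auto
    thus ?thesis using v by (simp add: power_one_over field_simps)
  qed
  have a: "\<bar>1 / (real N - 1/2 - real n) ^ (d + 1)\<bar> = 1 / v ^ (d + 1)"
  proof -
    have eq: "real N - 1/2 - real n = real N - real n - 1/2" by simp
    show ?thesis unfolding eq v_def by (simp only: abs_divide power_abs abs_one)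
  qed
  have b: "\<bar>1 / (- real N - 1/2 - real n) ^ (d + 1)\<bar> \<le> 1 / v ^ (d + 1)"
  proof -
    have le: "v \<le> \<bar>- real N - 1/2 - real n\<bar>" unfolding v_def by linarith
    have "1 / \<bar>- real N - 1/2 - real n\<bar> ^ (d + 1) \<le> 1 / v ^ (d + 1)"
      using v le by (intro divide_left_mono power_mono mult_pos_pos zero_less_power) linarith+
    thus ?thesis by (simp only: abs_divide power_abs abs_one)
  qed
  have "\<bar>signed_kernel t d N (Suc n) - signed_kernel t d N n\<bar> =
      \<bar>1 / (- real N - 1/2 - real n) ^ (d + 1) - 1 / (real N - 1/2 - real n) ^ (d + 1)\<bar>"
    unfolding signed_kernel_diff_eq[OF assms] abs_mult t by simp
  also have "\<dots> \<le> 1 / v ^ (d + 1) + 1 / v ^ (d + 1)"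
    using a b by linarith
  also have "\<dots> \<le> 2 ^ d / v + 2 ^ d / v" by (intro add_mono inv)
  finally show ?thesis by (simp add: v_def)
qed

lemma half_kernel_0: "half_kernel t d N 0 = (of_int t + (-1) ^ (d + 1)) * h_harm (d + 1) t N"
proof -
  have neg: "of_int t ^ r / (- (real r + 1/2)) ^ (d + 1) = (-1) ^ (d + 1) * (of_int t ^ r / (real r + 1/2) ^ (d + 1))" for r
    using inverse_minus_power[of "real r + 1/2" "d + 1"]
    by (metis (no_types, opaque_lifting) mult.commute mult.right_neutral times_divide_eq_right)
  have "half_kernel t d N 0 = (\<Sum>r<N. (of_int t + (-1) ^ (d + 1)) * (of_int t ^ r / (real r + 1/2) ^ (d + 1)))"
    unfolding half_kernel_def of_nat_0 diff_zero neg
    by (intro sum.cong refl) (simp only: distrib_right power_Suc times_divide_eq_right add_divide_distrib)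
  thus ?thesis unfolding h_harm_conv_sum sum_distrib_left .
qed

lemma signed_kernel_0_tendsto:
  assumes "t \<in> {1, -1}"
  shows "(\<lambda>N. signed_kernel t d N 0) \<longlonglongrightarrow> kernel_lim t d"
proof (cases "d = 0 \<and> t = 1")
  case True
  thus ?thesis by (simp add: signed_kernel_def half_kernel_0 kernel_lim_def)
next
  case False
  have "(\<lambda>N. h_harm (d + 1) t N - reg_const (d + 1) t N) \<longlonglongrightarrow> T_const (d + 1) t"
    using assms by (intro h_harm_reg_tendsto) auto
  moreover have "reg_const (d + 1) t N = 0" for N using False by (auto simp: reg_const_def)
  ultimately have "(\<lambda>N. h_harm (d + 1) t N) \<longlonglongrightarrow> T_const (d + 1) t" by simp
  thus ?thesis unfolding signed_kernel_def half_kernel_0 kernel_lim_def power_0 mult_1_left by (rule tendsto_mult_left)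
qed

lemma signed_kernel_tendsto:
  assumes "t \<in> {1, -1}"
  shows "(\<lambda>N. signed_kernel t d N n) \<longlonglongrightarrow> kernel_lim t d"
proof (induction n)
  case 0
  show ?case by (rule signed_kernel_0_tendsto[OF assms])
next
  case (Suc n)
  have "(\<lambda>N. signed_kernel t d N (Suc n) - signed_kernel t d N n) \<longlonglongrightarrow> 0"
  proof (rule Lim_null_comparison)
    show "\<forall>\<^sub>F N in sequentially. norm (signed_kernel t d N (Suc n) - signed_kernel t d N n) \<le> 2 * 2 ^ d / \<bar>real N - real n - 1/2\<bar>"
      using signed_kernel_diff[OF assms] by (intro always_eventually) auto
    show "(\<lambda>N. 2 * 2 ^ d / \<bar>real N - real n - 1/2\<bar>) \<longlonglongrightarrow> 0" by real_asymp
  qed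
  from tendsto_add[OF this Suc] show ?case by simp
qed

lemma h_harm_mono: "m \<le> n \<Longrightarrow> h_harm 1 1 m \<le> h_harm 1 1 n"
  unfolding h_harm_conv_sum by (intro sum_mono2) auto

text \<open>On either side of \<open>N\<close> the distances are distinct members of 1/2, 3/2, 5/2,
  ..., so each side is dominated by an initial segment of \<open>h_harm 1 1\<close>.\<close>

lemma sum_inverse_half_dist_le: "(\<Sum>i<n. 1 / \<bar>real N - real i - 1/2\<bar>) \<le> 2 * h_harm 1 1 n"
proof -
  define l where "l = min N n"
  have split: "{..<n} = {..<l} \<union> {l..<n}" by (auto simp: l_def)
  have "(\<Sum>i<n. 1 / \<bar>real N - real i - 1/2\<bar>) =
          (\<Sum>i<l. 1 / \<bar>real N - real i - 1/2\<bar>) + (\<Sum>i\<in>{l..<n}. 1 / \<bar>real N - real i - 1/2\<bar>)"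
    unfolding split by (rule sum.union_disjoint) auto
  also have "(\<Sum>i<l. 1 / \<bar>real N - real i - 1/2\<bar>) \<le> (\<Sum>i<l. 1 / (real (l - Suc i) + 1/2))"
  proof (intro sum_mono divide_left_mono)
    fix i assume i: "i \<in> {..<l}"
    hence "real (l - Suc i) = real l - real i - 1" by (simp add: of_nat_diff)
    thus "real (l - Suc i) + 1/2 \<le> \<bar>real N - real i - 1/2\<bar>" using i by (simp add: l_def)
    show "0 < \<bar>real N - real i - 1/2\<bar> * (real (l - Suc i) + 1/2)"
      using half_dist_pos[of N i] by (intro mult_pos_pos) linarith+
  qed auto
  also have "\<dots> = h_harm 1 1 l"
    unfolding h_harm_conv_sum by (subst sum.nat_diff_reindex) simp
  also have "\<dots> \<le> h_harm 1 1 n" by (rule h_harm_mono) (simp add: l_def)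
  also have "(\<Sum>i\<in>{l..<n}. 1 / \<bar>real N - real i - 1/2\<bar>) \<le> h_harm 1 1 (n - l)"
  proof (cases "N \<le> n")
    case True
    hence l: "l = N" by (simp add: l_def)
    have "(\<Sum>i\<in>{l..<n}. 1 / \<bar>real N - real i - 1/2\<bar>) = h_harm 1 1 (n - l)"
      unfolding h_harm_conv_sum l
      by (rule sum.reindex_bij_witness[of _ "\<lambda>j. N + j" "\<lambda>i. i - N"]) (auto simp: of_nat_diff)
    thus ?thesis by simp
  qed (simp add: l_def h_harm_conv_sum)
  also have "\<dots> \<le> h_harm 1 1 n" by (rule h_harm_mono) simp
  finally show ?thesis by simp
qed

text \<open>At \<open>n = 0\<close> the kernel converges in \<open>N\<close>, hence is bounded.
  Telescoping from there adds at most a multiple of \<open>h_harm 1 1 n\<close>, so the growth in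
  \<open>n\<close> is logarithmic, uniformly in \<open>N\<close>.\<close>

lemma signed_kernel_bound:
  assumes "t \<in> {1, -1}"
  obtains B where "\<And>N n. \<bar>signed_kernel t d N (Suc n)\<bar> \<le> B * (real n + 1) powr (1/4)"
proof -
  have "Bseq (\<lambda>N. signed_kernel t d N 0)"
    using signed_kernel_0_tendsto[OF assms] by (intro convergent_imp_Bseq convergentI)
  then obtain K where K: "\<And>N. \<bar>signed_kernel t d N 0\<bar> \<le> K" by (auto simp: Bseq_def)
  define c where "c = (2 :: real) * 2 ^ d"
  have 1: "\<bar>signed_kernel t d N n\<bar> \<le> K + c * (\<Sum>i<n. 1 / \<bar>real N - real i - 1/2\<bar>)" for N n
  proof (induction n)
    case (Suc n)
    have "\<bar>signed_kernel t d N (Suc n)\<bar> \<le> \<bar>signed_kernel t d N n\<bar> + \<bar>signed_kernel t d N (Suc n) - signed_kernel t d N n\<bar>" by linarith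
    also have "\<dots> \<le> (K + c * (\<Sum>i<n. 1 / \<bar>real N - real i - 1/2\<bar>)) + c / \<bar>real N - real n - 1/2\<bar>"
      using Suc signed_kernel_diff[OF assms, of d N n] unfolding c_def by linarith
    finally show ?case by (simp add: algebra_simps)
  qed (use K in simp)
  have "slow (\<lambda>n. K + 2 * c * h_harm 1 1 n)"
    by (intro slow_add slow_mult slow_const slow_h_harm) auto
  then obtain C where C: "C \<ge> 0" "\<And>n. \<bar>K + 2 * c * h_harm 1 1 n\<bar> \<le> C * (real n + 1) powr (1/4)"
    by (rule slowE[of _ "1/4"]) auto
  have "\<bar>signed_kernel t d N (Suc n)\<bar> \<le> (C * 2) * (real n + 1) powr (1/4)" for N n
  proof -
    have "\<bar>signed_kernel t d N (Suc n)\<bar> \<le> K + c * (2 * h_harm 1 1 (Suc n))"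
      by (rule order_trans[OF 1]) (intro add_left_mono mult_left_mono sum_inverse_half_dist_le; simp add: c_def)
    also have "\<dots> \<le> C * (real (Suc n) + 1) powr (1/4)"
      using C(2)[of "Suc n"] by (simp add: mult_ac)
    \<comment> \<open>Here \<open>n + 2 \<le> 16 * (n + 1)\<close>; the constant 16 is taken for its
      fourth root 2.\<close>
    also have "\<dots> \<le> C * (16 * (real n + 1)) powr (1/4)"
      using C(1) by (intro mult_left_mono powr_mono2) auto
    also have "(16 * (real n + 1)) powr (1/4) = 2 * (real n + 1) powr (1/4)"
    proof -
      have "(16 :: real) powr (1/4) = (2 powr 4) powr (1/4)" by simp
      also have "\<dots> = 2" by (subst powr_powr) simp
      finally show ?thesis by (subst powr_mult) auto
    qed
    finally show ?thesis by (simp add: mult_ac)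
  qed
  thus ?thesis by (rule that)
qed

lemma signed_kernel_limit:
  assumes "slow u" "q \<ge> 1" "\<sigma> \<in> {1, -1 :: int}" "(q, \<sigma>) \<noteq> (1, 1)" "t \<in> {1, -1}"
  shows "(\<lambda>N. \<Sum>m. of_int \<sigma> ^ m * u m * signed_kernel t d N (Suc m) / (real m + 1) ^ q) \<longlonglongrightarrow>
           kernel_lim t d * (\<Sum>m. of_int \<sigma> ^ m * u m / (real m + 1) ^ q)"
proof -
  obtain B where B: "\<And>N n. \<bar>signed_kernel t d N (Suc n)\<bar> \<le> B * (real n + 1) powr (1/4)"
    using signed_kernel_bound[OF assms(5)] by blast
  define B' where "B' = max B (2 * 2 ^ d)"
  show ?thesis
  proof (rule slow_kernel_limit[OF assms(1-4), of "\<lambda>N m. signed_kernel t d N (Suc m)"])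
    show "(\<lambda>N. signed_kernel t d N (Suc m)) \<longlonglongrightarrow> kernel_lim t d" for m
      by (rule signed_kernel_tendsto[OF assms(5)])
    show "\<bar>signed_kernel t d N (Suc m)\<bar> \<le> B' * (real m + 1) powr (1/4)" for N m
      by (rule order_trans[OF B]) (intro mult_right_mono; simp add: B'_def)
    show "\<bar>signed_kernel t d N (Suc (Suc m)) - signed_kernel t d N (Suc m)\<bar> \<le> B' / \<bar>real N - real m - 3/2\<bar>" for N m
    proof -
      have eq: "\<bar>real N - real (Suc m) - 1/2\<bar> = \<bar>real N - real m - 3/2\<bar>" by simp
      have "\<bar>signed_kernel t d N (Suc (Suc m)) - signed_kernel t d N (Suc m)\<bar> \<le> 2 * 2 ^ d / \<bar>real N - real m - 3/2\<bar>"
        using signed_kernel_diff[OF assms(5), of d N "Suc m"] unfolding eq .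
      also have "\<dots> \<le> B' / \<bar>real N - real m - 3/2\<bar>" by (intro divide_right_mono) (auto simp: B'_def)
      finally show ?thesis .
    qed
  qed
qed

section \<open>The parity theorem\<close>

lemma S_const_rat_polynomial:
  assumes "k \<ge> 1" "w \<ge> 1" "s \<in> {1, -1}"
  shows "rat_polynomial_in (Euler_sums_below k) (S_const w s)"
proof (cases "w = 1 \<and> s = 1")
  case True
  thus ?thesis using rat_polynomial_in_of_nat[of _ 0] by (simp add: S_const_def)
next
  case False
  have "rat_polynomial_in (Euler_sums_below k) (of_int s * (\<Sum>m. of_int s ^ m / (real m + 1) ^ w))"
    using S_value[of "[]" k w s] assms False by (intro rat_polynomial_in_mult rat_polynomial_in_of_int) auto
  thus ?thesis using False by (auto simp: S_const_def)
qed

text \<open>The regularised value is twice the alternating harmonic series, an S-sum of degree 0; so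
  S-sums enter on the side of the half-integers as well.\<close>

lemma T_const_rat_polynomial:
  assumes "k \<ge> 1" "p \<ge> 1" "s \<in> {1, -1}"
  shows "rat_polynomial_in (Euler_sums_below k) (T_const p s)"
proof (cases "p = 1 \<and> s = 1")
  case True
  have "rat_polynomial_in (Euler_sums_below k) (of_nat 2 * (\<Sum>m. (-1) ^ m / (real m + 1)))"
    using S_value[of "[]" k 1 "-1"] assms(1) by (intro rat_polynomial_in_mult rat_polynomial_in_of_nat) auto
  thus ?thesis using True by (simp add: T_const_def)
next
  case False
  thus ?thesis using T_value[of "[]" k p s] assms by (auto simp: T_const_def)
qed

lemma kernel_lim_rat_polynomial:
  assumes "k \<ge> 1" "t \<in> {1, -1}"
  shows "rat_polynomial_in (Euler_sums_below k) (kernel_lim t d)"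
proof -
  have "rat_polynomial_in (Euler_sums_below k) (of_int (t + (-1) ^ (d + 1)) * T_const (d + 1) t)"
    using assms by (intro rat_polynomial_in_mult rat_polynomial_in_of_int T_const_rat_polynomial) auto
  thus ?thesis by (simp add: kernel_lim_def)
qed

lemma rat_polynomial_in_fps_mult:
  assumes "\<And>j. rat_polynomial_in A (fps_nth F j)" "\<And>j. rat_polynomial_in A (fps_nth G j)"
  shows "rat_polynomial_in A (fps_nth (F * G) j)"
  unfolding fps_mult_nth by (intro rat_polynomial_in_sum rat_polynomial_in_mult assms)

lemma rat_polynomial_in_fps_prod:
  assumes "\<And>i j. i \<in> I \<Longrightarrow> rat_polynomial_in A (fps_nth (F i) j)"
  shows "rat_polynomial_in A (fps_nth (\<Prod>i\<in>I. F i) j)"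
  using assms
proof (induction I arbitrary: j rule: infinite_finite_induct)
  case (insert i I)
  have "rat_polynomial_in A (fps_nth (F i * (\<Prod>i\<in>I. F i)) j)"
    using insert by (intro rat_polynomial_in_fps_mult) auto
  thus ?case using insert.hyps by simp
qed (use rat_polynomial_in_of_nat[of A 0] rat_polynomial_in_of_nat[of A 1] in \<open>auto simp: fps_one_nth\<close>)

text \<open>At \<open>n = 0\<close> all harmonic numbers vanish, so coefficients of every order are
  polynomials in sums of degree 0. This covers the pole at 0, whose order exceeds that of the others
  by \<open>q\<close>.\<close>

lemma res_fps_lim_0_rat_polynomial:
  assumes k: "k \<ge> 1" and p: "\<And>i. i \<in> {1..k} \<Longrightarrow> 1 \<le> p i" and s: "\<And>i. i \<in> {1..k} \<Longrightarrow> s i \<in> {1, -1}"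
  shows "rat_polynomial_in (Euler_sums_below k) (fps_nth (res_fps_lim k p s q 0) j)"
  unfolding res_fps_lim_def
proof (intro rat_polynomial_in_fps_mult rat_polynomial_in_fps_prod)
  show "rat_polynomial_in (Euler_sums_below k) (fps_nth (weight_fps q 0) j)" for j
    using rat_polynomial_in_of_nat[of _ 0] rat_polynomial_in_of_nat[of _ 1] by (simp add: weight_fps_def fps_one_nth)
  fix i j assume i: "i \<in> {1..k}"
  have 1: "rat_polynomial_in (Euler_sums_below k) ((-1) ^ p i)"
    using rat_polynomial_in_of_int[of _ "(-1) ^ p i"] by simp
  have 0: "rat_polynomial_in (Euler_sums_below k) 0"
    using rat_polynomial_in_of_nat[of _ 0] by simp
  have 2: "rat_polynomial_in (Euler_sums_below k) (psi_coeff_lim (p i) (s i) 0 f)" for f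
  proof -
    have "rat_polynomial_in (Euler_sums_below k) (of_nat ((p i + f - 1) choose f) * S_const (p i + f) (s i))"
      using k p[OF i] s[OF i]
      by (intro rat_polynomial_in_mult rat_polynomial_in_of_nat S_const_rat_polynomial) auto
    thus ?thesis by (simp add: psi_coeff_lim_def)
  qed
  show "rat_polynomial_in (Euler_sums_below k) (fps_nth (psi_fps_lim (p i) (s i) 0) j)"
    unfolding psi_fps_lim_def using 0 1 2 by simp
qed

section \<open>Degree bounds at the integer poles and at the half-integers\<close>

context
  fixes k :: nat
  assumes k: "k \<ge> 1"
begin

abbreviation Spoly :: "nat \<Rightarrow> (nat \<Rightarrow> real) \<Rightarrow> bool" where
  "Spoly \<equiv> hpoly (Euler_sums_below k) H_seq (\<lambda>m. real m + 1)"

abbreviation Tpoly :: "nat \<Rightarrow> (nat \<Rightarrow> real) \<Rightarrow> bool" where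
  "Tpoly \<equiv> hpoly (Euler_sums_below k) h_harm (\<lambda>m. real m + 1/2)"

text \<open>Below order \<open>p\<close> only the pole contributes, with constants; from order
  \<open>p\<close> on a single harmonic number enters. This difference is the source of the drop in
  degree.\<close>

lemma Spoly_psi_fps_lim:
  assumes "p \<ge> 1" "s \<in> {1, -1}"
  shows "Spoly 1 (\<lambda>m. fps_nth (psi_fps_lim p s (Suc m)) j)"
    and "j < p \<Longrightarrow> Spoly 0 (\<lambda>m. fps_nth (psi_fps_lim p s (Suc m)) j)"
proof -
  have 1: "rat_polynomial_in (Euler_sums_below k) ((-1) ^ p)"
    using rat_polynomial_in_of_int[of _ "(-1) ^ p"] by simp
  have 0: "rat_polynomial_in (Euler_sums_below k) 0"
    using rat_polynomial_in_of_nat[of _ 0] by simp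
  have 2: "Spoly 1 (\<lambda>m. psi_coeff_lim p s (Suc m) f)" for f
  proof -
    have c: "rat_polynomial_in (Euler_sums_below k) ((-1) ^ (p + f) * of_int s)"
      using rat_polynomial_in_of_int[of _ "(-1) ^ (p + f) * s"] by simp
    show ?thesis unfolding psi_coeff_lim_def
      by (intro hpoly_cmult hpoly.add c hpoly_const hpoly_base rat_polynomial_in_of_nat S_const_rat_polynomial k)
         (use assms in auto)
  qed
  show small: "Spoly 0 (\<lambda>m. fps_nth (psi_fps_lim p s (Suc m)) j)" if "j < p"
    using that 0 1 by (cases "j = 0") (auto simp: psi_fps_lim_def intro: hpoly_const)
  show "Spoly 1 (\<lambda>m. fps_nth (psi_fps_lim p s (Suc m)) j)"
  proof (cases "j < p")
    case True
    show ?thesis by (rule hpoly_mono[OF small[OF True]]) simp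
  next
    case False
    thus ?thesis using 2[of "j - p"] assms by (simp add: psi_fps_lim_def)
  qed
qed

text \<open>The two degrees may vary with the split \<open>i\<close> of the order, so that the drop
  may come from a different factor in each summand.\<close>

lemma Spoly_fps_mult:
  assumes "\<And>i. i \<le> j \<Longrightarrow> \<exists>d d'. Spoly d (\<lambda>m. fps_nth (F m) i) \<and> Spoly d' (\<lambda>m. fps_nth (G m) (j - i)) \<and> d + d' \<le> n"
  shows "Spoly n (\<lambda>m. fps_nth (F m * G m) j)"
  unfolding fps_mult_nth
proof (rule hpoly_sum)
  fix i assume "i \<in> {0..j}"
  with assms[of i] obtain d d' where "Spoly d (\<lambda>m. fps_nth (F m) i)" "Spoly d' (\<lambda>m. fps_nth (G m) (j - i))" "d + d' \<le> n"
    by auto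
  thus "Spoly n (\<lambda>m. fps_nth (F m) i * fps_nth (G m) (j - i))" by (rule hpoly_mult_le)
qed

lemma Spoly_prod:
  assumes "finite I" "\<And>i. i \<in> I \<Longrightarrow> 1 \<le> p i" "\<And>i. i \<in> I \<Longrightarrow> s i \<in> {1, -1}"
  shows "Spoly (card I) (\<lambda>m. fps_nth (\<Prod>i\<in>I. psi_fps_lim (p i) (s i) (Suc m)) j)"
  using assms
proof (induction I arbitrary: j rule: finite_induct)
  case empty
  show ?case using rat_polynomial_in_of_nat[of _ 0] rat_polynomial_in_of_nat[of _ 1]
    by (auto simp: fps_one_nth intro: hpoly_const)
next
  case (insert i I)
  have "Spoly (card (insert i I)) (\<lambda>m. fps_nth (psi_fps_lim (p i) (s i) (Suc m) * (\<Prod>i\<in>I. psi_fps_lim (p i) (s i) (Suc m))) j)"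
  proof (rule Spoly_fps_mult)
    fix a
    show "\<exists>d d'. Spoly d (\<lambda>m. fps_nth (psi_fps_lim (p i) (s i) (Suc m)) a) \<and>
       Spoly d' (\<lambda>m. fps_nth (\<Prod>i\<in>I. psi_fps_lim (p i) (s i) (Suc m)) (j - a)) \<and> d + d' \<le> card (insert i I)"
      by (rule exI[of _ 1], rule exI[of _ "card I"], intro conjI Spoly_psi_fps_lim insert.IH)
         (use insert in auto)
  qed
  thus ?case using insert.hyps by simp
qed

text \<open>Only the coefficients of the principal part matter, and there at least one factor
  contributes its pole: this is where the degree drops.\<close>

lemma Spoly_prod_principal:
  assumes "finite I" "I \<noteq> {}" "\<And>i. i \<in> I \<Longrightarrow> 1 \<le> p i" "\<And>i. i \<in> I \<Longrightarrow> s i \<in> {1, -1}"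
    and "j < (\<Sum>i\<in>I. p i)"
  shows "Spoly (card I - 1) (\<lambda>m. fps_nth (\<Prod>i\<in>I. psi_fps_lim (p i) (s i) (Suc m)) j)"
  using assms
proof (induction I arbitrary: j rule: finite_ne_induct)
  case (singleton i)
  thus ?case using Spoly_psi_fps_lim(2)[of "p i" "s i" j] by simp
next
  case (insert i I)
  have card: "card (insert i I) - 1 = card I" using insert.hyps by simp
  have pos: "card I \<ge> 1" using insert.hyps by (simp add: Suc_leI card_gt_0_iff)
  have "Spoly (card I) (\<lambda>m. fps_nth (psi_fps_lim (p i) (s i) (Suc m) * (\<Prod>i\<in>I. psi_fps_lim (p i) (s i) (Suc m))) j)"
  proof (rule Spoly_fps_mult)
    fix a assume a: "a \<le> j"
    show "\<exists>d d'. Spoly d (\<lambda>m. fps_nth (psi_fps_lim (p i) (s i) (Suc m)) a) \<and>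
       Spoly d' (\<lambda>m. fps_nth (\<Prod>i\<in>I. psi_fps_lim (p i) (s i) (Suc m)) (j - a)) \<and> d + d' \<le> card I"
    \<comment> \<open>Either factor \<open>i\<close> stays below its pole order and has degree 0, or
      it uses up at least \<open>p i\<close> of the total order, and the remaining factors must
      supply the drop.\<close>
    proof (cases "a < p i")
      case True
      show ?thesis
        by (rule exI[of _ 0], rule exI[of _ "card I"], intro conjI Spoly_psi_fps_lim(2) Spoly_prod)
           (use insert True in auto)
    next
      case False
      have "j - a < (\<Sum>i\<in>I. p i)" using False a insert.prems(3) insert.hyps by simp
      hence "Spoly (card I - 1) (\<lambda>m. fps_nth (\<Prod>i\<in>I. psi_fps_lim (p i) (s i) (Suc m)) (j - a))"
        using insert.prems by (intro insert.IH) auto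
      thus ?thesis
        by (intro exI[of _ 1] exI[of _ "card I - 1"] conjI Spoly_psi_fps_lim(1))
           (use insert.prems pos in auto)
    qed
  qed
  thus ?case using insert.hyps by simp
qed

lemma Spoly_weight_fps: "Spoly 0 (\<lambda>m. fps_nth (weight_fps q (Suc m)) e)"
proof -
  have c: "rat_polynomial_in (Euler_sums_below k) ((-1) ^ e * of_nat ((q + e - 1) choose e))"
    using rat_polynomial_in_of_int[of _ "(-1) ^ e * of_nat ((q + e - 1) choose e)"] by simp
  have "Spoly 0 (\<lambda>m. of_int 1 ^ m / (real m + 1) ^ e)"
  proof (cases "e = 0")
    case True
    thus ?thesis using hpoly_const[OF rat_polynomial_in_of_nat[of _ 1]] by simp
  qed (intro hpoly_inverse_power; simp)
  from hpoly_cmult[OF c this] show ?thesis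
    by (simp add: weight_fps_def add_ac)
qed

lemma Spoly_res_fps_lim:
  assumes p: "\<And>i. i \<in> {1..k} \<Longrightarrow> 1 \<le> p i" and s: "\<And>i. i \<in> {1..k} \<Longrightarrow> s i \<in> {1, -1}"
    and j: "j < (\<Sum>i=1..k. p i)"
  shows "Spoly (k - 1) (\<lambda>m. fps_nth (res_fps_lim k p s q (Suc m)) j)"
  unfolding res_fps_lim_def
proof (rule Spoly_fps_mult)
  fix a assume "a \<le> j"
  hence "Spoly (card {1..k} - 1) (\<lambda>m. fps_nth (\<Prod>i=1..k. psi_fps_lim (p i) (s i) (Suc m)) a)"
    using assms k by (intro Spoly_prod_principal) auto
  hence "Spoly (k - 1) (\<lambda>m. fps_nth (\<Prod>i=1..k. psi_fps_lim (p i) (s i) (Suc m)) a)" by simp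
  thus "\<exists>d d'. Spoly d (\<lambda>m. fps_nth (\<Prod>i=1..k. psi_fps_lim (p i) (s i) (Suc m)) a) \<and>
      Spoly d' (\<lambda>m. fps_nth (weight_fps q (Suc m)) (j - a)) \<and> d + d' \<le> k - 1"
    by (intro exI[of _ "k - 1"] exI[of _ 0] conjI Spoly_weight_fps) simp_all
qed

lemma Tpoly_prod:
  assumes "finite I" "\<And>i. i \<in> I \<Longrightarrow> Tpoly 1 (u i)"
  shows "Tpoly (card I) (\<lambda>m. \<Prod>i\<in>I. u i m)"
  using assms
proof (induction I rule: finite_induct)
  case empty
  show ?case using hpoly_const[OF rat_polynomial_in_of_nat[of _ 1]] by simp
next
  case (insert i I)
  have "Tpoly (1 + card I) (\<lambda>m. u i m * (\<Prod>i\<in>I. u i m))"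
    using insert by (intro hpoly_mult) auto
  thus ?case using insert.hyps by simp
qed

text \<open>When the product is expanded, every term other than the product of the
  \<open>u i\<close> contains at least one \<open>v i\<close> and loses a degree.\<close>

lemma Tpoly_prod_leading:
  assumes "finite I" "I \<noteq> {}" "\<And>i. i \<in> I \<Longrightarrow> Tpoly 1 (u i)" "\<And>i. i \<in> I \<Longrightarrow> Tpoly 0 (v i)"
  shows "Tpoly (card I - 1) (\<lambda>m. (\<Prod>i\<in>I. u i m + v i m) - (\<Prod>i\<in>I. u i m))"
  using assms
proof (induction I rule: finite_ne_induct)
  case (insert i I)
  have pos: "card I \<ge> 1" using insert.hyps by (simp add: Suc_leI card_gt_0_iff)
  define D where "D = (\<lambda>m. (\<Prod>i\<in>I. u i m + v i m) - (\<Prod>i\<in>I. u i m))"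
  have D: "Tpoly (card I - 1) D" unfolding D_def using insert by blast
  have U: "Tpoly (card I) (\<lambda>m. \<Prod>i\<in>I. u i m)" using insert by (intro Tpoly_prod) auto
  have ui: "Tpoly 1 (u i)" and vi: "Tpoly 0 (v i)" using insert by auto
  have "Tpoly (card I) (\<lambda>m. (u i m * D m + v i m * D m) + v i m * (\<Prod>i\<in>I. u i m))"
    by (intro hpoly.add hpoly_mult_le[OF ui D] hpoly_mult_le[OF vi D] hpoly_mult_le[OF vi U]) (use pos in auto)
  also have "(\<lambda>m. (u i m * D m + v i m * D m) + v i m * (\<Prod>i\<in>I. u i m)) =
      (\<lambda>m. (\<Prod>i\<in>insert i I. u i m + v i m) - (\<Prod>i\<in>insert i I. u i m))"
    using insert.hyps by (simp add: D_def algebra_simps)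
  finally show ?case using insert.hyps by simp
qed simp

text \<open>Isolates the term with all \<open>k\<close> harmonic numbers in the values at
  \<open>-(m + 1/2)\<close> and \<open>m + 1/2\<close>. In the second, \<open>h_harm\<close> is
  moved from \<open>Suc m\<close> to \<open>m\<close>; the added term has degree 0 and, as
  \<open>p i \<ge> 1\<close>, its sign is accompanied by a positive power of
  \<open>1 / (m + 1/2)\<close>.\<close>

lemma T_side:
  fixes s :: "nat \<Rightarrow> int"
  assumes p: "\<And>i. i \<in> {1..k} \<Longrightarrow> 1 \<le> p i" and s: "\<And>i. i \<in> {1..k} \<Longrightarrow> s i \<in> {1, -1}"
  defines "h \<equiv> \<lambda>m. \<Prod>i=1..k. h_harm (p i) (s i) m"
  shows "Tpoly (k - 1) (\<lambda>m. (\<Prod>i=1..k. T_const (p i) (s i) - h_harm (p i) (s i) m) - (-1) ^ k * h m)"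
    and "Tpoly (k - 1) (\<lambda>m. (\<Prod>i=1..k. T_const (p i) (s i) + (-1) ^ p i * of_int (s i) * h_harm (p i) (s i) (Suc m))
           - (-1) ^ (\<Sum>i=1..k. p i) * (\<Prod>i=1..k. of_int (s i)) * h m)"
proof -
  have hp: "Tpoly 1 (\<lambda>m. c * h_harm (p i) (s i) m)" if "i \<in> {1..k}" "rat_polynomial_in (Euler_sums_below k) c" for i c
    using p s that by (intro hpoly_cmult hpoly_base) auto
  have Tc: "Tpoly 0 (\<lambda>m. T_const (p i) (s i))" if "i \<in> {1..k}" for i
    using p s that k by (intro hpoly_const T_const_rat_polynomial) auto
  have m1: "rat_polynomial_in (Euler_sums_below k) (-1)"
    using rat_polynomial_in_of_int[of _ "-1"] by simp
  have "Tpoly (card {1..k} - 1) (\<lambda>m. (\<Prod>i=1..k. (- 1) * h_harm (p i) (s i) m + T_const (p i) (s i)) -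
                                 (\<Prod>i=1..k. (- 1) * h_harm (p i) (s i) m))"
    using k by (intro Tpoly_prod_leading hp Tc m1) auto
  moreover have "(\<Prod>i=1..k. (- 1) * h_harm (p i) (s i) m) = (-1) ^ k * h m" for m
    unfolding prod.distrib h_def by simp
  moreover have "(- 1) * h_harm (p i) (s i) m + T_const (p i) (s i) = T_const (p i) (s i) - h_harm (p i) (s i) m" for i m
    by simp
  ultimately show "Tpoly (k - 1) (\<lambda>m. (\<Prod>i=1..k. T_const (p i) (s i) - h_harm (p i) (s i) m) - (-1) ^ k * h m)"
    by (simp only: card_atLeastAtMost diff_Suc_1 add_Suc_right)
  define c where "c = (\<lambda>i. (-1) ^ p i * real_of_int (s i))"
  have c: "rat_polynomial_in (Euler_sums_below k) (c i)" for i
    using rat_polynomial_in_of_int[of _ "(-1) ^ p i * s i"] by (simp add: c_def)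
  have b: "Tpoly 0 (\<lambda>m. T_const (p i) (s i) + c i * (of_int (s i) ^ m / (real m + 1/2) ^ p i))" if "i \<in> {1..k}" for i
    using p s that by (intro hpoly.add Tc hpoly_cmult c hpoly_inverse_power) auto
  have "Tpoly (card {1..k} - 1) (\<lambda>m. (\<Prod>i=1..k. c i * h_harm (p i) (s i) m +
            (T_const (p i) (s i) + c i * (of_int (s i) ^ m / (real m + 1/2) ^ p i))) -
            (\<Prod>i=1..k. c i * h_harm (p i) (s i) m))"
    using k by (intro Tpoly_prod_leading hp b c) auto
  moreover have "(\<Prod>i=1..k. c i * h_harm (p i) (s i) m) = (-1) ^ (\<Sum>i=1..k. p i) * (\<Prod>i=1..k. of_int (s i)) * h m" for m
    unfolding prod.distrib h_def c_def by (simp add: power_sum)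
  moreover have "c i * h_harm (p i) (s i) m + (T_const (p i) (s i) + c i * (of_int (s i) ^ m / (real m + 1/2) ^ p i)) =
       T_const (p i) (s i) + (-1) ^ p i * of_int (s i) * h_harm (p i) (s i) (Suc m)" for i m
    by (simp add: h_harm_Suc c_def algebra_simps)
  ultimately show "Tpoly (k - 1) (\<lambda>m. (\<Prod>i=1..k. T_const (p i) (s i) + (-1) ^ p i * of_int (s i) * h_harm (p i) (s i) (Suc m))
           - (-1) ^ (\<Sum>i=1..k. p i) * (\<Prod>i=1..k. of_int (s i)) * h m)"
    by (simp only: card_atLeastAtMost diff_Suc_1 add_Suc_right)
qed

end

section \<open>Assembling the two evaluations\<close>

lemma half_not_Nats: "real m + 1/2 \<notin> \<nat>" "- (real m + 1/2) \<notin> \<nat>"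
proof -
  show "real m + 1/2 \<notin> \<nat>"
  proof
    assume "real m + 1/2 \<in> \<nat>"
    then obtain n where "real m + 1/2 = real n" by (auto simp: Nats_def)
    hence "2 * real m + 1 = 2 * real n" by linarith
    hence "2 * m + 1 = 2 * n" by linarith
    thus False by presburger
  qed
  show "- (real m + 1/2) \<notin> \<nat>"
    by (auto simp: Nats_def)
qed

text \<open>The summand combines the values of \<open>F\<close> at \<open>r + 1/2\<close> and
  \<open>-(r + 1/2)\<close>. Once these are expanded over the poles, the finite sum over
  \<open>r < N\<close> may be taken inside the series, where it becomes \<open>half_kernel\<close>;
  \<open>signed_kernel_limit\<close> then performs the limit in \<open>N\<close>.\<close>

lemma kernel_sum_limit:
  fixes s :: "nat \<Rightarrow> int" and \<sigma> :: int
  assumes k: "k \<ge> 1" and p: "\<And>i. i \<in> {1..k} \<Longrightarrow> 1 \<le> p i" and s: "\<And>i. i \<in> {1..k} \<Longrightarrow> s i \<in> {1, -1}"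
    and q: "q \<ge> 1" "\<sigma> \<in> {1, -1}" "(q, \<sigma>) \<noteq> (1, 1)"
  defines "w \<equiv> \<lambda>m. of_int \<sigma> * (\<Prod>i=1..k. T_const (p i) (s i) + (-1) ^ p i * of_int (s i) * h_harm (p i) (s i) (Suc m))
       + (-1) ^ q * (\<Prod>i=1..k. T_const (p i) (s i) - h_harm (p i) (s i) m)"
  shows "\<exists>V. rat_polynomial_in (Euler_sums_below k) V \<and> (\<lambda>N. \<Sum>r<N. of_int \<sigma> ^ r * w r / (real r + 1/2) ^ q) \<longlonglongrightarrow> V"
proof -
  define P where "P = (\<Sum>i=1..k. p i)"
  define \<epsilon> where "\<epsilon> = (\<Prod>i=1..k. s i)"
  define e where "e = (\<Prod>i=1..k. real_of_int (s i))"
  \<comment> \<open>Chosen so that \<open>t\<close> compensates the sign \<open>e\<close> coming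
    from the \<open>psi\<close> factors and leaves \<open>\<sigma>\<close>.\<close>
  define t where "t = \<epsilon> * \<sigma>"
  define R where "R = (\<lambda>n. fps_nth (res_fps_lim k p s q n))"
  have e_eq: "e = of_int \<epsilon>" by (simp add: e_def \<epsilon>_def)
  have \<epsilon>: "\<epsilon> \<in> {1, -1}"
  proof -
    have "\<bar>\<epsilon>\<bar> = 1" unfolding \<epsilon>_def abs_prod
    proof (intro prod.neutral ballI)
      fix i assume "i \<in> {1..k}"
      from s[OF this] show "\<bar>s i\<bar> = 1" by auto
    qed
    thus ?thesis by auto
  qed
  have t: "t \<in> {1, -1}" using \<epsilon> q(2) by (auto simp: t_def)
  have te: "of_int t * e = of_int \<sigma>" using \<epsilon> by (auto simp: t_def e_eq)
  have et: "e = of_int \<sigma> * of_int t" using \<epsilon> q(2) by (auto simp: t_def e_eq)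
  define a where "a = (\<lambda>d m. e ^ Suc m * R (Suc m) (P - 1 - d) / (real m + 1) ^ q)"
  define Lp where "Lp = (\<lambda>m i. of_int (s i) ^ Suc m * (T_const (p i) (s i) + (-1) ^ p i * of_int (s i) * h_harm (p i) (s i) (Suc m)))"
  define Ln where "Ln = (\<lambda>m i. of_int (s i) ^ m * (T_const (p i) (s i) - h_harm (p i) (s i) m))"
  have limp: "(\<lambda>M. psi M (p i) (s i) (real r + 1/2)) \<longlonglongrightarrow> Lp r i" if "i \<in> {1..k}" for r i
    unfolding Lp_def by (rule psi_tendsto_pos[OF p[OF that] s[OF that]])
  have limn: "(\<lambda>M. psi M (p i) (s i) (- (real r + 1/2))) \<longlonglongrightarrow> Ln r i" if "i \<in> {1..k}" for r i
    unfolding Ln_def by (rule psi_tendsto_neg[OF p[OF that] s[OF that]])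
  note mlp = mittag_leffler[where p = p and s = s, OF k p s q(1) half_not_Nats(1) limp]
  note mln = mittag_leffler[where p = p and s = s, OF k p s q(1) half_not_Nats(2) limn]
  have sp: "summable (\<lambda>m. a d m / (real r + 1/2 - (real m + 1)) ^ (d + 1))" for r d
    unfolding a_def P_def e_def R_def by (rule mlp(1)) auto
  have sn: "summable (\<lambda>m. a d m / (- (real r + 1/2) - (real m + 1)) ^ (d + 1))" for r d
    unfolding a_def P_def e_def R_def by (rule mln(1)) auto
  have fp: "(\<Prod>i=1..k. Lp r i) / (real r + 1/2) ^ q = (\<Sum>d<P+q. R 0 (P + q - 1 - d) / (real r + 1/2) ^ (d + 1)) +
       (\<Sum>d<P. \<Sum>m. a d m / (real r + 1/2 - (real m + 1)) ^ (d + 1))" for r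
    unfolding a_def P_def e_def R_def by (rule mlp(2)) auto
  have fn: "(\<Prod>i=1..k. Ln r i) / (- (real r + 1/2)) ^ q = (\<Sum>d<P+q. R 0 (P + q - 1 - d) / (- (real r + 1/2)) ^ (d + 1)) +
       (\<Sum>d<P. \<Sum>m. a d m / (- (real r + 1/2) - (real m + 1)) ^ (d + 1))" for r
    unfolding a_def P_def e_def R_def by (rule mln(2)) auto
  \<comment> \<open>The powers of \<open>e\<close> and \<open>t\<close> combine to
    \<open>\<sigma> ^ r\<close>. The exponent \<open>Suc r\<close> on the positive side leaves the
    extra \<open>\<sigma>\<close> in \<open>w\<close>, and \<open>(-1) ^ q\<close> comes from the
    \<open>q\<close>-th power of a negative number.\<close>
  have wr: "of_int \<sigma> ^ r * w r / (real r + 1/2) ^ q =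
      of_int t ^ Suc r * ((\<Prod>i=1..k. Lp r i) / (real r + 1/2) ^ q) + of_int t ^ r * ((\<Prod>i=1..k. Ln r i) / (- (real r + 1/2)) ^ q)" for r
  proof -
    have pp: "(\<Prod>i=1..k. Lp r i) = e ^ Suc r * (\<Prod>i=1..k. T_const (p i) (s i) + (-1) ^ p i * of_int (s i) * h_harm (p i) (s i) (Suc r))"
      unfolding Lp_def prod.distrib e_def prod_power_distrib ..
    have nn: "(\<Prod>i=1..k. Ln r i) = e ^ r * (\<Prod>i=1..k. T_const (p i) (s i) - h_harm (p i) (s i) r)"
      unfolding Ln_def prod.distrib e_def prod_power_distrib ..
    have te': "of_int t ^ n * (e ^ n * y) = of_int \<sigma> ^ n * y" for n y
      unfolding te [symmetric] by (simp add: power_mult_distrib)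
    have neg: "y / (- (real r + 1/2)) ^ q = (-1) ^ q * y / (real r + 1/2) ^ q" for y
      using inverse_minus_power[of "real r + 1/2" q]
      by (metis (no_types, opaque_lifting) mult.commute mult.right_neutral times_divide_eq_right)
    have "of_int \<sigma> ^ r * (of_int \<sigma> * X + c * Y) / D =
        of_int t ^ Suc r * (e ^ Suc r * X / D) + of_int t ^ r * (c * (e ^ r * Y) / D)" for X Y c D :: real
    proof -
      have 1: "of_int t ^ Suc r * (e ^ Suc r * X / D) = of_int \<sigma> ^ Suc r * (X / D)"
        using te'[of "Suc r" "X / D"] by (simp only: times_divide_eq_right)
      have "of_int t ^ r * (c * (e ^ r * Y) / D) = c * (of_int t ^ r * (e ^ r * (Y / D)))" by simp
      hence 2: "of_int t ^ r * (c * (e ^ r * Y) / D) = c * (of_int \<sigma> ^ r * (Y / D))" unfolding te' .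
      show ?thesis unfolding 1 2 by (simp add: distrib_left add_divide_distrib mult_ac)
    qed
    thus ?thesis unfolding pp nn neg w_def .
  qed
  have key: "(\<Sum>r<N. of_int \<sigma> ^ r * w r / (real r + 1/2) ^ q) =
      (\<Sum>d<P+q. R 0 (P + q - 1 - d) * signed_kernel t d N 0) + (\<Sum>d<P. \<Sum>m. a d m * half_kernel t d N (Suc m))" for N
  proof -
    have "(\<Sum>r<N. of_int \<sigma> ^ r * w r / (real r + 1/2) ^ q) =
       (\<Sum>r<N. of_int t ^ Suc r * (\<Sum>d<P+q. R 0 (P + q - 1 - d) / (real r + 1/2) ^ (d + 1)) +
               of_int t ^ r * (\<Sum>d<P+q. R 0 (P + q - 1 - d) / (- (real r + 1/2)) ^ (d + 1))) +
       (\<Sum>r<N. of_int t ^ Suc r * (\<Sum>d<P. \<Sum>m. a d m / (real r + 1/2 - (real m + 1)) ^ (d + 1)) +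
               of_int t ^ r * (\<Sum>d<P. \<Sum>m. a d m / (- (real r + 1/2) - (real m + 1)) ^ (d + 1)))"
      unfolding wr fp fn sum.distrib [symmetric] by (intro sum.cong refl) (simp only: distrib_left add_ac)
    also have "(\<Sum>r<N. of_int t ^ Suc r * (\<Sum>d<P+q. R 0 (P + q - 1 - d) / (real r + 1/2) ^ (d + 1)) +
               of_int t ^ r * (\<Sum>d<P+q. R 0 (P + q - 1 - d) / (- (real r + 1/2)) ^ (d + 1))) =
         (\<Sum>d<P+q. R 0 (P + q - 1 - d) * signed_kernel t d N 0)"
      unfolding sum_distrib_left sum.distrib [symmetric]
      by (subst sum.swap)
         (simp add: signed_kernel_def half_kernel_def sum_distrib_left distrib_left sum.distrib mult_ac)
    also have "(\<Sum>r<N. of_int t ^ Suc r * (\<Sum>d<P. \<Sum>m. a d m / (real r + 1/2 - (real m + 1)) ^ (d + 1)) +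
               of_int t ^ r * (\<Sum>d<P. \<Sum>m. a d m / (- (real r + 1/2) - (real m + 1)) ^ (d + 1))) =
         (\<Sum>d<P. \<Sum>r<N. of_int t ^ Suc r * (\<Sum>m. a d m / (real r + 1/2 - (real m + 1)) ^ (d + 1)) +
               of_int t ^ r * (\<Sum>m. a d m / (- (real r + 1/2) - (real m + 1)) ^ (d + 1)))"
      unfolding sum_distrib_left sum.distrib [symmetric] by (rule sum.swap)
    also have "\<dots> = (\<Sum>d<P. \<Sum>m. a d m * half_kernel t d N (Suc m))"
    proof (intro sum.cong refl)
      fix d
      define f where "f = (\<lambda>r m. of_int t ^ Suc r * (a d m / (real r + 1/2 - (real m + 1)) ^ (d + 1)) +
           of_int t ^ r * (a d m / (- (real r + 1/2) - (real m + 1)) ^ (d + 1)))"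
      have f: "f r sums (of_int t ^ Suc r * (\<Sum>m. a d m / (real r + 1/2 - (real m + 1)) ^ (d + 1)) +
               of_int t ^ r * (\<Sum>m. a d m / (- (real r + 1/2) - (real m + 1)) ^ (d + 1)))" for r
        unfolding f_def by (intro sums_add sums_mult summable_sums sp sn)
      have "(\<lambda>m. \<Sum>r<N. f r m) sums (\<Sum>r<N. of_int t ^ Suc r * (\<Sum>m. a d m / (real r + 1/2 - (real m + 1)) ^ (d + 1)) +
               of_int t ^ r * (\<Sum>m. a d m / (- (real r + 1/2) - (real m + 1)) ^ (d + 1)))"
        by (intro sums_sum f)
      moreover have "(\<Sum>r<N. f r m) = a d m * half_kernel t d N (Suc m)" for m
        unfolding f_def half_kernel_def sum_distrib_left
        by (intro sum.cong refl) (simp add: distrib_left add_ac mult_ac)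
      ultimately show "(\<Sum>r<N. of_int t ^ Suc r * (\<Sum>m. a d m / (real r + 1/2 - (real m + 1)) ^ (d + 1)) +
               of_int t ^ r * (\<Sum>m. a d m / (- (real r + 1/2) - (real m + 1)) ^ (d + 1))) =
           (\<Sum>m. a d m * half_kernel t d N (Suc m))"
        by (simp add: sums_iff)
    qed
    finally show ?thesis .
  qed
  \<comment> \<open>The sign \<open>e ^ Suc m\<close> equals
    \<open>\<sigma> ^ m * \<sigma> * t ^ Suc m\<close>: the middle factor is put into
    \<open>u\<close>, the last one completes \<open>half_kernel\<close> to
    \<open>signed_kernel\<close>.\<close>
  define u where "u = (\<lambda>d m. of_int \<sigma> * R (Suc m) (P - 1 - d))"
  have P: "P > 0"
    unfolding P_def using k p[of 1] by (intro sum_pos2[of _ 1]) auto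
  have u: "hpoly (Euler_sums_below k) H_seq (\<lambda>m. real m + 1) (k - 1) (u d)" for d
    unfolding u_def R_def
    by (intro hpoly_cmult rat_polynomial_in_of_int Spoly_res_fps_lim k p s) (use P in \<open>auto simp: P_def\<close>)
  have ak: "a d m * half_kernel t d N (Suc m) = of_int \<sigma> ^ m * u d m * signed_kernel t d N (Suc m) / (real m + 1) ^ q" for d m N
  proof -
    have e_pow: "e ^ Suc m = of_int \<sigma> ^ m * (of_int \<sigma> * of_int t ^ Suc m)"
      unfolding et by (simp add: power_mult_distrib)
    show ?thesis
      unfolding a_def u_def signed_kernel_def e_pow by (simp add: mult_ac del: power_Suc)
  qed
  define V where "V = (\<Sum>d<P+q. R 0 (P + q - 1 - d) * kernel_lim t d) +
     (\<Sum>d<P. kernel_lim t d * (\<Sum>m. of_int \<sigma> ^ m * u d m / (real m + 1) ^ q))"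
  have "(\<lambda>N. \<Sum>r<N. of_int \<sigma> ^ r * w r / (real r + 1/2) ^ q) \<longlonglongrightarrow> V"
    unfolding key ak V_def
    by (intro tendsto_add tendsto_sum tendsto_mult_left signed_kernel_tendsto t signed_kernel_limit hpoly_S_slow[OF u] q)
  moreover have "rat_polynomial_in (Euler_sums_below k) V"
    unfolding V_def R_def using k
    by (intro rat_polynomial_in_add rat_polynomial_in_sum rat_polynomial_in_mult kernel_lim_rat_polynomial t
        res_fps_lim_0_rat_polynomial p s hpoly_S_value[OF u] q) auto
  ultimately show ?thesis by blast
qed

theorem theorem5p1:
  fixes k q :: nat and p :: "nat \<Rightarrow> nat" and s :: "nat \<Rightarrow> int" and \<sigma> :: int
  assumes "1 \<le> k"
    and "\<And>i. i \<in> {1..k} \<Longrightarrow> 1 \<le> p i"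
    and "1 \<le> q"
    and "\<And>i. i \<in> {1..k} \<Longrightarrow> s i \<in> {1, -1}"
    and "\<sigma> \<in> {1, -1}"
    and "(q, \<sigma>) \<noteq> (1, 1)"
    and "even ((\<Sum>i=1..k. p i) + q + k) \<longleftrightarrow> even ((1 - (\<Prod>i=1..k. s i) * \<sigma>) div 2)"
  shows "rat_polynomial_in (Euler_sums_below k) (Euler_T_sum k p s q \<sigma>)"
proof -
  note k = assms(1) and p = assms(2) and s = assms(4) and q = assms(3,5,6)
  define P where "P = (\<Sum>i=1..k. p i)"
  define \<epsilon> where "\<epsilon> = (\<Prod>i=1..k. s i)"
  define h where "h = (\<lambda>m. \<Prod>i=1..k. h_harm (p i) (s i) m)"
  define Ap where "Ap = (\<lambda>m. \<Prod>i=1..k. T_const (p i) (s i) + (-1) ^ p i * of_int (s i) * h_harm (p i) (s i) (Suc m))"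
  define An where "An = (\<lambda>m. \<Prod>i=1..k. T_const (p i) (s i) - h_harm (p i) (s i) m)"
  define w where "w = (\<lambda>m. of_int \<sigma> * Ap m + (-1) ^ q * An m)"
  have "\<exists>V. rat_polynomial_in (Euler_sums_below k) V \<and>
      (\<lambda>N. \<Sum>r<N. of_int \<sigma> ^ r * w r / (real r + 1/2) ^ q) \<longlonglongrightarrow> V"
    unfolding w_def Ap_def An_def by (rule kernel_sum_limit[OF k _ _ q]) (use p s in auto)
  then obtain V where V: "rat_polynomial_in (Euler_sums_below k) V"
      "(\<lambda>N. \<Sum>r<N. of_int \<sigma> ^ r * w r / (real r + 1/2) ^ q) \<longlonglongrightarrow> V" by blast
  have \<epsilon>: "\<epsilon> \<in> {1, -1}"
  proof -
    have "\<bar>\<epsilon>\<bar> = 1" unfolding \<epsilon>_def abs_prod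
    proof (intro prod.neutral ballI)
      fix i assume "i \<in> {1..k}"
      from s[OF this] show "\<bar>s i\<bar> = 1" by auto
    qed
    thus ?thesis by auto
  qed
  \<comment> \<open>What is left of \<open>w\<close> after the leading terms of both values are
    removed; by \<open>T_side\<close> its degree is at most \<open>k - 1\<close>.\<close>
  define lower where "lower = (\<lambda>m. of_int \<sigma> * (Ap m - (-1) ^ P * of_int \<epsilon> * h m) + (-1) ^ q * (An m - (-1) ^ k * h m))"
  \<comment> \<open>The parity hypothesis amounts to
    \<open>\<epsilon> * \<sigma> = (-1) ^ (P + q + k)\<close>, so the two leading coefficients
    agree; with the opposite parity their sum would be 0.\<close>
  have sign: "of_int \<sigma> * ((-1) ^ P * of_int \<epsilon>) + (-1) ^ q * (-1) ^ k = (2 * (-1) ^ (q + k) :: real)"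
  proof -
    have "even (P + q + k) \<longleftrightarrow> \<epsilon> * \<sigma> = 1"
      using assms(7) \<epsilon> q(2) unfolding P_def \<epsilon>_def by auto
    moreover have "(\<epsilon> * \<sigma> = 1 \<and> \<sigma> * \<epsilon> = 1) \<or> (\<epsilon> * \<sigma> = -1 \<and> \<sigma> * \<epsilon> = -1)" using \<epsilon> q(2) by auto
    ultimately have "of_int (\<sigma> * \<epsilon>) * (-1) ^ P = ((-1) ^ (q + k) :: real)"
      by (cases "even P"; cases "even q"; cases "even k") auto
    thus ?thesis by (simp add: power_add mult_ac)
  qed
  have w_eq: "w m = (2 * (-1) ^ (q + k)) * h m + lower m" for m
    unfolding sign [symmetric] by (simp add: w_def lower_def algebra_simps)
  have mq: "rat_polynomial_in (Euler_sums_below k) ((-1) ^ q)"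
    using rat_polynomial_in_of_int[of _ "(-1) ^ q"] by simp
  have lower: "hpoly (Euler_sums_below k) h_harm (\<lambda>m. real m + 1/2) (k - 1) lower"
    unfolding lower_def Ap_def An_def P_def \<epsilon>_def h_def of_int_prod
    by (intro hpoly.add hpoly_cmult T_side k p s mq rat_polynomial_in_of_int)
  have h: "slow h"
    unfolding h_def
  proof (rule hpoly_T_slow)
    show "hpoly (Euler_sums_below k) h_harm (\<lambda>m. real m + 1/2) (card {1..k}) (\<lambda>m. \<Prod>i=1..k. h_harm (p i) (s i) m)"
      using p s by (intro Tpoly_prod k hpoly_base) auto
  qed
  define S where "S = (\<Sum>m. of_int \<sigma> ^ m * lower m / (real m + 1/2) ^ q)"
  have T: "Euler_T_sum k p s q \<sigma> = (\<Sum>m. of_int \<sigma> ^ m * h m / (real m + 1/2) ^ q)"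
    unfolding Euler_T_sum_def Euler_T_term_def h_def by (simp add: algebra_simps)
  have "(\<lambda>m. of_int \<sigma> ^ m * h m / (real m + 1/2) ^ q) sums Euler_T_sum k p s q \<sigma>"
    unfolding T by (intro summable_sums slow_summable h q) auto
  moreover have "(\<lambda>m. of_int \<sigma> ^ m * lower m / (real m + 1/2) ^ q) sums S"
    unfolding S_def by (intro summable_sums slow_summable hpoly_T_slow[OF lower] q) auto
  ultimately have "(\<lambda>m. (2 * (-1) ^ (q + k)) * (of_int \<sigma> ^ m * h m / (real m + 1/2) ^ q) + of_int \<sigma> ^ m * lower m / (real m + 1/2) ^ q)
      sums ((2 * (-1) ^ (q + k)) * Euler_T_sum k p s q \<sigma> + S)"
    by (intro sums_add sums_mult)
  moreover have "(2 * (-1) ^ (q + k)) * (of_int \<sigma> ^ m * h m / (real m + 1/2) ^ q) + of_int \<sigma> ^ m * lower m / (real m + 1/2) ^ q =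
      of_int \<sigma> ^ m * w m / (real m + 1/2) ^ q" for m
    unfolding w_eq by (simp add: distrib_left add_divide_distrib mult_ac)
  \<comment> \<open>The same partial sums tend to \<open>V\<close> by the expansion over the poles
    and to the right-hand side by direct summation.\<close>
  ultimately have "V = (2 * (-1) ^ (q + k)) * Euler_T_sum k p s q \<sigma> + S"
    using V(2) LIMSEQ_unique unfolding sums_def by simp
  moreover have "((-1) ^ (q + k) / 2) * (2 * (-1) ^ (q + k)) = (1 :: real)"
    by (simp flip: power_mult_distrib)
  ultimately have "Euler_T_sum k p s q \<sigma> = of_rat ((-1) ^ (q + k) / 2) * (V - S)"
    by (simp add: of_rat_divide of_rat_power of_rat_minus)
  moreover have "rat_polynomial_in (Euler_sums_below k) S"
    unfolding S_def using k by (intro hpoly_T_value[OF lower] q) auto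
  ultimately show ?thesis
    using V(1) by (simp only: rat_polynomial_in_mult rat_polynomial_in_of_rat rat_polynomial_in_diff)
qed

end
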